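(* Let $K\in\mathcal S^n_o$, $\varphi\in\Phi\cap C^1[0,\infty)$ and $T\in\mathrm{SL}(n)$. Then the following assertions are equivalent: (1) $\mathrm L_\varphi\left(O_\varphi(K,TB)^{-1}K\right)=TB$; (2) $\overline{\mathrm L}_\varphi K=TB$; (3) $\mathrm L_\varphi^\diamond\left(O_\varphi(T^{-1}K,B)^{-1}T^{-1}K\right)=B$; (4) the measure $\mu_\varphi\left(O_\varphi(T^{-1}K,B)^{-1}T^{-1}K,\cdot\right)$ is isotropic on $S^{n-1}$.
   Context: Work in $\mathbb R^n$; $V$ is volume, $B$ the Euclidean unit ball, $\omega_n=V(B)$, $S$ spherical Lebesgue measure on the unit sphere $S^{n-1}$. $\Phi$ is the class of convex, strictly increasing functions $\varphi:[0,\infty)\to[0,\infty)$ with $\varphi(0)=0$. For a compact set $K$ that is star-shaped about the origin, the radial function is $\rho_K(x)=\sup\{\lambda\ge0:\lambda x\in K\}$, $x\ne o$; $\mathcal S^n_o$ is the class of star bodies about the origin $o$, i.e. compact sets $K$ with $\lambda x\in K$ for all $x\in K,\lambda\in[0,1]$, with $o\in\operatorname{int}K$ and $\rho_K$ continuous on $S^{n-1}$. $\mathcal E^n$ is the class of (nondegenerate, $n$-dimensional) origin-symmetric ellipsoids. $d\tilde V_K=\frac{\rho_K^n}{n}dS$ and $V_K^*=\tilde V_K/V(K)$ are measures on $S^{n-1}$. For $K,L\in\mathcal S^n_o$, $$\tilde V_\varphi(K,L)=\int_{S^{n-1}}\varphi\left(\frac{\rho_K}{\rho_L}\right)d\tilde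 V_K,\qquad O_\varphi(K,L)=\inf\left\{\lambda>0:\ \varphi^{-1}\left(\int_{S^{n-1}}\varphi\left(\frac{\rho_K}{\lambda\rho_L}\right)dV_K^*\right)\le1\right\}.$$ The following minimizers exist and are unique. $\mathrm L_\varphi K$ (Orlicz-Legendre ellipsoid): the $E\in\mathcal E^n$ minimizing $V(E)$ subject to $O_\varphi(K,E)\le1$. $\overline{\mathrm L}_\varphi K$ (normalized Orlicz-Legendre ellipsoid): the $E\in\mathcal E^n$ minimizing $O_\varphi(K,E)$ subject to $V(E)=\omega_n$. $\mathrm L^\diamond_\varphi K$: the $E\in\mathcal E^n$ minimizing $\tilde V_\varphi(K,E)$ subject to $V(E)=\omega_n$. For $\varphi\in\Phi\cap C^1[0,\infty)$, $\mu_\varphi(K,\cdot)$ is the Borel measure on $S^{n-1}$ with $d\mu_\varphi(K,\cdot)=\varphi'(\rho_K)\rho_K^{n+1}\,dS$. A finite positive Borel measure $\mu$ on $S^{n-1}$ with total mass $|\mu|$ is isotropic if $\frac n{|\mu|}\int_{S^{n-1}}(u\cdot v)^2\,d\mu(u)=1$ for all $v\in S^{n-1}$. *)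

theory Defs
  imports "HOL-Analysis.Analysis"
begin

(* The class \<Phi>. Functions on [0,\<infinity>) are modelled by total functions on the reals whose values
   on the negative half-line are irrelevant. *)
definition orlicz_functions :: "(real \<Rightarrow> real) set" where
  "orlicz_functions = {\<phi>. (\<forall>t\<ge>0. 0 \<le> \<phi> t) \<and> convex_on {0..} \<phi> \<and>
     strict_mono_on {0..} \<phi> \<and> \<phi> 0 = 0}"

(* Derivative relative to [0,\<infinity>): one-sided at 0, the ordinary derivative on (0,\<infinity>). *)
definition half_line_deriv :: "(real \<Rightarrow> real) \<Rightarrow> real \<Rightarrow> real" where
  "half_line_deriv \<phi> t = vector_derivative \<phi> (at t within {0..})"

definition C1_half_line :: "(real \<Rightarrow> real) set" where
  "C1_half_line = {\<phi>. (\<forall>t\<ge>0. \<phi> differentiable (at t within {0..})) \<and>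
     continuous_on {0..} (half_line_deriv \<phi>)}"

definition radial_fun :: "(real^'n) set \<Rightarrow> real^'n \<Rightarrow> real" where
  "radial_fun K x = Sup {l. 0 \<le> l \<and> l *\<^sub>R x \<in> K}"

definition star_bodies :: "(real^'n) set set" where
  "star_bodies = {K. compact K \<and> (\<forall>x\<in>K. \<forall>l\<in>{0..1}. l *\<^sub>R x \<in> K) \<and> 0 \<in> interior K \<and>
     continuous_on (sphere 0 1) (radial_fun K)}"

abbreviation unit_ball :: "(real^'n) set" where
  "unit_ball \<equiv> cball 0 1"

abbreviation lin_image :: "real^'n^'n \<Rightarrow> (real^'n) set \<Rightarrow> (real^'n) set" where
  "lin_image A K \<equiv> (\<lambda>x. A *v x) ` K"

abbreviation dilate :: "real \<Rightarrow> (real^'n) set \<Rightarrow> (real^'n) set" where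
  "dilate c K \<equiv> (\<lambda>x. c *\<^sub>R x) ` K"

abbreviation volume :: "(real^'n) set \<Rightarrow> real" where
  "volume K \<equiv> measure lebesgue K"

definition ellipsoids :: "(real^'n) set set" where
  "ellipsoids = {lin_image A unit_ball | A. invertible A}"

(* Spherical Lebesgue measure, a Borel measure on the unit sphere: the measure of A is n times the
   volume of the cone {r u | 0 < r \<le> 1, u \<in> A}. Recall sgn x = x / |x|. *)
definition spherical_measure :: "(real^'n) measure" where
  "spherical_measure = scale_measure (of_nat CARD('n))
     (distr (restrict_space lborel (cball 0 1 - {0})) (restrict_space borel (sphere 0 1)) sgn)"

definition dual_cone_measure :: "(real^'n) set \<Rightarrow> (real^'n) measure" where
  "dual_cone_measure K =
     density spherical_measure (\<lambda>u. ennreal (radial_fun K u ^ CARD('n) / real CARD('n)))"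

definition normalized_dual_cone_measure :: "(real^'n) set \<Rightarrow> (real^'n) measure" where
  "normalized_dual_cone_measure K = scale_measure (ennreal (1 / volume K)) (dual_cone_measure K)"

definition dual_orlicz_mixed_volume ::
    "(real \<Rightarrow> real) \<Rightarrow> (real^'n) set \<Rightarrow> (real^'n) set \<Rightarrow> real" where
  "dual_orlicz_mixed_volume \<phi> K L =
     (\<integral>u. \<phi> (radial_fun K u / radial_fun L u) \<partial>dual_cone_measure K)"

definition O_functional :: "(real \<Rightarrow> real) \<Rightarrow> (real^'n) set \<Rightarrow> (real^'n) set \<Rightarrow> real" where
  "O_functional \<phi> K L = Inf {l. 0 < l \<and>
     inv_into {0..} \<phi>
       (\<integral>u. \<phi> (radial_fun K u / (l * radial_fun L u)) \<partial>normalized_dual_cone_measure K) \<le> 1}"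

definition orlicz_legendre :: "(real \<Rightarrow> real) \<Rightarrow> (real^'n) set \<Rightarrow> (real^'n) set" where
  "orlicz_legendre \<phi> K =
     (THE E. is_arg_min volume (\<lambda>E. E \<in> ellipsoids \<and> O_functional \<phi> K E \<le> 1) E)"

definition normalized_orlicz_legendre :: "(real \<Rightarrow> real) \<Rightarrow> (real^'n) set \<Rightarrow> (real^'n) set" where
  "normalized_orlicz_legendre \<phi> K =
     (THE E. is_arg_min (O_functional \<phi> K)
       (\<lambda>E. E \<in> ellipsoids \<and> volume E = volume (unit_ball :: (real^'n) set)) E)"

definition diamond_orlicz_legendre :: "(real \<Rightarrow> real) \<Rightarrow> (real^'n) set \<Rightarrow> (real^'n) set" where
  "diamond_orlicz_legendre \<phi> K =
     (THE E. is_arg_min (dual_orlicz_mixed_volume \<phi> K)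
       (\<lambda>E. E \<in> ellipsoids \<and> volume E = volume (unit_ball :: (real^'n) set)) E)"

definition mu_measure :: "(real \<Rightarrow> real) \<Rightarrow> (real^'n) set \<Rightarrow> (real^'n) measure" where
  "mu_measure \<phi> K = density spherical_measure
     (\<lambda>u. ennreal (half_line_deriv \<phi> (radial_fun K u) * radial_fun K u ^ (CARD('n) + 1)))"

definition isotropic :: "(real^'n) measure \<Rightarrow> bool" where
  "isotropic \<mu> \<longleftrightarrow> finite_measure \<mu> \<and> sets \<mu> = sets (restrict_space borel (sphere 0 1)) \<and>
     (\<forall>v\<in>sphere 0 1. real CARD('n) / measure \<mu> (space \<mu>) * (\<integral>u. (u \<bullet> v)\<^sup>2 \<partial>\<mu>) = 1)"

end

theory Submission
  imports Defs
begin

text \<open>An ellipsoid is written as the set of all \<open>x\<close> with \<open>norm (M *v x) \<le> 1\<close>, where \<open>M\<close> is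
  invertible. All functionals in the theorem then become functionals of the matrix \<open>M\<close> built from
  \<open>F M = (\<integral>u. \<phi> (\<rho> u * norm (M *v u)) \<partial>\<nu>)\<close>, where \<open>\<nu>\<close> is the normalized dual cone measure. This
  function is convex and coercive on the space of all matrices, which gives the existence of the
  three extremal ellipsoids; they are unique because any two matrices of equal determinant have,
  up to a rotation, an average of strictly larger determinant. By scaling, each of (1), (2) and (3)
  says that \<open>F\<close>, for the body dilated by \<open>O_functional\<close>, is minimal at the inverse of \<open>T\<close> among
  matrices of determinant \<open>\<plusminus>1\<close>; here polar coordinates turn the integrals over the sphere into
  integrals over the body, where the linear change of variables is available. That isotropy is
  sufficient for the minimum in (3) follows from the tangent inequality for \<open>\<phi>\<close> and the
  arithmetic-geometric mean inequality. It is necessary by the first variation along volume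
  preserving stretches in the direction of a unit vector.\<close>

section \<open>Orthonormal frames and singular values\<close>

text \<open>The three Legendre ellipsoids are given by description operators, which say something
  only once existence and uniqueness are known, so both have to be proved. Uniqueness cannot hold
  for \<open>M\<close> itself, because \<open>M\<close> and \<open>U ** M\<close> with
  \<open>U\<close> orthogonal describe the same ellipsoid. Uniqueness statements therefore conclude
  that the functions \<open>\<lambda>x. norm (M *v x)\<close> agree, and singular values enter
  without the left orthogonal factor.

  The passage to matrices yields convexity because the ellipsoid of \<open>M\<close> has the radial
  function \<open>1 / norm (M *v u)\<close>, so that quotients of radial functions become norms of
  \<open>M *v u\<close>. The level \<open>\<phi> 1\<close> that recurs below comes from the
  condition that the inverse of \<open>\<phi>\<close> is at most 1. Dilating by the value of
  \<open>O_functional\<close> makes \<open>F\<close> equal to \<open>\<phi> 1\<close> exactly at the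
  inverse of \<open>T\<close>. At that level the largest determinant, the least
  \<open>O_functional\<close> and the least \<open>F\<close> are interchangeable, because
  \<open>F\<close> increases strictly along rays.\<close>

definition orthonormal :: "('n \<Rightarrow> real^'n) \<Rightarrow> bool" where
  "orthonormal e \<longleftrightarrow> (\<forall>i j. e i \<bullet> e j = (if i = j then 1 else 0))"

text \<open>The symmetric matrix with eigenvectors \<open>e i\<close> and eigenvalues
  \<open>c i\<close>, in its spectral form.\<close>

definition frame_scaling :: "('n \<Rightarrow> real^'n) \<Rightarrow> ('n \<Rightarrow> real) \<Rightarrow> real^'n^'n" where
  "frame_scaling e c = transpose (\<chi> i. e i) ** (\<chi> i j. if i = j then c i else 0) ** (\<chi> i. e i)"

lemma orthonormal_matrix:
  assumes "orthonormal e"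
  shows "orthogonal_matrix (\<chi> i. e i)"
  unfolding orthogonal_matrix_orthonormal_rows
  using assms
  by (auto simp: orthonormal_def row_def norm_eq_1 orthogonal_def)

lemma frame_mult: "((\<chi> i. e i) *v x) $ i = e i \<bullet> x" for e :: "'n \<Rightarrow> real^'n"
  by (simp add: matrix_vector_mult_def inner_vec_def)

lemma norm_orthonormal_matrix:
  assumes "orthonormal e"
  shows "norm ((\<chi> i. e i) *v x) = norm x"
proof -
  have "orthogonal_transformation ((*v) (\<chi> i. e i))"
    using orthonormal_matrix[OF assms] orthogonal_matrix_def
    by (metis matrix_of_matrix_vector_mul matrix_vector_mul_linear orthogonal_transformation_matrix)
  then show ?thesis
    by (simp add: orthogonal_transformation)
qed

lemma norm_sq_orthonormal:
  assumes "orthonormal e"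
  shows "(norm x)\<^sup>2 = (\<Sum>i\<in>UNIV. (e i \<bullet> x)\<^sup>2)"
proof -
  have "(norm ((\<chi> i. e i) *v x))\<^sup>2 = (\<Sum>i\<in>UNIV. (e i \<bullet> x)\<^sup>2)"
    unfolding norm_vec_def L2_set_def frame_mult by (simp add: sum_nonneg)
  then show ?thesis
    by (simp only: norm_orthonormal_matrix[OF assms])
qed

lemma matrix_vector_mult_diagonal:
  "((\<chi> i j. if i = j then c i else 0) *v y) $ i = c i * y $ i" for y :: "real^'n"
proof -
  have "((\<chi> i j. if i = j then c i else 0) *v y) $ i = (\<Sum>j\<in>UNIV. (if i = j then c i else 0) * y $ j)"
    unfolding matrix_vector_mult_def by simp
  also have "\<dots> = (\<Sum>j\<in>UNIV. if j = i then c i * y $ i else 0)"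
    by (intro sum.cong) auto
  finally show ?thesis
    by simp
qed

lemma inner_frame_scaling:
  assumes "orthonormal e"
  shows "e i \<bullet> (frame_scaling e c *v x) = c i * (e i \<bullet> x)"
proof -
  let ?Q = "\<chi> i. e i" and ?D = "\<chi> i j. if i = j then c i else 0"
  have "e i \<bullet> (frame_scaling e c *v x) = (?Q *v (frame_scaling e c *v x)) $ i"
    by (simp add: frame_mult)
  also have "?Q *v (frame_scaling e c *v x) = (?Q ** transpose ?Q) *v (?D *v (?Q *v x))"
    by (simp add: frame_scaling_def matrix_vector_mul_assoc matrix_mul_assoc)
  also have "\<dots> = ?D *v (?Q *v x)"
    using orthonormal_matrix[OF assms] by (simp add: orthogonal_matrix_def)
  also have "\<dots> $ i = c i * (e i \<bullet> x)"
    by (simp add: matrix_vector_mult_diagonal frame_mult)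
  finally show ?thesis .
qed

lemma norm_frame_scaling:
  assumes "orthonormal e"
  shows "(norm (frame_scaling e c *v x))\<^sup>2 = (\<Sum>i\<in>UNIV. (c i)\<^sup>2 * (e i \<bullet> x)\<^sup>2)"
  using norm_sq_orthonormal[OF assms, of "frame_scaling e c *v x"]
  by (simp add: inner_frame_scaling[OF assms] power_mult_distrib)

lemma det_frame_scaling:
  assumes "orthonormal e"
  shows "det (frame_scaling e c) = (\<Prod>i\<in>UNIV. c i)"
proof -
  let ?Q = "\<chi> i. e i"
  have "det ?Q = 1 \<or> det ?Q = -1"
    by (rule det_orthogonal_matrix[OF orthonormal_matrix[OF assms]])
  then have "det (transpose ?Q) * det ?Q = 1"
    by auto
  moreover have "det (\<chi> i j. if i = j then c i else 0) = (\<Prod>i\<in>UNIV. c i)"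
    by (subst det_diagonal) auto
  ultimately show ?thesis
    unfolding frame_scaling_def det_mul by (simp add: algebra_simps)
qed

lemma frame_scaling_add:
  "frame_scaling e (\<lambda>i. c i + d i) = frame_scaling e c + frame_scaling e d"
proof -
  have *: "(\<chi> i j. if i = j then c i + d i else 0) =
      (\<chi> i j. if i = j then c i else 0) + (\<chi> i j. if i = j then d i else (0::real))"
    by (simp add: vec_eq_iff)
  show ?thesis
    unfolding frame_scaling_def *
    by (simp add: matrix_matrix_mult_def vec_eq_iff sum.distrib algebra_simps)
qed

lemma frame_scaling_1:
  fixes e :: "'n \<Rightarrow> real^'n"
  assumes "orthonormal e"
  shows "frame_scaling e (\<lambda>i. 1) = mat 1"
proof -
  have "(\<chi> i j. if i = j then 1 else 0) = (mat 1 :: real^'n^'n)"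
    by (simp add: mat_def)
  then show ?thesis
    using orthonormal_matrix[OF assms] unfolding frame_scaling_def orthogonal_matrix_def
    by simp
qed

section \<open>Frames with orthogonal images\<close>

lemma orthogonal_direction_exists:
  fixes B :: "(real^'n) set"
  assumes "finite B" "card B < CARD('n)"
  shows "\<exists>x. norm x = 1 \<and> (\<forall>b\<in>B. x \<bullet> b = 0)"
proof -
  have "dim B < DIM(real^'n)"
    using assms dim_le_card'[of B] by simp
  then obtain x where "x \<noteq> 0" "\<And>y. y \<in> span B \<Longrightarrow> orthogonal x y"
    using orthogonal_to_subspace_exists by blast
  then have "norm (sgn x) = 1 \<and> (\<forall>b\<in>B. sgn x \<bullet> b = 0)"
    by (auto simp: norm_sgn sgn_div_norm orthogonal_def span_base)
  then show ?thesis
    by blast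
qed

text \<open>First order condition at a maximizer \<open>b\<close> of \<open>norm (N *v x)\<close>
  among unit vectors. Expanding the assumption in \<open>t\<close> gives
  \<open>2 * t * \<beta> \<le> t\<^sup>2 * \<gamma>\<close> for all \<open>t\<close>, which forces
  the linear coefficient to vanish.\<close>

lemma norm_maximizer_orthogonal:
  fixes N :: "real^'n^'m"
  assumes b: "norm b = 1" and w: "w \<bullet> b = 0"
    and max: "\<And>t. (norm (N *v (b + t *\<^sub>R w)))\<^sup>2 \<le> (norm (N *v b))\<^sup>2 * (norm (b + t *\<^sub>R w))\<^sup>2"
  shows "(N *v b) \<bullet> (N *v w) = 0"
proof -
  define \<beta> where "\<beta> = (N *v b) \<bullet> (N *v w)"
  define \<gamma> where "\<gamma> = (norm (N *v b))\<^sup>2 * (norm w)\<^sup>2"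
  have \<gamma>: "\<gamma> \<ge> 0"
    by (simp add: \<gamma>_def)
  have key: "2 * t * \<beta> \<le> t\<^sup>2 * \<gamma>" for t
  proof -
    have e1: "(norm (N *v (b + t *\<^sub>R w)))\<^sup>2 = (norm (N *v b))\<^sup>2 + 2 * t * \<beta> + t\<^sup>2 * (norm (N *v w))\<^sup>2"
      unfolding power2_norm_eq_inner \<beta>_def
      by (simp add: matrix_vector_right_distrib matrix_vector_mult_scaleR inner_add inner_commute
          power2_eq_square algebra_simps)
    have e2: "(norm (b + t *\<^sub>R w))\<^sup>2 = 1 + t\<^sup>2 * (norm w)\<^sup>2"
      using b w unfolding power2_norm_eq_inner norm_eq_1
      by (simp add: inner_add inner_commute power2_eq_square algebra_simps)
    have "0 \<le> t\<^sup>2 * (norm (N *v w))\<^sup>2"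
      by simp
    moreover have e3: "(norm (N *v b))\<^sup>2 * (1 + t\<^sup>2 * (norm w)\<^sup>2) = (norm (N *v b))\<^sup>2 + t\<^sup>2 * \<gamma>"
      by (simp add: \<gamma>_def algebra_simps)
    ultimately show ?thesis
      using max[of t, unfolded e1 e2 e3] by linarith
  qed
  show ?thesis
  proof (rule ccontr)
    assume nz: "\<not> ?thesis"
    \<comment> \<open>The summand 1 keeps the denominator positive if \<open>\<gamma> = 0\<close>.
      For \<open>t = s\<close> the bound becomes
      \<open>s\<^sup>2 * (\<gamma> + 2) \<le> 0\<close>.\<close>
    define s where "s = \<beta> / (\<gamma> + 1)"
    have "s\<^sup>2 > 0"
      using nz \<gamma> by (simp add: \<beta>_def s_def)
    then have "0 < s\<^sup>2 * (\<gamma> + 2)"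
      using \<gamma> by simp
    moreover have "\<beta> = s * (\<gamma> + 1)"
      using \<gamma> by (simp add: s_def)
    then have "2 * s * (s * (\<gamma> + 1)) \<le> s\<^sup>2 * \<gamma>"
      using key[of s] by metis
    then have "s\<^sup>2 * (\<gamma> + 2) \<le> 0"
      by (simp add: algebra_simps power2_eq_square)
    ultimately show False
      by simp
  qed
qed

text \<open>Existence part of the singular value decomposition, by successive maximization of
  \<open>norm (N *v x)\<close> on the unit sphere of the orthogonal complement.\<close>

lemma svd_set:
  fixes N :: "real^'n^'m"
  assumes "k \<le> CARD('n)"
  shows "\<exists>B. finite B \<and> card B = k \<and> (\<forall>b\<in>B. norm b = 1) \<and>
    (\<forall>b\<in>B. \<forall>c\<in>B. b \<noteq> c \<longrightarrow> b \<bullet> c = 0) \<and>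
    (\<forall>b\<in>B. \<forall>c\<in>B. b \<noteq> c \<longrightarrow> (N *v b) \<bullet> (N *v c) = 0) \<and>
    (\<forall>b\<in>B. \<forall>w. (\<forall>c\<in>B. w \<bullet> c = 0) \<longrightarrow> (N *v b) \<bullet> (N *v w) = 0)"
  using assms
proof (induction k)
  case 0
  show ?case
    by (rule exI[of _ "{}"]) auto
next
  case (Suc k)
  then have "k \<le> CARD('n)"
    by simp
  from Suc.IH[OF this] obtain B where B0: "finite B" "card B = k" "\<forall>b\<in>B. norm b = 1"
    "\<forall>b\<in>B. \<forall>c\<in>B. b \<noteq> c \<longrightarrow> b \<bullet> c = 0"
    "\<forall>b\<in>B. \<forall>c\<in>B. b \<noteq> c \<longrightarrow> (N *v b) \<bullet> (N *v c) = 0"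
    "\<forall>b\<in>B. \<forall>w. (\<forall>c\<in>B. w \<bullet> c = 0) \<longrightarrow> (N *v b) \<bullet> (N *v w) = 0"
    by (elim exE conjE) (rule that)
  note B = B0(1,2) B0(3-6)[rule_format]
  define S where "S = sphere 0 1 \<inter> (\<Inter>c\<in>B. {w. w \<bullet> c = 0})"
  have "closed (\<Inter>c\<in>B. {w. w \<bullet> c = 0})"
    by (intro closed_INT ballI closed_Collect_eq continuous_intros)
  then have "compact S"
    unfolding S_def by (intro compact_Int_closed) auto
  moreover have "S \<noteq> {}"
    using orthogonal_direction_exists[of B] B(1,2) Suc.prems by (auto simp: S_def)
  moreover have "continuous_on S (\<lambda>x. norm (N *v x))"
    by (intro continuous_intros linear_continuous_on) auto
  ultimately obtain b where b: "b \<in> S" and b_max: "\<And>x. x \<in> S \<Longrightarrow> norm (N *v x) \<le> norm (N *v b)"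
    using continuous_attains_sup by metis
  have b1: "norm b = 1" and bB: "\<And>c. c \<in> B \<Longrightarrow> b \<bullet> c = 0"
    using b by (auto simp: S_def)
  have "b \<notin> B"
    using bB[of b] b1 by auto
  have N0: "(N *v b) \<bullet> (N *v w) = 0" if w: "\<And>c. c \<in> insert b B \<Longrightarrow> w \<bullet> c = 0" for w
  proof (rule norm_maximizer_orthogonal[OF b1])
    show "w \<bullet> b = 0"
      using w by simp
    fix t
    let ?x = "b + t *\<^sub>R w"
    \<comment> \<open>The component along \<open>b\<close> is 1, so \<open>?x\<close> is nonzero and
      can be normalized to a point of \<open>S\<close>; homogeneity removes the normalization
      again.\<close>
    have "?x \<bullet> b = 1"
      using b1 w by (simp add: inner_add norm_eq_1)
    then have nz: "norm ?x \<noteq> 0"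
      by auto
    then have "(1 / norm ?x) *\<^sub>R ?x \<in> S"
      using bB w by (auto simp: S_def inner_add)
    from b_max[OF this] have "norm (N *v ?x) \<le> norm (N *v b) * norm ?x"
      unfolding matrix_vector_mult_scaleR norm_scaleR using nz
      by (simp add: divide_le_eq)
    then show "(norm (N *v ?x))\<^sup>2 \<le> (norm (N *v b))\<^sup>2 * (norm ?x)\<^sup>2"
      by (metis norm_ge_zero power_mono power_mult_distrib)
  qed
  have N1: "(N *v b) \<bullet> (N *v w) = 0" "(N *v w) \<bullet> (N *v b) = 0"
    if "w \<bullet> b = 0" "\<forall>c\<in>B. w \<bullet> c = 0" for w
    using N0[of w] that by (auto simp: inner_commute)
  \<comment> \<open>The last conjunct of the induction hypothesis, applied to \<open>w = b\<close>,
    makes \<open>N *v b\<close> orthogonal to the images of the old vectors. The same conjunct for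
    \<open>b\<close> itself is \<open>N0\<close>.\<close>
  show ?case
    using B b1 bB \<open>b \<notin> B\<close>
    by (intro exI[of _ "insert b B"]) (auto simp: inner_commute N1)
qed

lemma svd:
  fixes N :: "real^'n^'m"
  obtains e :: "'n \<Rightarrow> real^'n" where "orthonormal e"
    "\<And>i j. i \<noteq> j \<Longrightarrow> (N *v e i) \<bullet> (N *v e j) = 0"
proof -
  obtain B :: "(real^'n) set" where B0: "finite B" "card B = CARD('n)" "\<forall>b\<in>B. norm b = 1"
    "\<forall>b\<in>B. \<forall>c\<in>B. b \<noteq> c \<longrightarrow> b \<bullet> c = 0"
    "\<forall>b\<in>B. \<forall>c\<in>B. b \<noteq> c \<longrightarrow> (N *v b) \<bullet> (N *v c) = 0"
    using svd_set[OF order_refl, of N] by (elim exE conjE) (rule that)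
  note B = B0(1,2) B0(3-5)[rule_format]
  obtain e :: "'n \<Rightarrow> real^'n" where e: "bij_betw e UNIV B"
    using B(1,2) finite_same_card_bij[of "UNIV :: 'n set" B] by auto
  then have eB: "e i \<in> B" and inj: "e i = e j \<longleftrightarrow> i = j" for i j
    by (auto simp: bij_betw_def inj_eq)
  have "orthonormal e"
    unfolding orthonormal_def using B(3,4)[OF eB] eB inj by (simp add: norm_eq_1)
  moreover have "(N *v e i) \<bullet> (N *v e j) = 0" if "i \<noteq> j" for i j
    by (intro B(5) eB) (simp add: inj that)
  ultimately show thesis
    by (rule that)
qed

lemma orthonormal_expansion:
  assumes "orthonormal e"
  shows "x = (\<Sum>i\<in>UNIV. (e i \<bullet> x) *\<^sub>R e i)"
proof -
  have "e j \<bullet> (\<Sum>i\<in>UNIV. (e i \<bullet> x) *\<^sub>R e i) = e j \<bullet> x" for j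
  proof -
    have "e j \<bullet> (\<Sum>i\<in>UNIV. (e i \<bullet> x) *\<^sub>R e i) = (\<Sum>i\<in>UNIV. if i = j then e j \<bullet> x else 0)"
      unfolding inner_sum_right
      using assms by (intro sum.cong) (auto simp: orthonormal_def)
    then show ?thesis
      by simp
  qed
  then have "(norm (x - (\<Sum>i\<in>UNIV. (e i \<bullet> x) *\<^sub>R e i)))\<^sup>2 = 0"
    unfolding norm_sq_orthonormal[OF assms] by (simp add: inner_diff_right)
  then show ?thesis
    unfolding zero_eq_power2 norm_eq_zero right_minus_eq .
qed

text \<open>Pythagoras: when \<open>x\<close> is expanded in the frame, the vectors
  \<open>N *v e i\<close> are pairwise orthogonal, so only their lengths matter. These lengths are
  the singular values.\<close>

lemma singular_norm:
  assumes e: "orthonormal e" and N: "\<And>i j. i \<noteq> j \<Longrightarrow> (N *v e i) \<bullet> (N *v e j) = 0"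
  shows "norm (N *v x) = norm (frame_scaling e (\<lambda>i. norm (N *v e i)) *v x)"
proof -
  have *: "N *v x = (\<Sum>i\<in>UNIV. (e i \<bullet> x) *\<^sub>R (N *v e i))" (is "_ = ?S")
    using arg_cong[OF orthonormal_expansion[OF e, of x], of "\<lambda>x. N *v x"]
    by (simp add: linear_sum[OF matrix_vector_mul_linear] matrix_vector_mult_scaleR)
  have "(norm (N *v x))\<^sup>2 = ?S \<bullet> ?S"
    by (simp only: power2_norm_eq_inner *[symmetric])
  also have "\<dots> = (\<Sum>i\<in>UNIV. \<Sum>j\<in>UNIV. (e i \<bullet> x) * (e j \<bullet> x) * ((N *v e i) \<bullet> (N *v e j)))"
    unfolding inner_sum_left unfolding inner_sum_right
    by (intro sum.cong refl) (simp add: mult_ac)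
  also have "\<dots> = (\<Sum>i\<in>UNIV. \<Sum>j\<in>UNIV. if j = i then (norm (N *v e i))\<^sup>2 * (e i \<bullet> x)\<^sup>2 else 0)"
    by (intro sum.cong refl) (auto simp: N dot_square_norm power2_eq_square)
  finally have "(norm (N *v x))\<^sup>2 = (norm (frame_scaling e (\<lambda>i. norm (N *v e i)) *v x))\<^sup>2"
    by (simp add: norm_frame_scaling[OF e])
  then show ?thesis
    by simp
qed

lemma inner_transpose_mult: "x \<bullet> (transpose A *v y) = (A *v x) \<bullet> y" for A :: "real^'n^'m"
  using dot_lmul_matrix[of y A x] by (simp add: inner_commute transpose_matrix_vector)

text \<open>Polarization turns equal norms into \<open>transpose A ** A = transpose B ** B\<close>,
  and the determinants of these products are the squares of \<open>det A\<close> and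
  \<open>det B\<close>.\<close>

lemma matrix_eq_norm_imp_abs_det_eq:
  fixes A B :: "real^'n^'n"
  assumes "\<And>x. norm (A *v x) = norm (B *v x)"
  shows "\<bar>det A\<bar> = \<bar>det B\<bar>"
proof -
  have "(A *v x) \<bullet> (A *v y) = (B *v x) \<bullet> (B *v y)" for x y
    by (simp add: dot_norm assms flip: matrix_vector_right_distrib)
  then have "x \<bullet> ((transpose A ** A) *v y) = x \<bullet> ((transpose B ** B) *v y)" for x y
    by (simp only: inner_transpose_mult matrix_vector_mul_assoc[symmetric])
  then have "transpose A ** A = transpose B ** B"
    unfolding matrix_eq using vector_eq_ldot by blast
  then have "(det A)\<^sup>2 = (det B)\<^sup>2"
    by (metis det_mul det_transpose power2_eq_square)
  then show ?thesis
    by (simp add: power2_eq_iff abs_eq_iff)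
qed

text \<open>The left orthogonal factor of the decomposition is dropped, since neither norms nor
  ellipsoids detect it.\<close>

lemma singular_value_decomposition:
  fixes N :: "real^'n^'n"
  obtains e d where "orthonormal e" "\<And>i. d i \<ge> 0" "\<bar>det N\<bar> = (\<Prod>i\<in>UNIV. d i)"
    "\<And>x. norm (N *v x) = norm (frame_scaling e d *v x)"
proof -
  obtain e where e: "orthonormal e" "\<And>i j. i \<noteq> j \<Longrightarrow> (N *v e i) \<bullet> (N *v e j) = 0"
    using svd by blast
  have s: "norm (N *v x) = norm (frame_scaling e (\<lambda>i. norm (N *v e i)) *v x)" for x
    by (rule singular_norm[OF e])
  have "\<bar>det N\<bar> = \<bar>\<Prod>i\<in>UNIV. norm (N *v e i)\<bar>"
    using matrix_eq_norm_imp_abs_det_eq[OF s] by (simp add: det_frame_scaling[OF e(1)])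
  then have "\<bar>det N\<bar> = (\<Prod>i\<in>UNIV. norm (N *v e i))"
    by (simp add: prod_nonneg)
  from that[OF e(1) _ this s] show thesis
    by simp
qed

text \<open>The arithmetic-geometric mean inequality for each pair \<open>1\<close>,
  \<open>d i\<close>, in squared form to avoid roots. It is strict where
  \<open>d i \<noteq> 1\<close>, and strictness survives the product because all factors are
  positive.\<close>

lemma prod_average_gt_1:
  fixes d :: "'n::finite \<Rightarrow> real"
  assumes d: "\<And>i. d i \<ge> 0" "(\<Prod>i\<in>UNIV. d i) = 1" "\<exists>i. d i \<noteq> 1"
  shows "(\<Prod>i\<in>UNIV. (1 + d i) / 2) > 1"
proof -
  obtain k where k: "d k \<noteq> 1"
    using d(3) by blast
  have pos: "d i > 0" for i
    using d(1)[of i] d(2) by (metis finite iso_tuple_UNIV_I less_eq_real_def prod_zero zero_neq_one)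
  have amgm: "((1 + d i) / 2)\<^sup>2 = d i + ((1 - d i) / 2)\<^sup>2" for i
    by (simp add: power2_eq_square field_simps)
  have "1 = (\<Prod>i\<in>UNIV. d i)"
    using d by simp
  also have "\<dots> < (\<Prod>i\<in>UNIV. ((1 + d i) / 2)\<^sup>2)"
  proof -
    have "(\<Prod>i\<in>UNIV. d i) = d k * (\<Prod>i\<in>UNIV-{k}. d i)"
      by (simp add: prod.remove)
    also have "\<dots> < ((1 + d k) / 2)\<^sup>2 * (\<Prod>i\<in>UNIV-{k}. d i)"
      using k pos by (intro mult_strict_right_mono) (auto simp: amgm intro!: prod_pos)
    also have "\<dots> \<le> ((1 + d k) / 2)\<^sup>2 * (\<Prod>i\<in>UNIV-{k}. ((1 + d i) / 2)\<^sup>2)"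
      using d(1) by (intro mult_left_mono prod_mono) (auto simp: amgm)
    also have "\<dots> = (\<Prod>i\<in>UNIV. ((1 + d i) / 2)\<^sup>2)"
      by (rule prod.remove[symmetric]) auto
    finally show ?thesis .
  qed
  finally have "1\<^sup>2 < (\<Prod>i\<in>UNIV. (1 + d i) / 2)\<^sup>2"
    by (simp add: prod_power_distrib)
  then show ?thesis
    by (rule power_less_imp_less_base) (auto intro!: prod_nonneg add_nonneg_nonneg d(1))
qed

text \<open>Write \<open>M2 = N ** M1\<close>, where \<open>N\<close> has determinant of absolute
  value 1. Replacing \<open>N\<close> by \<open>D = frame_scaling e d\<close>, built from its
  singular values, changes \<open>M2\<close> only by an orthogonal factor on the left. The average
  of \<open>M1\<close> and \<open>D ** M1\<close> has the determinant of \<open>M1\<close> times the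
  product of the numbers \<open>(1 + d i) / 2\<close>. This product exceeds 1 unless
  \<open>D\<close> is the identity, which \<open>x0\<close> excludes.\<close>

lemma average_with_larger_det:
  fixes M1 M2 :: "real^'n^'n"
  assumes det: "\<bar>det M1\<bar> = \<bar>det M2\<bar>" "det M1 \<noteq> 0"
    and neq: "norm (M1 *v x0) \<noteq> norm (M2 *v x0)"
  obtains R where "\<bar>det R\<bar> > \<bar>det M1\<bar>" "\<And>x. norm (R *v x) \<le> (norm (M1 *v x) + norm (M2 *v x)) / 2"
proof -
  obtain M1' where inv: "M1' ** M1 = mat 1"
    using det(2) invertible_det_nz[of M1] by (metis invertible_left_inverse)
  then have "det M1' * det M1 = 1"
    by (metis det_I det_mul)
  then have "\<bar>det (M2 ** M1')\<bar> = 1"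
    using det(1) by (metis abs_mult abs_one det_mul mult.commute)
  obtain e d where e: "orthonormal e" "\<And>i. d i \<ge> 0" "\<bar>det (M2 ** M1')\<bar> = (\<Prod>i\<in>UNIV. d i)"
    "\<And>x. norm ((M2 ** M1') *v x) = norm (frame_scaling e d *v x)"
    using singular_value_decomposition by blast
  have N: "norm (M2 *v x) = norm (frame_scaling e d *v (M1 *v x))" for x
    by (metis e(4) inv matrix_mul_assoc matrix_mul_rid matrix_vector_mul_assoc)
  define W where "W = frame_scaling e (\<lambda>i. (1 + d i) / 2)"
  have 2: "frame_scaling e (\<lambda>i. 1 / 2 * c i) = (1/2) *\<^sub>R frame_scaling e c" for c
  proof -
    have *: "frame_scaling e c = frame_scaling e (\<lambda>i. 1/2 * c i) + frame_scaling e (\<lambda>i. 1/2 * c i)"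
      by (subst frame_scaling_add[symmetric]) simp
    show ?thesis
      by (subst *) (simp add: scaleR_2[symmetric])
  qed
  have W: "W = (1/2) *\<^sub>R (mat 1 + frame_scaling e d)"
    unfolding W_def using 2[of "\<lambda>i. 1 + d i"]
    by (simp add: frame_scaling_add frame_scaling_1[OF e(1)])
  show thesis
  proof
    have "\<exists>i. d i \<noteq> 1"
    proof (rule ccontr)
      assume "\<nexists>i. d i \<noteq> 1"
      then have "d = (\<lambda>i. 1)"
        by auto
      then show False
        using neq N[of x0] by (simp add: frame_scaling_1[OF e(1)])
    qed
    then have "det W > 1"
      using e(2,3) \<open>\<bar>det (M2 ** M1')\<bar> = 1\<close>
      by (simp only: W_def det_frame_scaling[OF e(1)]) (rule prod_average_gt_1, auto)
    then show "\<bar>det (W ** M1)\<bar> > \<bar>det M1\<bar>"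
      using det(2) by (simp add: det_mul abs_mult)
    fix x
    have "norm ((W ** M1) *v x) = norm (M1 *v x + frame_scaling e d *v (M1 *v x)) / 2"
      by (simp add: W matrix_vector_mul_assoc[symmetric] scaleR_matrix_vector_assoc[symmetric]
          matrix_vector_mult_add_rdistrib)
    also have "\<dots> \<le> (norm (M1 *v x) + norm (M2 *v x)) / 2"
      using norm_triangle_ineq by (simp add: N)
    finally show "norm ((W ** M1) *v x) \<le> (norm (M1 *v x) + norm (M2 *v x)) / 2" .
  qed
qed

text \<open>With singular frame \<open>e\<close> and singular values \<open>d\<close>, the sum is
  the quadratic form of \<open>D = frame_scaling e d\<close> at \<open>u\<close>. By Cauchy-Schwarz
  it is at most \<open>norm (D *v u)\<close> for a unit vector, and the arithmetic-geometric mean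
  inequality bounds the trace of \<open>D\<close>. A quadratic form is wanted because its integral
  against an isotropic measure depends only on its trace.\<close>

lemma det_1_quadratic_minorant:
  fixes N :: "real^'n^'n"
  assumes "\<bar>det N\<bar> = 1"
  obtains e d where "orthonormal e" "(\<Sum>i\<in>UNIV. d i) \<ge> real CARD('n)"
    "\<And>u. norm u = 1 \<Longrightarrow> (\<Sum>i\<in>UNIV. d i * (e i \<bullet> u)\<^sup>2) \<le> norm (N *v u)"
proof -
  obtain e d where e: "orthonormal e" "\<And>i. d i \<ge> 0" "\<bar>det N\<bar> = (\<Prod>i\<in>UNIV. d i)"
    "\<And>x. norm (N *v x) = norm (frame_scaling e d *v x)"
    using singular_value_decomposition by blast
  show thesis
  proof (rule that)
    show "orthonormal e"
      by fact
    have "1 \<le> (\<Sum>i\<in>UNIV. d i / real CARD('n))"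
      using arith_geom_mean[of "UNIV :: 'n set" d] e(2,3) assms by simp
    then show "(\<Sum>i\<in>UNIV. d i) \<ge> real CARD('n)"
      by (simp add: field_simps flip: sum_divide_distrib)
    fix u :: "real^'n" assume u: "norm u = 1"
    have "(\<Sum>i\<in>UNIV. d i * (e i \<bullet> u)\<^sup>2)\<^sup>2 = (\<Sum>i\<in>UNIV. (d i * (e i \<bullet> u)) * (e i \<bullet> u))\<^sup>2"
      by (simp add: power2_eq_square mult.assoc)
    also have "\<dots> \<le> (\<Sum>i\<in>UNIV. (d i * (e i \<bullet> u))\<^sup>2) * (\<Sum>i\<in>UNIV. (e i \<bullet> u)\<^sup>2)"
      by (rule Cauchy_Schwarz_ineq_sum)
    also have "\<dots> = (norm (N *v u))\<^sup>2"
      using u by (simp add: e(4) norm_frame_scaling[OF e(1)] power_mult_distrib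
          flip: norm_sq_orthonormal[OF e(1)])
    finally show "(\<Sum>i\<in>UNIV. d i * (e i \<bullet> u)\<^sup>2) \<le> norm (N *v u)"
      by (rule power2_le_imp_le) simp
  qed
qed

lemma orthonormal_extend:
  fixes v :: "real^'n"
  assumes "norm v = 1"
  obtains e k where "orthonormal e" "e k = v"
proof -
  obtain A k where A: "orthogonal_matrix A" "A *v (axis k 1) = v"
    using orthogonal_matrix_exists_basis[OF assms] by blast
  show thesis
  proof
    show "orthonormal (\<lambda>i. column i A)"
      using A(1) unfolding orthogonal_matrix_orthonormal_columns orthonormal_def
      by (auto simp: norm_eq_1 orthogonal_def)
    show "column k A = v"
      using A(2) by (simp add: matrix_vector_mult_basis)
  qed
qed

text \<open>The stretch by \<open>s\<close> in direction \<open>v\<close> that fixes the orthogonal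
  complement of \<open>v\<close>. It supplies the test matrices of the first variation.\<close>

lemma det_stretch:
  fixes v :: "real^'n"
  assumes "norm v = 1" "s > 0"
  obtains M :: "real^'n^'n" where "det M = s"
    "\<And>x. (norm (M *v x))\<^sup>2 = (norm x)\<^sup>2 + (s\<^sup>2 - 1) * (v \<bullet> x)\<^sup>2"
proof -
  obtain e k where e: "orthonormal e" and ek: "e k = v"
    using orthonormal_extend[OF assms(1)] .
  show thesis
  proof
    show "det (frame_scaling e (\<lambda>i. if i = k then s else 1)) = s"
      by (simp add: det_frame_scaling[OF e])
    fix x
    have *: "(if i = k then s else 1)\<^sup>2 * (e i \<bullet> x)\<^sup>2 =
        (e i \<bullet> x)\<^sup>2 + (if i = k then (s\<^sup>2 - 1) * (v \<bullet> x)\<^sup>2 else 0)" for i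
      by (simp add: ek algebra_simps)
    show "(norm (frame_scaling e (\<lambda>i. if i = k then s else 1) *v x))\<^sup>2 =
        (norm x)\<^sup>2 + (s\<^sup>2 - 1) * (v \<bullet> x)\<^sup>2"
      unfolding norm_frame_scaling[OF e] * sum.distrib norm_sq_orthonormal[OF e, of x] by simp
  qed
qed

section \<open>Linear change of variables\<close>

lemma nn_integral_lborel_affine:
  fixes f :: "'a::euclidean_space \<Rightarrow> ennreal"
  assumes [measurable]: "f \<in> borel_measurable borel" and c: "c \<noteq> 0"
  shows "(\<integral>\<^sup>+x. f x \<partial>lborel) = ennreal (\<bar>c\<bar> ^ DIM('a)) * (\<integral>\<^sup>+x. f (t + c *\<^sub>R x) \<partial>lborel)"
  by (subst lborel_affine[OF c, of t])
     (simp add: nn_integral_density nn_integral_distr nn_integral_cmult)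

text \<open>Uniqueness of the translation invariant measure, by interchanging the order of integration
  in a double integral of \<open>f (U x) * g (y + U x)\<close>.\<close>

lemma nn_integral_linear_proportional:
  fixes U :: "real^'n^'n" and f g :: "real^'n \<Rightarrow> ennreal"
  assumes "invertible U"
    and [measurable]: "f \<in> borel_measurable borel" "g \<in> borel_measurable borel"
  shows "(\<integral>\<^sup>+x. f (U *v x) \<partial>lborel) * (\<integral>\<^sup>+x. g x \<partial>lborel) =
    (\<integral>\<^sup>+x. g (U *v x) \<partial>lborel) * (\<integral>\<^sup>+x. f x \<partial>lborel)"
proof -
  obtain V where V: "U ** V = mat 1"
    using assms(1) by (auto simp: invertible_def)
  have [measurable]: "(\<lambda>x. U *v x) \<in> borel_measurable borel"
    by (intro borel_measurable_continuous_onI linear_continuous_on) auto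
  have UV: "U *v (V *v (- y) + x) = U *v x - y" for x y
    by (simp add: matrix_vector_right_distrib matrix_vector_mul_assoc V)
  have "(\<integral>\<^sup>+x. f (U *v x) \<partial>lborel) * (\<integral>\<^sup>+y. g y \<partial>lborel) =
      (\<integral>\<^sup>+x. f (U *v x) * (\<integral>\<^sup>+y. g y \<partial>lborel) \<partial>lborel)"
    by (simp add: nn_integral_multc)
  also have "\<dots> = (\<integral>\<^sup>+x. \<integral>\<^sup>+y. f (U *v x) * g (U *v x + y) \<partial>lborel \<partial>lborel)"
  proof (rule nn_integral_cong)
    fix x
    show "f (U *v x) * (\<integral>\<^sup>+y. g y \<partial>lborel) = (\<integral>\<^sup>+y. f (U *v x) * g (U *v x + y) \<partial>lborel)"
      by (subst nn_integral_lborel_affine[of g 1 "U *v x"]) (simp_all add: nn_integral_cmult)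
  qed
  also have "\<dots> = (\<integral>\<^sup>+y. \<integral>\<^sup>+x. f (U *v x) * g (U *v x + y) \<partial>lborel \<partial>lborel)"
    by (rule lborel_pair.Fubini') measurable
  \<comment> \<open>Translating \<open>x\<close> by \<open>V *v (- y)\<close> moves the shift by
    \<open>y\<close> from \<open>g\<close> to \<open>f\<close>.\<close>
  also have "\<dots> = (\<integral>\<^sup>+y. \<integral>\<^sup>+x. f (U *v x - y) * g (U *v x) \<partial>lborel \<partial>lborel)"
  proof (rule nn_integral_cong)
    fix y
    show "(\<integral>\<^sup>+x. f (U *v x) * g (U *v x + y) \<partial>lborel) =
        (\<integral>\<^sup>+x. f (U *v x - y) * g (U *v x) \<partial>lborel)"
      by (subst nn_integral_lborel_affine[of _ 1 "V *v (- y)"]) (simp_all add: UV)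
  qed
  also have "\<dots> = (\<integral>\<^sup>+x. \<integral>\<^sup>+y. f (U *v x - y) * g (U *v x) \<partial>lborel \<partial>lborel)"
    by (rule lborel_pair.Fubini'[symmetric]) measurable
  \<comment> \<open>For fixed \<open>x\<close> the map from \<open>y\<close> to
    \<open>U *v x - y\<close> preserves Lebesgue measure, which decouples the integral of
    \<open>f\<close>.\<close>
  also have "\<dots> = (\<integral>\<^sup>+x. g (U *v x) * (\<integral>\<^sup>+y. f y \<partial>lborel) \<partial>lborel)"
  proof (rule nn_integral_cong)
    fix x
    show "(\<integral>\<^sup>+y. f (U *v x - y) * g (U *v x) \<partial>lborel) = g (U *v x) * (\<integral>\<^sup>+y. f y \<partial>lborel)"
      by (subst nn_integral_lborel_affine[of f "-1" "U *v x"])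
        (simp_all add: nn_integral_multc mult.commute[of "g (U *v x)"])
  qed
  finally show ?thesis
    by (simp add: nn_integral_multc)
qed

text \<open>The unit ball is invariant under the isometry. With its indicator as \<open>g\<close>,
  the proportionality has the same factor on both sides, and this factor is positive and
  finite.\<close>

lemma nn_integral_lborel_isometry:
  fixes U :: "real^'n^'n" and f :: "real^'n \<Rightarrow> ennreal"
  assumes "invertible U" "\<And>x. norm (U *v x) = norm x" "f \<in> borel_measurable borel"
  shows "(\<integral>\<^sup>+x. f (U *v x) \<partial>lborel) = (\<integral>\<^sup>+x. f x \<partial>lborel)"
proof -
  let ?g = "indicator (ball 0 1) :: real^'n \<Rightarrow> ennreal"
  have [measurable]: "?g \<in> borel_measurable borel"
    by (intro borel_measurable_indicator) auto
  have "?g (U *v x) = ?g x" for x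
    by (simp add: indicator_def assms(2))
  then have "(\<integral>\<^sup>+x. f (U *v x) \<partial>lborel) * emeasure lborel (ball 0 1 :: (real^'n) set) =
      (\<integral>\<^sup>+x. f x \<partial>lborel) * emeasure lborel (ball 0 1 :: (real^'n) set)"
    using nn_integral_linear_proportional[OF assms(1,3), of ?g] by (simp add: mult.commute[of _ "emeasure _ _"])
  moreover have "emeasure lborel (ball 0 1 :: (real^'n) set) \<noteq> 0"
    using content_ball_pos[of 1 "0 :: real^'n"] by (auto simp: measure_def)
  moreover have "emeasure lborel (ball 0 1 :: (real^'n) set) \<noteq> top"
    using emeasure_lborel_ball_finite[of "0 :: real^'n" 1] by simp
  ultimately show ?thesis
    by (simp add: ennreal_mult_cancel_left mult.commute[of _ "emeasure _ _"])
qed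

lemma nn_integral_lborel_diagonal:
  fixes d :: "'n::finite \<Rightarrow> real" and f :: "real^'n \<Rightarrow> ennreal"
  assumes d: "\<And>i. d i \<noteq> 0" and [measurable]: "f \<in> borel_measurable borel"
  shows "(\<integral>\<^sup>+x. f x \<partial>lborel) =
    ennreal \<bar>\<Prod>i\<in>UNIV. d i\<bar> * (\<integral>\<^sup>+x. f ((\<chi> i j. if i = j then d i else 0) *v x) \<partial>lborel)"
proof -
  define c where "c = (\<lambda>b::real^'n. d (axis_index b))"
  have B: "(Basis :: (real^'n) set) = range (\<lambda>i. axis i 1)" "inj (\<lambda>i::'n. axis i (1::real))"
    by (auto simp: Basis_vec_def inj_on_def axis_eq_axis)
  have c: "c (axis i 1) = d i" for i
    by (simp add: c_def axis_index_axis)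
  have T: "(\<Sum>j\<in>Basis. (c j * (x \<bullet> j)) *\<^sub>R j) = (\<chi> i j. if i = j then d i else 0) *v x" for x
  proof -
    have "(\<Sum>j\<in>Basis. (c j * (x \<bullet> j)) *\<^sub>R j) $ k = d k * x $ k" for k
    proof -
      have "(\<Sum>j\<in>Basis. (c j * (x \<bullet> j)) *\<^sub>R j) $ k = (\<Sum>i\<in>UNIV. if i = k then d k * x $ k else 0)"
        unfolding B(1) sum.reindex[OF B(2)] sum_component
        unfolding o_def c inner_axis by (intro sum.cong) (auto simp: axis_def)
      then show ?thesis
        by simp
    qed
    then show ?thesis
      by (simp add: vec_eq_iff matrix_vector_mult_diagonal)
  qed
  have p: "(\<Prod>j\<in>Basis. \<bar>c j\<bar>) = \<bar>\<Prod>i\<in>UNIV. d i\<bar>"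
    unfolding B(1) prod.reindex[OF B(2)] by (simp add: c abs_prod)
  have "c j \<noteq> 0" for j
    using d by (simp add: c_def)
  then have l: "lborel = density (distr lborel borel (\<lambda>x. (\<chi> i j. if i = j then d i else 0) *v x))
      (\<lambda>_. ennreal \<bar>\<Prod>i\<in>UNIV. d i\<bar>)"
    using lborel_affine_euclidean[of c 0] unfolding T p by simp
  have [measurable]: "(\<lambda>x. (\<chi> i j. if i = j then d i else 0) *v x) \<in> borel_measurable borel"
    by (intro borel_measurable_continuous_onI linear_continuous_on) auto
  show ?thesis
    by (subst l) (simp add: nn_integral_density nn_integral_distr nn_integral_cmult)
qed

lemma isometry_invertible:
  fixes U :: "real^'n^'n"
  assumes "\<And>x. norm (U *v x) = norm x"
  shows "invertible U"
  using matrix_eq_norm_imp_abs_det_eq[of U "mat 1"] assms by (simp add: invertible_det_nz)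

text \<open>The library proves this only for index types in class \<open>wellorder\<close>.\<close>

proposition nn_integral_lborel_linear:
  fixes N :: "real^'n^'n" and f :: "real^'n \<Rightarrow> ennreal"
  assumes "invertible N" and f: "f \<in> borel_measurable borel"
  shows "(\<integral>\<^sup>+x. f x \<partial>lborel) = ennreal \<bar>det N\<bar> * (\<integral>\<^sup>+x. f (N *v x) \<partial>lborel)"
proof -
  obtain e d where e: "orthonormal e" "\<And>i. d i \<ge> 0" "\<bar>det N\<bar> = (\<Prod>i\<in>UNIV. d i)"
    "\<And>x. norm (N *v x) = norm (frame_scaling e d *v x)"
    using singular_value_decomposition by blast
  let ?Q = "\<chi> i. e i" and ?D = "\<chi> i j. if i = j then d i else 0"
  have meas: "(\<lambda>x. f (A *v x)) \<in> borel_measurable borel" for A :: "real^'n^'n"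
    by (intro measurable_compose[OF _ f] borel_measurable_continuous_onI linear_continuous_on) auto
  have nz: "(\<Prod>i\<in>UNIV. d i) \<noteq> 0"
    using assms(1) e(3) by (metis abs_0_eq invertible_det_nz)
  then have d: "d i \<noteq> 0" for i
    by auto
  obtain W where W: "W ** frame_scaling e d = mat 1" "frame_scaling e d ** W = mat 1"
    using nz by (metis det_frame_scaling[OF e(1)] invertible_det_nz invertible_def)
  \<comment> \<open>Polar decomposition: \<open>W\<close> inverts \<open>frame_scaling e d\<close>,
    whose norms agree with those of \<open>N\<close>, so \<open>U\<close> is an isometry. As
    \<open>?Q\<close> and its transpose are isometries too, only the diagonal factor changes the
    integral.\<close>
  define U where "U = N ** W"
  have "transpose ?Q ** (?D ** ?Q) = frame_scaling e d"
    by (simp add: frame_scaling_def matrix_mul_assoc)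
  then have N: "N = U ** (transpose ?Q ** (?D ** ?Q))"
    by (simp only: U_def matrix_mul_assoc[symmetric] W matrix_mul_rid)
  have U: "norm (U *v x) = norm x" for x
  proof -
    have "norm (U *v x) = norm (frame_scaling e d *v (W *v x))"
      by (simp only: U_def matrix_vector_mul_assoc[symmetric] e(4))
    then show ?thesis
      by (simp only: matrix_vector_mul_assoc W matrix_vector_mul_lid)
  qed
  note Q = norm_orthonormal_matrix[OF e(1)]
  have QT: "norm (transpose ?Q *v x) = norm x" for x
  proof -
    have "?Q ** transpose ?Q = mat 1"
      using orthonormal_matrix[OF e(1)] by (simp add: orthogonal_matrix_def)
    then show ?thesis
      using Q[of "transpose ?Q *v x"] by (simp only: matrix_vector_mul_assoc matrix_vector_mul_lid)
  qed
  note iso = nn_integral_lborel_isometry[OF isometry_invertible]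
  have "(\<integral>\<^sup>+x. f x \<partial>lborel) = (\<integral>\<^sup>+x. f (U *v x) \<partial>lborel)"
    by (rule iso[symmetric]) (use U f in auto)
  also have "\<dots> = (\<integral>\<^sup>+x. f (U *v (transpose ?Q *v x)) \<partial>lborel)"
    by (rule iso[symmetric]) (use QT meas in auto)
  also have "\<dots> = ennreal \<bar>det N\<bar> * (\<integral>\<^sup>+x. f (U *v (transpose ?Q *v (?D *v x))) \<partial>lborel)"
    unfolding e(3)
    using nn_integral_lborel_diagonal[OF d meas[of "U ** transpose ?Q"]] e(2)
    by (simp only: abs_of_nonneg prod_nonneg matrix_vector_mul_assoc[symmetric])
  also have "(\<integral>\<^sup>+x. f (U *v (transpose ?Q *v (?D *v x))) \<partial>lborel) =
      (\<integral>\<^sup>+x. f (U *v (transpose ?Q *v (?D *v (?Q *v x)))) \<partial>lborel)"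
    using meas[of "U ** (transpose ?Q ** ?D)"]
    by (intro iso[symmetric] Q) (simp only: matrix_vector_mul_assoc[symmetric])
  finally show ?thesis
    by (subst (2) N) (simp only: matrix_vector_mul_assoc[symmetric])
qed

lemma nn_integral_power_Icc:
  assumes "b \<ge> 0" "n > 0"
  shows "(\<integral>\<^sup>+t. ennreal (real n * t ^ (n - 1)) * indicator {0..b} t \<partial>lborel) = ennreal (b ^ n)"
  using nn_integral_FTC_Icc[of "\<lambda>t. real n * t ^ (n - 1)" 0 b "\<lambda>t. t ^ n"] assms
  by (auto intro!: derivative_eq_intros simp: power_0_left)

text \<open>Evaluates the inner integral in the polar coordinate formula; there
  \<open>a = norm y / r (sgn y)\<close>, so the result carries the factor
  \<open>r (sgn y) ^ n\<close>.\<close>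

lemma nn_integral_inverse_power_atLeast:
  fixes a :: real
  assumes "a > 0" "n > 0"
  shows "(\<integral>\<^sup>+t. ennreal (real n / t ^ (n + 1)) * indicator {a..} t \<partial>lborel) = ennreal (1 / a ^ n)"
proof -
  have "(\<integral>\<^sup>+t. ennreal (real n / t ^ (n + 1)) * indicator {a..} t \<partial>lborel) = ennreal (0 - - inverse (a ^ n))"
  proof (rule nn_integral_FTC_atLeast)
    fix x assume "a \<le> x"
    with assms have x: "x > 0"
      by simp
    have "x ^ (n - 1) * x = x ^ n"
      using assms by (simp add: power_eq_if)
    then show "((\<lambda>t. - inverse (t ^ n)) has_real_derivative real n / x ^ (n + 1)) (at x)"
      using x by (auto intro!: derivative_eq_intros simp: field_simps)
  next
    show "((\<lambda>t::real. - inverse (t ^ n)) \<longlongrightarrow> 0) at_top"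
      using tendsto_minus[OF tendsto_inverse_0_at_top[OF filterlim_pow_at_top[OF assms(2) filterlim_ident]]]
      by simp
  qed (use assms in auto)
  then show ?thesis
    by (simp add: divide_inverse)
qed

section \<open>Polar coordinates and radial functions\<close>

text \<open>Insert the integral over \<open>t\<close> of \<open>n * t ^ (n - 1) * norm x ^ n\<close> over \<open>0 < t \<le> 1 / norm x\<close>, which
  is 1, interchange the integrals and substitute \<open>y = t x\<close>.\<close>

proposition nn_integral_below_radial_graph:
  fixes g :: "real^'n \<Rightarrow> ennreal" and r :: "real^'n \<Rightarrow> real"
  assumes [measurable]: "g \<in> borel_measurable borel" "r \<in> borel_measurable borel"
    and r: "\<And>x. r x > 0"
  shows "(\<integral>\<^sup>+x. g (sgn x) * indicator {x. x \<noteq> 0 \<and> norm x \<le> r (sgn x)} x \<partial>lborel) =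
    (\<integral>\<^sup>+x. g (sgn x) * ennreal (r (sgn x) ^ CARD('n)) * indicator (cball 0 1 - {0}) x \<partial>lborel)"
proof -
  let ?n = "CARD('n)"
  have n: "?n > 0"
    by simp
  define G where "G x = g (sgn x) * indicator {x. x \<noteq> 0 \<and> norm x \<le> r (sgn x)} x" for x
  have [measurable]: "G \<in> borel_measurable borel"
    unfolding G_def by measurable
  define k where "k x t = ennreal (real ?n * t ^ (?n - 1)) * ennreal (norm x ^ ?n) *
      indicator {t. 0 < t \<and> t * norm x \<le> 1} t" for x :: "real^'n" and t :: real
  have [measurable]: "case_prod k \<in> borel_measurable (borel \<Otimes>\<^sub>M borel)"
    unfolding k_def by measurable
  \<comment> \<open>The integrand after the substitution \<open>y = t x\<close>. The constraints
    \<open>t * norm x \<le> 1\<close> and \<open>norm x \<le> r (sgn x)\<close> become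
    \<open>norm y \<le> 1\<close> and \<open>norm y / r (sgn y) \<le> t\<close>. The weight
    \<open>n / t ^ (n + 1)\<close> collects \<open>n * t ^ (n - 1)\<close>, the factor
    \<open>1 / t ^ n\<close> from \<open>norm x ^ n\<close> and the Jacobian
    \<open>1 / t ^ n\<close>.\<close>
  define H where "H y t = (if y \<noteq> 0 \<and> norm y \<le> 1 \<and> norm y / r (sgn y) \<le> t
      then g (sgn y) * ennreal (norm y ^ ?n) * ennreal (real ?n / t ^ (?n + 1)) else 0)" for y t
  have [measurable]: "case_prod H \<in> borel_measurable (borel \<Otimes>\<^sub>M borel)"
    unfolding H_def by measurable
  have H_eq: "H y t = g (sgn y) * ennreal (norm y ^ ?n) * indicator (cball 0 1 - {0}) y *
      (ennreal (real ?n / t ^ (?n + 1)) * indicator {norm y / r (sgn y)..} t)" for y t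
    unfolding H_def indicator_def by auto
  have k1: "(\<integral>\<^sup>+t. k x t \<partial>lborel) = 1" if "x \<noteq> 0" for x
  proof -
    have "(\<integral>\<^sup>+t. k x t \<partial>lborel) =
        (\<integral>\<^sup>+t. ennreal (norm x ^ ?n) * (ennreal (real ?n * t ^ (?n - 1)) * indicator {0..1 / norm x} t) \<partial>lborel)"
    proof (rule nn_integral_cong_AE)
      \<comment> \<open>The two integrands can differ only at \<open>t = 0\<close>, which
        \<open>k\<close> excludes and the closed interval contains.\<close>
      have "AE t in lborel. t \<noteq> (0::real)"
        by (rule AE_lborel_singleton)
      then show "AE t in lborel. k x t =
          ennreal (norm x ^ ?n) * (ennreal (real ?n * t ^ (?n - 1)) * indicator {0..1 / norm x} t)"
        by eventually_elim (use that in \<open>auto simp: k_def field_simps mult.left_commute split: split_indicator\<close>)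
    qed
    also have "\<dots> = ennreal (norm x ^ ?n) * ennreal ((1 / norm x) ^ ?n)"
      using n by (subst nn_integral_cmult) (simp_all only: nn_integral_power_Icc zero_le_divide_1_iff norm_ge_zero, measurable)
    also have "\<dots> = 1"
      using that by (simp add: power_one_over flip: ennreal_mult)
    finally show ?thesis .
  qed
  have "(\<integral>\<^sup>+x. G x \<partial>lborel) = (\<integral>\<^sup>+x. \<integral>\<^sup>+t. G x * k x t \<partial>lborel \<partial>lborel)"
  proof (rule nn_integral_cong)
    fix x :: "real^'n"
    have "G x = G x * (\<integral>\<^sup>+t. k x t \<partial>lborel)"
      by (cases "x = 0") (auto simp: k1 G_def)
    then show "G x = (\<integral>\<^sup>+t. G x * k x t \<partial>lborel)"
      by (simp add: nn_integral_cmult)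
  qed
  also have "\<dots> = (\<integral>\<^sup>+t. \<integral>\<^sup>+x. G x * k x t \<partial>lborel \<partial>lborel)"
    by (rule lborel_pair.Fubini'[symmetric]) measurable
  also have "\<dots> = (\<integral>\<^sup>+t. \<integral>\<^sup>+y. g (sgn y) * ennreal (norm y ^ ?n) * indicator (cball 0 1 - {0}) y *
      (ennreal (real ?n / t ^ (?n + 1)) * indicator {norm y / r (sgn y)..} t) \<partial>lborel \<partial>lborel)"
  proof (rule nn_integral_cong)
    fix t :: real
    show "(\<integral>\<^sup>+x. G x * k x t \<partial>lborel) =
        (\<integral>\<^sup>+y. g (sgn y) * ennreal (norm y ^ ?n) * indicator (cball 0 1 - {0}) y *
        (ennreal (real ?n / t ^ (?n + 1)) * indicator {norm y / r (sgn y)..} t) \<partial>lborel)" (is "_ = ?R")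
    proof (cases "t > 0")
      case True
      have "(\<integral>\<^sup>+x. G x * k x t \<partial>lborel) = ennreal ((1 / t) ^ ?n) * (\<integral>\<^sup>+y. G (y /\<^sub>R t) * k (y /\<^sub>R t) t \<partial>lborel)"
        using True by (subst nn_integral_lborel_affine[of _ "1 / t" 0]) (auto simp: divide_inverse)
      also have "\<dots> = (\<integral>\<^sup>+y. ennreal ((1 / t) ^ ?n) * (G (y /\<^sub>R t) * k (y /\<^sub>R t) t) \<partial>lborel)"
        by (simp add: nn_integral_cmult)
      also have "\<dots> = ?R"
      proof (rule nn_integral_cong)
        fix y :: "real^'n"
        have s: "sgn (y /\<^sub>R t) = sgn y"
          using True by (simp add: sgn_div_norm)
        have i1: "norm (y /\<^sub>R t) \<le> r (sgn y) \<longleftrightarrow> norm y / r (sgn y) \<le> t"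
          using True r[of "sgn y"] by (simp add: field_simps)
        have i2: "t * norm (y /\<^sub>R t) = norm y" "t * (inverse t * norm y) = norm y"
          using True by simp_all
        have tn: "t ^ ?n = t ^ (?n - 1) * t"
          using n by (simp add: power_eq_if)
        have "(1 / t) ^ ?n * (real ?n * t ^ (?n - 1) * norm (y /\<^sub>R t) ^ ?n) =
            norm y ^ ?n * (real ?n / t ^ (?n + 1))"
          using True by (simp add: tn power_mult_distrib power_divide field_simps)
        moreover have "ennreal ((1 / t) ^ ?n) * (ennreal (real ?n * t ^ (?n - 1)) * ennreal (norm (y /\<^sub>R t) ^ ?n)) =
            ennreal ((1 / t) ^ ?n * (real ?n * t ^ (?n - 1) * norm (y /\<^sub>R t) ^ ?n))"
          using True by (simp add: ennreal_mult)
        moreover have "ennreal (norm y ^ ?n) * ennreal (real ?n / t ^ (?n + 1)) =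
            ennreal (norm y ^ ?n * (real ?n / t ^ (?n + 1)))"
          by (rule ennreal_mult[symmetric]) (use True in auto)
        ultimately have c: "ennreal ((1 / t) ^ ?n) *
              (ennreal (real ?n * t ^ (?n - 1)) * ennreal (norm (y /\<^sub>R t) ^ ?n)) =
            ennreal (norm y ^ ?n) * ennreal (real ?n / t ^ (?n + 1))"
          by (simp only:)
        show "ennreal ((1 / t) ^ ?n) * (G (y /\<^sub>R t) * k (y /\<^sub>R t) t) =
          g (sgn y) * ennreal (norm y ^ ?n) * indicator (cball 0 1 - {0}) y *
          (ennreal (real ?n / t ^ (?n + 1)) * indicator {norm y / r (sgn y)..} t)"
        proof (cases "y \<noteq> 0 \<and> norm y \<le> 1 \<and> norm y / r (sgn y) \<le> t")
          case y: True
          then have "G (y /\<^sub>R t) = g (sgn y)" "k (y /\<^sub>R t) t =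
              ennreal (real ?n * t ^ (?n - 1)) * ennreal (norm (y /\<^sub>R t) ^ ?n)"
            using True i1 i2 unfolding G_def k_def by (auto simp: indicator_def s i2)
          then have "ennreal ((1 / t) ^ ?n) * (G (y /\<^sub>R t) * k (y /\<^sub>R t) t) = g (sgn y) *
              (ennreal ((1 / t) ^ ?n) * (ennreal (real ?n * t ^ (?n - 1)) * ennreal (norm (y /\<^sub>R t) ^ ?n)))"
            by (simp only: mult.left_commute)
          then show ?thesis
            unfolding c using y by (simp add: mult.assoc)
        next
          case False
          then have "G (y /\<^sub>R t) * k (y /\<^sub>R t) t = 0"
            using True i1 i2 unfolding G_def k_def by (auto simp: indicator_def s i2)
          moreover have "indicator (cball 0 1 - {0}) y * indicator {norm y / r (sgn y)..} t = (0 :: ennreal)"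
            using False by (auto simp: indicator_def)
          ultimately show ?thesis
            by (auto simp: indicator_def)
        qed
      qed
      finally show ?thesis .
    next
      case False
      have z: "k x t = 0" for x
        using False by (simp add: k_def)
      have "indicator (cball 0 1 - {0}) y * indicator {norm y / r (sgn y)..} t = (0 :: ennreal)" for y :: "real^'n"
        using False r[of "sgn y"] by (auto simp: indicator_def field_simps) (smt (verit) mult_pos_neg norm_eq_zero norm_ge_zero mult_nonneg_nonpos2 zero_less_norm_iff)
      then have e: "g (sgn y) * ennreal (norm y ^ ?n) * indicator (cball 0 1 - {0}) y *
        (ennreal (real ?n / t ^ (?n + 1)) * indicator {norm y / r (sgn y)..} t) = 0" for y
        by (subst mult.assoc, subst mult.left_commute[of "indicator _ _"]) simp
      then show ?thesis
        by (simp only: z e mult_zero_right nn_integral_const mult_zero_left)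
    qed
  qed
  also have "\<dots> = (\<integral>\<^sup>+y. \<integral>\<^sup>+t. g (sgn y) * ennreal (norm y ^ ?n) * indicator (cball 0 1 - {0}) y *
      (ennreal (real ?n / t ^ (?n + 1)) * indicator {norm y / r (sgn y)..} t) \<partial>lborel \<partial>lborel)"
    unfolding H_eq[symmetric] by (rule lborel_pair.Fubini') measurable
  also have "\<dots> = (\<integral>\<^sup>+y. g (sgn y) * ennreal (r (sgn y) ^ ?n) * indicator (cball 0 1 - {0}) y \<partial>lborel)"
  proof (rule nn_integral_cong)
    fix y :: "real^'n"
    show "(\<integral>\<^sup>+t. g (sgn y) * ennreal (norm y ^ ?n) * indicator (cball 0 1 - {0}) y *
      (ennreal (real ?n / t ^ (?n + 1)) * indicator {norm y / r (sgn y)..} t) \<partial>lborel) =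
      g (sgn y) * ennreal (r (sgn y) ^ ?n) * indicator (cball 0 1 - {0}) y" (is "?L = _")
    proof (cases "y = 0")
      case False
      then have pos: "norm y / r (sgn y) > 0"
        using r by simp
      have "?L = g (sgn y) * ennreal (norm y ^ ?n) * indicator (cball 0 1 - {0}) y *
          ennreal (1 / (norm y / r (sgn y)) ^ ?n)"
        by (subst nn_integral_cmult) (simp_all only: nn_integral_inverse_power_atLeast[OF pos n], measurable)
      also have "\<dots> = g (sgn y) * (ennreal (norm y ^ ?n) * ennreal (1 / (norm y / r (sgn y)) ^ ?n)) *
          indicator (cball 0 1 - {0}) y"
        by (simp add: mult_ac)
      also have "ennreal (norm y ^ ?n) * ennreal (1 / (norm y / r (sgn y)) ^ ?n) = ennreal (r (sgn y) ^ ?n)"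
        using False r[of "sgn y"] by (subst ennreal_mult[symmetric]) (auto simp: power_divide less_imp_le)
      finally show ?thesis .
    qed auto
  qed
  finally show ?thesis
    by (simp add: G_def)
qed

section \<open>The spherical measure and star bodies\<close>

lemma space_spherical_measure: "space spherical_measure = sphere 0 1"
  by (simp add: spherical_measure_def space_scale_measure space_restrict_space)

lemma sets_spherical_measure [measurable_cong]:
  "sets spherical_measure = sets (restrict_space borel (sphere 0 1))"
  by (simp add: spherical_measure_def)

lemma sgn_measurable_sphere:
  "sgn \<in> measurable (restrict_space lborel (cball 0 1 - {0})) (restrict_space borel (sphere (0::real^'n) 1))"
  by (intro measurable_restrict_space2 measurable_restrict_space1)
    (auto simp: norm_sgn space_restrict_space)

lemma nn_integral_spherical_measure:
  fixes g :: "real^'n \<Rightarrow> ennreal"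
  assumes [measurable]: "g \<in> borel_measurable borel"
  shows "(\<integral>\<^sup>+u. g u \<partial>spherical_measure) =
    of_nat CARD('n) * (\<integral>\<^sup>+x. g (sgn x) * indicator (cball 0 1 - {0}) x \<partial>lborel)"
proof -
  have m: "g \<in> borel_measurable (restrict_space borel (sphere 0 1))"
    by (rule measurable_restrict_space1) measurable
  show ?thesis
    unfolding spherical_measure_def
    by (subst nn_integral_scale_measure)
      (use m in \<open>auto simp: nn_integral_distr[OF sgn_measurable_sphere] nn_integral_restrict_space\<close>)
qed

text \<open>On a ray the admissible \<open>l\<close> form a closed bounded set because
  \<open>K\<close> is compact, and this set contains a positive number because 0 is interior. So the
  supremum is attained and positive, and star-shapedness fills the interval below it.\<close>

lemma radial_set:
  fixes K :: "(real^'n) set"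
  assumes K: "K \<in> star_bodies" and x: "x \<noteq> 0"
  shows "radial_fun K x > 0" "\<And>l. l \<ge> 0 \<Longrightarrow> l *\<^sub>R x \<in> K \<longleftrightarrow> l \<le> radial_fun K x"
proof -
  define S where "S = {l. 0 \<le> l \<and> l *\<^sub>R x \<in> K}"
  have comp: "compact K" and star: "\<And>x l. x \<in> K \<Longrightarrow> l \<in> {0..1} \<Longrightarrow> l *\<^sub>R x \<in> K"
    and int: "0 \<in> interior K"
    using K by (auto simp: star_bodies_def)
  have cl: "closed S"
  proof -
    have "closed ((\<lambda>l. l *\<^sub>R x) -` K)"
      by (intro closed_vimage compact_imp_closed comp continuous_intros)
    then have "closed ({0..} \<inter> (\<lambda>l. l *\<^sub>R x) -` K)"
      by (intro closed_Int) auto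
    also have "{0..} \<inter> (\<lambda>l. l *\<^sub>R x) -` K = S"
      by (auto simp: S_def)
    finally show ?thesis .
  qed
  obtain b where b: "\<And>y. y \<in> K \<Longrightarrow> norm y \<le> b"
    using compact_imp_bounded[OF comp] by (auto simp: bounded_iff)
  have bdd: "bdd_above S"
  proof (rule bdd_aboveI)
    fix l assume "l \<in> S"
    then have "l * norm x \<le> b"
      using b[of "l *\<^sub>R x"] by (simp add: S_def)
    then show "l \<le> b / norm x"
      using x by (simp add: field_simps)
  qed
  obtain e where e: "e > 0" "ball 0 e \<subseteq> K"
    using int by (auto simp: mem_interior)
  have eS: "e / (2 * norm x) \<in> S"
    using e x by (auto simp: S_def intro!: subsetD[OF e(2)])
  have sup: "radial_fun K x \<in> S"
    unfolding radial_fun_def S_def[symmetric]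
    by (rule closed_contains_Sup[OF _ bdd cl]) (use eS in blast)
  have up: "l \<le> radial_fun K x" if "l \<in> S" for l
    unfolding radial_fun_def S_def[symmetric] by (rule cSup_upper[OF that bdd])
  show pos: "radial_fun K x > 0"
    using up[OF eS] e(1) x by (smt (verit) divide_pos_pos mult_pos_pos zero_less_norm_iff)
  show "l *\<^sub>R x \<in> K \<longleftrightarrow> l \<le> radial_fun K x" if "l \<ge> 0" for l
  proof
    assume "l *\<^sub>R x \<in> K"
    then show "l \<le> radial_fun K x"
      using that by (intro up) (simp add: S_def)
  next
    assume l: "l \<le> radial_fun K x"
    have "(l / radial_fun K x) *\<^sub>R (radial_fun K x *\<^sub>R x) \<in> K"
      by (rule star) (use sup l that pos in \<open>auto simp: S_def\<close>)
    then show "l *\<^sub>R x \<in> K"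
      using pos by simp
  qed
qed

lemma radial_fun_eqI:
  assumes "c \<ge> 0" "\<And>l. l \<ge> 0 \<Longrightarrow> l *\<^sub>R x \<in> K \<longleftrightarrow> l \<le> c"
  shows "radial_fun K x = c"
proof -
  have "{l. 0 \<le> l \<and> l *\<^sub>R x \<in> K} = {0..c}"
    using assms by auto
  then show ?thesis
    using assms(1) by (simp add: radial_fun_def)
qed

lemma radial_fun_scaleR:
  assumes "K \<in> star_bodies" "x \<noteq> 0" "c > 0"
  shows "radial_fun K (c *\<^sub>R x) = radial_fun K x / c"
proof (rule radial_fun_eqI)
  show "radial_fun K x / c \<ge> 0"
    using radial_set(1)[OF assms(1,2)] assms(3) by simp
  show "l *\<^sub>R c *\<^sub>R x \<in> K \<longleftrightarrow> l \<le> radial_fun K x / c" if "l \<ge> 0" for l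
    using radial_set(2)[OF assms(1,2), of "l * c"] that assms(3) by (simp add: pos_le_divide_eq)
qed

lemma radial_fun_sgn:
  assumes "K \<in> star_bodies" "x \<noteq> 0"
  shows "radial_fun K x = radial_fun K (sgn x) / norm x"
proof -
  have "radial_fun K (norm x *\<^sub>R sgn x) = radial_fun K (sgn x) / norm x"
    using assms by (intro radial_fun_scaleR) (auto simp: sgn_zero_iff)
  then show ?thesis
    using assms(2) by (simp add: sgn_div_norm)
qed

lemma radial_fun_lin_image:
  assumes "invertible A"
  shows "radial_fun (lin_image A K) (A *v x) = radial_fun K x"
proof -
  have "inj ((*v) A)"
    using assms by (simp add: invertible_eq_bij bij_is_inj)
  then have "l *\<^sub>R (A *v x) \<in> lin_image A K \<longleftrightarrow> l *\<^sub>R x \<in> K" for l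
    by (auto simp: inj_def simp flip: matrix_vector_mult_scaleR)
  then show ?thesis
    by (simp add: radial_fun_def)
qed

lemma invertible_obtains:
  fixes A :: "real^'n^'n"
  assumes "invertible A"
  obtains B where "A ** B = mat 1" "B ** A = mat 1" "invertible B"
  using assms unfolding invertible_def by blast

text \<open>The point is continuity of the radial function. With \<open>B\<close> the inverse of
  \<open>A\<close>, homogeneity gives \<open>radial_fun (lin_image A K) u = radial_fun K (sgn (B *v
  u)) / norm (B *v u)\<close>.\<close>

lemma lin_image_star_bodies:
  fixes K :: "(real^'n) set"
  assumes K: "K \<in> star_bodies" and A: "invertible A"
  shows "lin_image A K \<in> star_bodies"
proof -
  obtain B where B: "A ** B = mat 1" "B ** A = mat 1" "invertible B"
    using invertible_obtains[OF A] .
  have bl: "bounded_linear ((*v) A)" "inj ((*v) A)"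
    using A by (auto simp: invertible_eq_bij bij_is_inj)
  have nz: "B *v u \<noteq> 0" if "u \<in> sphere 0 1" for u
  proof
    assume "B *v u = 0"
    then have "A *v (B *v u) = 0"
      by simp
    then show False
      using that by (simp only: matrix_vector_mul_assoc B) auto
  qed
  have K': "compact K" "0 \<in> interior K" "continuous_on (sphere 0 1) (radial_fun K)"
    "\<And>x l. x \<in> K \<Longrightarrow> l \<in> {0..1} \<Longrightarrow> l *\<^sub>R x \<in> K"
    using K by (auto simp: star_bodies_def)
  have "compact (lin_image A K)"
    by (intro compact_continuous_image K'(1) linear_continuous_on bl)
  moreover have "\<forall>x\<in>lin_image A K. \<forall>l\<in>{0..1}. l *\<^sub>R x \<in> lin_image A K"
    using K'(4) by (auto simp flip: matrix_vector_mult_scaleR)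
  moreover have "0 \<in> interior (lin_image A K)"
    using K'(2) interior_injective_linear_image[OF bounded_linear.linear[OF bl(1)] bl(2), of K]
    by (auto intro!: image_eqI[of _ _ 0])
  moreover have "continuous_on (sphere 0 1) (radial_fun (lin_image A K))"
  proof -
    have "radial_fun K (sgn (B *v u)) / norm (B *v u) = radial_fun (lin_image A K) u"
      if "u \<in> sphere 0 1" for u
    proof -
      have "radial_fun (lin_image A K) (A *v (B *v u)) = radial_fun K (sgn (B *v u)) / norm (B *v u)"
        using radial_fun_lin_image[OF A] radial_fun_sgn[OF K nz[OF that]] by simp
      then show ?thesis
        by (simp only: matrix_vector_mul_assoc B matrix_vector_mul_lid)
    qed
    moreover have "continuous_on (sphere 0 1) (\<lambda>u. radial_fun K (sgn (B *v u)) / norm (B *v u))"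
      using nz
      by (intro continuous_intros continuous_on_compose2[OF K'(3)] linear_continuous_on)
        (auto simp: norm_sgn intro!: continuous_intros linear_continuous_on)
    ultimately show ?thesis
      by (rule continuous_on_eq[rotated])
  qed
  ultimately show ?thesis
    by (simp add: star_bodies_def)
qed

lemma dilate_conv_lin_image: "dilate c K = lin_image (c *\<^sub>R mat 1) K"
  by (simp flip: scaleR_matrix_vector_assoc)

lemma scaled_identity_invertible: "c \<noteq> 0 \<Longrightarrow> invertible (c *\<^sub>R mat 1 :: real^'n^'n)"
  unfolding invertible_def
  by (intro exI[of _ "inverse c *\<^sub>R mat 1"])
    (simp add: matrix_scaleR scalar_matrix_assoc matrix_scalar_ac flip: scalar_mult_eq_scaleR)

lemma dilate_star_bodies:
  assumes "K \<in> star_bodies" "c > 0"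
  shows "dilate c K \<in> star_bodies"
  unfolding dilate_conv_lin_image
  using assms scaled_identity_invertible[of c] by (intro lin_image_star_bodies) auto

section \<open>Measures on the sphere\<close>

lemma continuous_on_sphere_measurable:
  "continuous_on (sphere 0 1) g \<Longrightarrow> g \<in> borel_measurable (restrict_space borel (sphere 0 1))"
  by (rule borel_measurable_continuous_on_restrict)

lemma continuous_on_sphere_bounded:
  fixes g :: "real^'n \<Rightarrow> real"
  assumes "continuous_on (sphere 0 1) g"
  obtains B where "\<And>u. norm u = 1 \<Longrightarrow> \<bar>g u\<bar> \<le> B"
proof -
  have "bounded (g ` sphere 0 1)"
    by (intro compact_imp_bounded compact_continuous_image assms) auto
  then obtain B where "\<forall>u\<in>sphere 0 1. \<bar>g u\<bar> \<le> B"
    by (auto simp: bounded_iff)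
  then show thesis
    by (intro that[of B]) simp
qed

text \<open>Continuity on the sphere says nothing about \<open>g\<close> elsewhere. Multiplication
  by the indicator of the sphere gives a Borel function on the whole space with the same
  integrals.\<close>

lemma nn_integral_spherical_measure_continuous:
  fixes g :: "real^'n \<Rightarrow> real"
  assumes g: "continuous_on (sphere 0 1) g"
  shows "(\<integral>\<^sup>+u. ennreal (g u) \<partial>spherical_measure) =
    of_nat CARD('n) * (\<integral>\<^sup>+x. ennreal (g (sgn x)) * indicator (cball 0 1 - {0}) x \<partial>lborel)"
proof -
  let ?g = "\<lambda>u. indicator (sphere 0 1) u *\<^sub>R g u"
  have [measurable]: "?g \<in> borel_measurable borel"
    by (rule borel_measurable_continuous_on_indicator) (use g in auto)
  have "(\<integral>\<^sup>+u. ennreal (g u) \<partial>spherical_measure) = (\<integral>\<^sup>+u. ennreal (?g u) \<partial>spherical_measure)"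
    by (intro nn_integral_cong) (auto simp: space_spherical_measure)
  also have "\<dots> = of_nat CARD('n) * (\<integral>\<^sup>+x. ennreal (?g (sgn x)) * indicator (cball 0 1 - {0}) x \<partial>lborel)"
    by (rule nn_integral_spherical_measure) measurable
  also have "(\<integral>\<^sup>+x. ennreal (?g (sgn x)) * indicator (cball 0 1 - {0}) x \<partial>lborel) =
      (\<integral>\<^sup>+x. ennreal (g (sgn x)) * indicator (cball 0 1 - {0}) x \<partial>lborel)"
    by (intro nn_integral_cong) (auto simp: indicator_def norm_sgn)
  finally show ?thesis .
qed

text \<open>The condition \<open>integral_pos\<close> is full support, tested on continuous
  functions. It is the source of strict inequalities between integrals, and hence of strict
  monotonicity of \<open>F\<close> along rays.\<close>

locale full_sphere_measure = finite_measure \<nu> for \<nu> :: "(real^'n) measure" +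
  assumes sets_nu: "sets \<nu> = sets (restrict_space borel (sphere 0 1))"
    and integral_pos: "\<And>(g :: real^'n \<Rightarrow> real) u0. continuous_on (sphere 0 1) g \<Longrightarrow> (\<And>u. norm u = 1 \<Longrightarrow> 0 \<le> g u) \<Longrightarrow>
      norm u0 = 1 \<Longrightarrow> 0 < g u0 \<Longrightarrow> 0 < (\<integral>u. g u \<partial>\<nu>)"
begin

lemma space_nu: "space \<nu> = sphere 0 1"
  using sets_eq_imp_space_eq[OF sets_nu] by (simp add: space_restrict_space)

lemma measurable_nu:
  fixes g :: "real^'n \<Rightarrow> real"
  assumes "continuous_on (sphere 0 1) g"
  shows "g \<in> borel_measurable \<nu>"
  using continuous_on_sphere_measurable[OF assms] measurable_cong_sets[OF sets_nu refl] by blast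

lemma integrable_nu:
  fixes g :: "real^'n \<Rightarrow> real"
  assumes "continuous_on (sphere 0 1) g"
  shows "integrable \<nu> g"
proof -
  obtain B where "\<And>u. norm u = 1 \<Longrightarrow> \<bar>g u\<bar> \<le> B"
    using continuous_on_sphere_bounded[OF assms] by blast
  then show ?thesis
    by (intro integrable_const_bound[of _ B] measurable_nu assms AE_I2) (auto simp: space_nu)
qed

lemma integral_mono_nu:
  fixes f g :: "real^'n \<Rightarrow> real"
  assumes "continuous_on (sphere 0 1) f" "continuous_on (sphere 0 1) g"
    and "\<And>u. norm u = 1 \<Longrightarrow> f u \<le> g u"
  shows "(\<integral>u. f u \<partial>\<nu>) \<le> (\<integral>u. g u \<partial>\<nu>)"
  by (intro integral_mono integrable_nu assms) (auto simp: space_nu intro!: assms)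

lemma integral_less_nu:
  fixes f g :: "real^'n \<Rightarrow> real"
  assumes fg: "continuous_on (sphere 0 1) f" "continuous_on (sphere 0 1) g"
    and "\<And>u. norm u = 1 \<Longrightarrow> f u \<le> g u" "norm u0 = 1" "f u0 < g u0"
  shows "(\<integral>u. f u \<partial>\<nu>) < (\<integral>u. g u \<partial>\<nu>)"
proof -
  have "0 < (\<integral>u. g u - f u \<partial>\<nu>)"
    by (rule integral_pos[of _ u0]) (use assms in \<open>auto intro!: continuous_intros\<close>)
  then show ?thesis
    by (simp add: integrable_nu fg)
qed

end

lemma finite_spherical_measure: "finite_measure (spherical_measure :: (real^'n) measure)"
proof (rule finite_measureI)
  have "emeasure (spherical_measure :: (real^'n) measure) (space spherical_measure) =
      (\<integral>\<^sup>+u. ennreal 1 \<partial>(spherical_measure :: (real^'n) measure))"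
    by simp
  also have "\<dots> = of_nat CARD('n) * emeasure lborel (cball 0 1 - {0} :: (real^'n) set)"
    by (subst nn_integral_spherical_measure_continuous) auto
  also have "\<dots> < top"
  proof -
    have "emeasure lborel (cball 0 1 - {0} :: (real^'n) set) \<le> emeasure lborel (cball 0 1 :: (real^'n) set)"
      by (rule emeasure_mono) auto
    also have "\<dots> < top"
      using emeasure_lborel_cball_finite[of "0 :: real^'n" 1] by simp
    finally show ?thesis
      by (simp add: ennreal_mult_less_top of_nat_less_top)
  qed
  finally show "emeasure (spherical_measure :: (real^'n) measure) (space spherical_measure) \<noteq> \<infinity>"
    by simp
qed

text \<open>The points of the open unit ball, other than 0, in whose direction \<open>g\<close> is
  positive form a nonempty open set. Such a set is not null, so the integral of \<open>g\<close>
  over the cone cannot vanish.\<close>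

lemma spherical_measure_full: "full_sphere_measure (spherical_measure :: (real^'n) measure)"
proof (intro full_sphere_measure.intro full_sphere_measure_axioms.intro finite_spherical_measure
    sets_spherical_measure)
  fix g :: "real^'n \<Rightarrow> real" and u0
  assume g: "continuous_on (sphere 0 1) g" "\<And>u. norm u = 1 \<Longrightarrow> 0 \<le> g u" and u0: "norm u0 = 1" "0 < g u0"
  interpret finite_measure "spherical_measure :: (real^'n) measure"
    by (rule finite_spherical_measure)
  let ?U = "{x \<in> ball 0 1 - {0}. g (sgn x) \<in> {0<..}}"
  have "continuous_on (ball 0 1 - {0}) (\<lambda>x. g (sgn x))"
    by (rule continuous_on_compose2[OF g(1)]) (auto intro!: continuous_intros simp: norm_sgn split: if_splits)
  then have U: "open ?U"
    by (intro continuous_open_preimage[of "ball 0 1 - {0}" _ "{0<..}", unfolded vimage_def Int_def mem_Collect_eq]) auto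
  moreover have "(1/2) *\<^sub>R u0 \<in> ?U"
    using u0 by (auto simp: sgn_div_norm)
  ultimately have "\<not> negligible ?U"
    using open_not_negligible by blast
  then have "emeasure lborel ?U \<noteq> 0"
    using U by (auto simp: negligible_iff_null_sets null_sets_def emeasure_completion)
  have [measurable]: "(\<lambda>x. indicator (sphere 0 1) x *\<^sub>R g x) \<in> borel_measurable borel"
    by (rule borel_measurable_continuous_on_indicator) (use g in auto)
  have [measurable]: "cball 0 1 \<in> sets (borel :: (real^'n) measure)" "{0} \<in> sets (borel :: (real^'n) measure)"
    by auto
  let ?G = "\<lambda>x. ennreal (indicator (sphere 0 1) (sgn x) *\<^sub>R g (sgn x)) * indicator (cball 0 1 - {0}) x"
  have [measurable]: "?G \<in> borel_measurable borel"
    using measurable_compose[OF borel_measurable_sgn \<open>(\<lambda>x. indicator (sphere 0 1) x *\<^sub>R g x) \<in> _\<close>]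
    by measurable
  have "(\<integral>\<^sup>+x. ?G x \<partial>lborel) \<noteq> 0"
  proof
    assume "(\<integral>\<^sup>+x. ?G x \<partial>lborel) = 0"
    then have "AE x in lborel. ?G x = 0"
      by (rule nn_integral_0_iff_AE[THEN iffD1, rotated]) measurable
    then have "AE x in lborel. x \<notin> ?U"
      by eventually_elim (auto simp: indicator_def norm_sgn split: if_splits)
    then have "emeasure lborel ?U = 0"
      using U by (subst (asm) AE_iff_measurable[OF _ refl]) auto
    then show False
      using \<open>emeasure lborel ?U \<noteq> 0\<close> by simp
  qed
  moreover have "(\<integral>\<^sup>+x. ?G x \<partial>lborel) = (\<integral>\<^sup>+x. ennreal (g (sgn x)) * indicator (cball 0 1 - {0}) x \<partial>lborel)"
    by (intro nn_integral_cong) (auto simp: indicator_def norm_sgn)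
  ultimately have nz: "(\<integral>\<^sup>+u. ennreal (g u) \<partial>spherical_measure) \<noteq> 0"
    by (subst nn_integral_spherical_measure_continuous[OF g(1)]) auto
  obtain B where B: "\<And>u. norm u = 1 \<Longrightarrow> \<bar>g u\<bar> \<le> B"
    using continuous_on_sphere_bounded[OF g(1)] by blast
  have m: "g \<in> borel_measurable spherical_measure"
    using continuous_on_sphere_measurable[OF g(1)] measurable_cong_sets[OF sets_spherical_measure refl] by blast
  have "integrable spherical_measure g"
    using B by (intro integrable_const_bound[of _ B] m AE_I2) (auto simp: space_spherical_measure)
  then have "(\<integral>\<^sup>+u. ennreal (g u) \<partial>spherical_measure) = ennreal (\<integral>u. g u \<partial>spherical_measure)"
    by (intro nn_integral_eq_integral AE_I2) (auto simp: space_spherical_measure g(2))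
  then show "0 < (\<integral>u. g u \<partial>spherical_measure)"
    using nz by (auto simp: ennreal_eq_0_iff not_le)
qed

lemma full_sphere_measure_density:
  fixes w :: "real^'n \<Rightarrow> real"
  assumes w: "continuous_on (sphere 0 1) w" "\<And>u. norm u = 1 \<Longrightarrow> w u > 0"
  defines "D \<equiv> density spherical_measure (\<lambda>u. ennreal (w u))"
  shows "full_sphere_measure D"
    and "\<And>g :: real^'n \<Rightarrow> real. continuous_on (sphere 0 1) g \<Longrightarrow> (\<integral>u. g u \<partial>D) = (\<integral>u. w u * g u \<partial>spherical_measure)"
proof -
  interpret S: full_sphere_measure "spherical_measure :: (real^'n) measure"
    by (rule spherical_measure_full)
  have m: "w \<in> borel_measurable spherical_measure" "g \<in> borel_measurable spherical_measure"
    if "continuous_on (sphere 0 1) g" for g :: "real^'n \<Rightarrow> real"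
    using S.measurable_nu w(1) that by auto
  note [measurable] = S.measurable_nu[OF w(1)]
  note D_def [simp]
  show int: "(\<integral>u. g u \<partial>D) = (\<integral>u. w u * g u \<partial>spherical_measure)"
    if "continuous_on (sphere 0 1) g" for g :: "real^'n \<Rightarrow> real"
    unfolding D_def using w(2)
    by (subst integral_density) (auto intro!: m[OF that] AE_I2 simp: space_spherical_measure less_imp_le)
  have "emeasure D (space D) = (\<integral>\<^sup>+u. ennreal (w u) \<partial>spherical_measure)"
    unfolding D_def by (subst emeasure_density) (auto intro!: nn_integral_cong)
  also have "\<dots> = ennreal (\<integral>u. w u \<partial>spherical_measure)"
    using w by (intro nn_integral_eq_integral S.integrable_nu AE_I2) (auto simp: space_spherical_measure less_imp_le)
  finally have fin: "finite_measure D"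
    by (intro finite_measureI) simp
  show "full_sphere_measure D"
  proof (intro full_sphere_measure.intro full_sphere_measure_axioms.intro fin)
    show "sets D = sets (restrict_space borel (sphere 0 1))"
      by (simp add: sets_spherical_measure)
    fix g :: "real^'n \<Rightarrow> real" and u0
    assume g: "continuous_on (sphere 0 1) g" "\<And>u. norm u = 1 \<Longrightarrow> 0 \<le> g u" "norm u0 = 1" "0 < g u0"
    show "0 < (\<integral>u. g u \<partial>D)"
      unfolding int[OF g(1)] using w g
      by (intro S.integral_pos[of _ u0]) (auto intro!: continuous_intros mult_nonneg_nonneg less_imp_le[OF w(2)])
  qed
qed

lemma radial_continuous: "K \<in> star_bodies \<Longrightarrow> continuous_on (sphere 0 1) (radial_fun K)"
  by (simp add: star_bodies_def)

lemma radial_pos: "K \<in> star_bodies \<Longrightarrow> norm u = 1 \<Longrightarrow> radial_fun K u > 0"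
  by (rule radial_set(1)) auto

section \<open>Dual cone measures as integrals over the body\<close>

lemma dual_cone_weight:
  fixes K :: "(real^'n) set"
  assumes K: "K \<in> star_bodies"
  shows "continuous_on (sphere 0 1) (\<lambda>u. radial_fun K u ^ CARD('n) / real CARD('n))"
    "\<And>u. norm u = 1 \<Longrightarrow> radial_fun K u ^ CARD('n) / real CARD('n) > 0"
  using radial_pos[OF K] by (auto intro!: continuous_intros radial_continuous[OF K])

lemma dual_cone_full:
  fixes K :: "(real^'n) set"
  assumes K: "K \<in> star_bodies"
  shows "full_sphere_measure (dual_cone_measure K)"
    and "\<And>g :: real^'n \<Rightarrow> real. continuous_on (sphere 0 1) g \<Longrightarrow> (\<integral>u. g u \<partial>dual_cone_measure K) =
      (\<integral>u. radial_fun K u ^ CARD('n) / real CARD('n) * g u \<partial>spherical_measure)"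
  unfolding dual_cone_measure_def
  by (rule full_sphere_measure_density[OF dual_cone_weight[OF K]]; assumption)+

text \<open>Polar coordinates: the denominator \<open>n\<close> of the density cancels the factor
  \<open>n\<close> of the spherical measure, and the factor \<open>radial_fun K u ^ n\<close> turns
  the integral over the ball into one over the region below the radial graph. Up to the origin, this
  region is \<open>K\<close>.\<close>

proposition nn_integral_dual_cone_measure:
  fixes K :: "(real^'n) set" and g :: "real^'n \<Rightarrow> real"
  assumes K: "K \<in> star_bodies" and g: "continuous_on (sphere 0 1) g" "\<And>u. norm u = 1 \<Longrightarrow> g u \<ge> 0"
  shows "(\<integral>\<^sup>+u. ennreal (g u) \<partial>dual_cone_measure K) =
    (\<integral>\<^sup>+x. ennreal (g (sgn x)) * indicator (K - {0}) x \<partial>lborel)"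
proof -
  interpret S: full_sphere_measure "spherical_measure :: (real^'n) measure"
    by (rule spherical_measure_full)
  define g' where "g' u = indicator (sphere 0 1) u *\<^sub>R g u" for u
  \<comment> \<open>The radial function on the sphere, extended by the value 1, so that it is Borel
    measurable and positive everywhere.\<close>
  define r where "r u = indicator (sphere 0 1) u *\<^sub>R (radial_fun K u - 1) + 1" for u
  let ?n = "CARD('n)"
  have [measurable]: "cball 0 1 \<in> sets (borel :: (real^'n) measure)" "{0} \<in> sets (borel :: (real^'n) measure)"
    by auto
  have [measurable]: "g' \<in> borel_measurable borel"
    unfolding g'_def by (rule borel_measurable_continuous_on_indicator) (use g in auto)
  have "(\<lambda>u. indicator (sphere 0 1) u *\<^sub>R (radial_fun K u - 1)) \<in> borel_measurable borel"
    by (rule borel_measurable_continuous_on_indicator)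
      (auto intro!: continuous_intros radial_continuous[OF K])
  then have r_meas [measurable]: "r \<in> borel_measurable borel"
    unfolding r_def by measurable
  have rpos: "r x > 0" for x
    using radial_pos[OF K, of x] by (auto simp: r_def indicator_def)
  have "(\<integral>\<^sup>+u. ennreal (g u) \<partial>dual_cone_measure K) =
      (\<integral>\<^sup>+u. ennreal (radial_fun K u ^ ?n / real ?n) * ennreal (g u) \<partial>spherical_measure)"
    unfolding dual_cone_measure_def
    by (rule nn_integral_density)
      (auto intro!: measurable_compose[OF _ measurable_ennreal] S.measurable_nu dual_cone_weight K g)
  also have "\<dots> = (\<integral>\<^sup>+u. ennreal (g' u) * ennreal (r u ^ ?n / real ?n) \<partial>spherical_measure)"
    by (intro nn_integral_cong) (auto simp: space_spherical_measure mult.commute g'_def r_def)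
  also have "\<dots> = of_nat ?n * (\<integral>\<^sup>+x. ennreal (g' (sgn x)) * ennreal (r (sgn x) ^ ?n / real ?n) *
      indicator (cball 0 1 - {0}) x \<partial>lborel)"
    by (rule nn_integral_spherical_measure[of "\<lambda>u. ennreal (g' u) * ennreal (r u ^ ?n / real ?n)"]) measurable
  also have "\<dots> = (\<integral>\<^sup>+x. of_nat ?n * (ennreal (g' (sgn x)) * ennreal (r (sgn x) ^ ?n / real ?n) *
      indicator (cball 0 1 - {0}) x) \<partial>lborel)"
    by (rule nn_integral_cmult[symmetric]) measurable
  also have "\<dots> = (\<integral>\<^sup>+x. ennreal (g' (sgn x)) * ennreal (r (sgn x) ^ ?n) * indicator (cball 0 1 - {0}) x \<partial>lborel)"
  proof (rule nn_integral_cong)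
    fix x :: "real^'n"
    have "of_nat ?n * ennreal (r (sgn x) ^ ?n / real ?n) = ennreal (r (sgn x) ^ ?n)"
      unfolding ennreal_of_nat_eq_real_of_nat
      by (subst ennreal_mult'[symmetric]) auto
    then show "of_nat ?n * (ennreal (g' (sgn x)) * ennreal (r (sgn x) ^ ?n / real ?n) *
      indicator (cball 0 1 - {0}) x) = ennreal (g' (sgn x)) * ennreal (r (sgn x) ^ ?n) * indicator (cball 0 1 - {0}) x"
      by (metis (no_types, lifting) mult.assoc mult.left_commute)
  qed
  also have "\<dots> = (\<integral>\<^sup>+x. ennreal (g' (sgn x)) * indicator {x. x \<noteq> 0 \<and> norm x \<le> r (sgn x)} x \<partial>lborel)"
    by (intro nn_integral_below_radial_graph[of "\<lambda>u. ennreal (g' u)", symmetric] rpos) measurable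
  also have "\<dots> = (\<integral>\<^sup>+x. ennreal (g (sgn x)) * indicator (K - {0}) x \<partial>lborel)"
  proof (rule nn_integral_cong)
    fix x :: "real^'n"
    have "norm x \<le> radial_fun K (sgn x) \<longleftrightarrow> x \<in> K" if "x \<noteq> 0"
      using radial_set(2)[OF K, of "sgn x" "norm x"] that by (simp add: sgn_div_norm)
    then show "ennreal (g' (sgn x)) * indicator {x. x \<noteq> 0 \<and> norm x \<le> r (sgn x)} x =
        ennreal (g (sgn x)) * indicator (K - {0}) x"
      by (auto simp: indicator_def norm_sgn g'_def r_def)
  qed
  finally show ?thesis .
qed

lemma star_body_measurable: "K \<in> star_bodies \<Longrightarrow> K \<in> sets borel"
  by (simp add: star_bodies_def borel_compact)

lemma volume_star_body_pos:
  fixes K :: "(real^'n) set"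
  assumes "K \<in> star_bodies"
  shows "volume K > 0"
proof -
  have "K \<in> lmeasurable" "interior K \<noteq> {}"
    using assms by (auto simp: star_bodies_def lmeasurable_compact)
  moreover have "\<not> negligible K"
    using negligible_subset[OF _ interior_subset[of K]] open_not_negligible[OF open_interior] calculation(2) by blast
  ultimately show ?thesis
    using negligible_iff_measure[of K] measure_nonneg[of lebesgue K] by linarith
qed

lemma measure_linear_image_borel:
  fixes A :: "real^'n^'n"
  assumes A: "invertible A" and S: "S \<in> sets borel" "bounded S"
  shows "volume (lin_image A S) = \<bar>det A\<bar> * volume S"
proof -
  obtain B where B: "A ** B = mat 1" "B ** A = mat 1" "invertible B"
    using invertible_obtains[OF A] .
  have "inj ((*v) A)"
    using A by (auto simp: invertible_eq_bij bij_is_inj)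
  then have pre: "(A *v x \<in> lin_image A S) = (x \<in> S)" for x
    by (simp add: inj_image_mem_iff)
  have img: "lin_image A S = (\<lambda>x. B *v x) -` S"
  proof (intro set_eqI iffI)
    fix y assume "y \<in> (\<lambda>x. B *v x) -` S"
    then have "A *v (B *v y) \<in> lin_image A S"
      by blast
    then show "y \<in> lin_image A S"
      by (simp only: matrix_vector_mul_assoc B matrix_vector_mul_lid)
  next
    fix y assume "y \<in> lin_image A S"
    then obtain x where "x \<in> S" "y = A *v x"
      by blast
    then show "y \<in> (\<lambda>x. B *v x) -` S"
      by (simp add: matrix_vector_mul_assoc B)
  qed
  have "(\<lambda>x. B *v x) \<in> measurable borel borel"
    by (intro borel_measurable_continuous_onI linear_continuous_on) auto
  from measurable_sets[OF this S(1)] have m: "lin_image A S \<in> sets borel"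
    by (simp add: img)
  have "emeasure lborel (lin_image A S) = (\<integral>\<^sup>+x. indicator (lin_image A S) x \<partial>lborel)"
    using m by simp
  also have "\<dots> = ennreal \<bar>det A\<bar> * (\<integral>\<^sup>+x. indicator (lin_image A S) (A *v x) \<partial>lborel)"
    by (rule nn_integral_lborel_linear[OF A]) (use m in simp)
  also have "(\<integral>\<^sup>+x. indicator (lin_image A S) (A *v x) \<partial>lborel) = (\<integral>\<^sup>+x. indicator S x \<partial>lborel)"
    by (intro nn_integral_cong) (simp add: indicator_def pre)
  also have "\<dots> = emeasure lborel S"
    using S(1) by simp
  finally show ?thesis
    using m S(1) by (simp add: measure_def enn2real_mult)
qed

lemma normalized_dual_cone_full:
  fixes K :: "(real^'n) set"
  assumes K: "K \<in> star_bodies"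
  shows "full_sphere_measure (normalized_dual_cone_measure K)"
    and "\<And>g :: real^'n \<Rightarrow> real. continuous_on (sphere 0 1) g \<Longrightarrow> (\<And>u. norm u = 1 \<Longrightarrow> 0 \<le> g u) \<Longrightarrow>
      (\<integral>u. g u \<partial>normalized_dual_cone_measure K) = (\<integral>u. g u \<partial>dual_cone_measure K) / volume K"
proof -
  interpret D: full_sphere_measure "dual_cone_measure K"
    by (rule dual_cone_full(1)[OF K])
  let ?N = "normalized_dual_cone_measure K"
  have V: "volume K > 0"
    by (rule volume_star_body_pos[OF K])
  have sets: "sets ?N = sets (restrict_space borel (sphere 0 1))"
    by (simp add: normalized_dual_cone_measure_def D.sets_nu)
  have sp: "space ?N = sphere 0 1"
    using sets_eq_imp_space_eq[OF sets] by (simp add: space_restrict_space)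
  show int: "(\<integral>u. g u \<partial>?N) = (\<integral>u. g u \<partial>dual_cone_measure K) / volume K"
    if g: "continuous_on (sphere 0 1) g" "\<And>u. norm u = 1 \<Longrightarrow> 0 \<le> g u" for g :: "real^'n \<Rightarrow> real"
  proof -
    note m = D.measurable_nu[OF g(1)]
    have "(\<integral>u. g u \<partial>?N) = enn2real (\<integral>\<^sup>+u. ennreal (g u) \<partial>?N)"
    proof (rule integral_eq_nn_integral)
      show "g \<in> borel_measurable ?N"
        using m by (simp add: normalized_dual_cone_measure_def measurable_def space_scale_measure)
    qed (auto intro!: AE_I2 simp: sp g(2))
    also have "\<dots> = enn2real (ennreal (1 / volume K) * (\<integral>\<^sup>+u. ennreal (g u) \<partial>dual_cone_measure K))"
      unfolding normalized_dual_cone_measure_def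
      by (subst nn_integral_scale_measure) (use m in auto)
    also have "\<dots> = 1 / volume K * enn2real (\<integral>\<^sup>+u. ennreal (g u) \<partial>dual_cone_measure K)"
      using V by (simp add: enn2real_mult)
    also have "enn2real (\<integral>\<^sup>+u. ennreal (g u) \<partial>dual_cone_measure K) = (\<integral>u. g u \<partial>dual_cone_measure K)"
      by (rule integral_eq_nn_integral[symmetric]) (auto intro!: m AE_I2 simp: D.space_nu g(2))
    finally show ?thesis
      by simp
  qed
  have "emeasure ?N (space ?N) = ennreal (1 / volume K) * emeasure (dual_cone_measure K) (space (dual_cone_measure K))"
    by (simp add: normalized_dual_cone_measure_def space_scale_measure)
  also have "\<dots> \<noteq> top"
    using D.emeasure_finite by (simp add: ennreal_mult_eq_top_iff)
  finally have "finite_measure ?N"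
    by (intro finite_measureI) simp
  then show "full_sphere_measure ?N"
  proof (intro full_sphere_measure.intro full_sphere_measure_axioms.intro sets)
    fix g :: "real^'n \<Rightarrow> real" and u0
    assume g: "continuous_on (sphere 0 1) g" "\<And>u. norm u = 1 \<Longrightarrow> 0 \<le> g u" "norm u0 = 1" "0 < g u0"
    show "0 < (\<integral>u. g u \<partial>?N)"
      using int[OF g(1,2)] V D.integral_pos[OF g] by simp
  qed
qed

text \<open>Both sides become integrals over the bodies, where \<open>A *v x\<close> is substituted
  for \<open>x\<close>. The resulting factor \<open>\<bar>det A\<bar>\<close> is the ratio of the
  volumes and cancels in the normalization. The hypothesis \<open>gh\<close> matches the integrands
  as functions of the direction.\<close>

proposition integral_normalized_dual_cone_linear:
  fixes K :: "(real^'n) set" and g h :: "real^'n \<Rightarrow> real"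
  assumes K: "K \<in> star_bodies" and A: "invertible A"
    and g: "continuous_on (sphere 0 1) g" "\<And>u. norm u = 1 \<Longrightarrow> 0 \<le> g u"
    and h: "continuous_on (sphere 0 1) h" "\<And>u. norm u = 1 \<Longrightarrow> 0 \<le> h u"
    and gh: "\<And>x. x \<noteq> 0 \<Longrightarrow> g (sgn (A *v x)) = h (sgn x)"
  shows "(\<integral>u. g u \<partial>normalized_dual_cone_measure (lin_image A K)) =
    (\<integral>u. h u \<partial>normalized_dual_cone_measure K)"
proof -
  have AK: "lin_image A K \<in> star_bodies"
    by (rule lin_image_star_bodies[OF K A])
  interpret D: full_sphere_measure "dual_cone_measure K"
    by (rule dual_cone_full(1)[OF K])
  interpret DA: full_sphere_measure "dual_cone_measure (lin_image A K)"
    by (rule dual_cone_full(1)[OF AK])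
  have inj: "inj ((*v) A)"
    using A by (auto simp: invertible_eq_bij bij_is_inj)
  have nz: "A *v x = 0 \<longleftrightarrow> x = 0" for x
    using inj by (metis inj_eq matrix_vector_mult_0_right)
  let ?g = "\<lambda>x. ennreal (indicator (sphere 0 1) (sgn x) *\<^sub>R g (sgn x)) * indicator (lin_image A K - {0}) x"
  have [measurable]: "K \<in> sets borel" "lin_image A K \<in> sets borel"
    using star_body_measurable K AK by auto
  have "(\<lambda>u. indicator (sphere 0 1) u *\<^sub>R g u) \<in> borel_measurable borel"
    by (rule borel_measurable_continuous_on_indicator) (use g in auto)
  from measurable_compose[OF borel_measurable_sgn this]
  have m: "?g \<in> borel_measurable borel"
    by measurable
  have "(\<integral>\<^sup>+u. ennreal (g u) \<partial>dual_cone_measure (lin_image A K)) =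
      (\<integral>\<^sup>+x. ennreal (g (sgn x)) * indicator (lin_image A K - {0}) x \<partial>lborel)"
    by (rule nn_integral_dual_cone_measure[OF AK g])
  also have "\<dots> = (\<integral>\<^sup>+x. ?g x \<partial>lborel)"
    by (intro nn_integral_cong) (auto simp: indicator_def norm_sgn)
  also have "\<dots> = ennreal \<bar>det A\<bar> * (\<integral>\<^sup>+x. ?g (A *v x) \<partial>lborel)"
    by (rule nn_integral_lborel_linear[OF A m])
  also have "(\<integral>\<^sup>+x. ?g (A *v x) \<partial>lborel) = (\<integral>\<^sup>+x. ennreal (h (sgn x)) * indicator (K - {0}) x \<partial>lborel)"
    using inj by (intro nn_integral_cong) (auto simp: indicator_def norm_sgn nz gh inj_image_mem_iff)
  also have "\<dots> = (\<integral>\<^sup>+u. ennreal (h u) \<partial>dual_cone_measure K)"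
    by (rule nn_integral_dual_cone_measure[OF K h, symmetric])
  finally have "enn2real (\<integral>\<^sup>+u. ennreal (g u) \<partial>dual_cone_measure (lin_image A K)) =
      \<bar>det A\<bar> * enn2real (\<integral>\<^sup>+u. ennreal (h u) \<partial>dual_cone_measure K)"
    by (simp add: enn2real_mult)
  moreover have "enn2real (\<integral>\<^sup>+u. ennreal (g u) \<partial>dual_cone_measure (lin_image A K)) =
      (\<integral>u. g u \<partial>dual_cone_measure (lin_image A K))"
    by (rule integral_eq_nn_integral[symmetric]) (auto intro!: DA.measurable_nu AE_I2 g simp: DA.space_nu)
  moreover have "enn2real (\<integral>\<^sup>+u. ennreal (h u) \<partial>dual_cone_measure K) = (\<integral>u. h u \<partial>dual_cone_measure K)"
    by (rule integral_eq_nn_integral[symmetric]) (auto intro!: D.measurable_nu AE_I2 h simp: D.space_nu)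
  moreover have "volume (lin_image A K) = \<bar>det A\<bar> * volume K"
    using K by (intro measure_linear_image_borel A star_body_measurable) (auto simp: star_bodies_def compact_imp_bounded)
  ultimately show ?thesis
    using A by (simp add: normalized_dual_cone_full(2)[OF AK g] normalized_dual_cone_full(2)[OF K h] invertible_det_nz)
qed

section \<open>Minimization over matrices\<close>

lemma det_scaleR: "det (c *\<^sub>R M) = c ^ CARD('n) * det M" for M :: "real^'n^'n"
proof -
  have "c *\<^sub>R M = (\<chi> i. c *s (M $ i))"
    by (simp add: vec_eq_iff)
  then show ?thesis
    using det_rows_mul[of "\<lambda>i. c" "\<lambda>i. M $ i"] by simp
qed

lemma continuous_on_det: "continuous_on S (\<lambda>M :: real^'n^'n. det M)"
  unfolding det_def by (intro continuous_intros)

lemma abs_det_normalize: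
  fixes M :: "real^'n^'n"
  assumes "det M \<noteq> 0"
  shows "\<bar>det ((1 / root CARD('n) \<bar>det M\<bar>) *\<^sub>R M)\<bar> = 1"
  using assms by (simp add: det_scaleR abs_mult power_one_over)

lemma exists_mult_vec_nonzero:
  fixes M :: "real^'n^'n"
  assumes "M \<noteq> 0"
  obtains u where "norm u = 1" "M *v u \<noteq> 0"
proof -
  obtain x where x: "M *v x \<noteq> 0"
    using assms matrix_eq[of M 0] by auto
  then have "x \<noteq> 0"
    by auto
  with x show thesis
    by (intro that[of "sgn x"]) (auto simp: norm_sgn sgn_div_norm matrix_vector_mult_scaleR)
qed

lemma continuous_on_mult_vec [continuous_intros]: "continuous_on S (\<lambda>u. (M :: real^'n^'m) *v u)"
  by (intro linear_continuous_on) auto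

text \<open>Measure and function are parameters because three instances occur: the dual cone
  measure, its normalized version, and the identity in place of \<open>\<phi>\<close> for the proof
  of coercivity.\<close>

locale orlicz_sphere = full_sphere_measure \<nu> for \<nu> :: "(real^'n) measure" +
  fixes \<phi> :: "real \<Rightarrow> real" and r :: "real^'n \<Rightarrow> real"
  assumes orlicz: "\<phi> \<in> orlicz_functions" and phi_cont: "continuous_on {0..} \<phi>"
    and r_cont: "continuous_on (sphere 0 1) r" and r_pos: "\<And>u. norm u = 1 \<Longrightarrow> 0 < r u"
begin

definition F :: "real^'n^'n \<Rightarrow> real" where
  "F M = (\<integral>u. \<phi> (r u * norm (M *v u)) \<partial>\<nu>)"

lemma phi_0: "\<phi> 0 = 0" and phi_nonneg: "0 \<le> t \<Longrightarrow> 0 \<le> \<phi> t"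
  and phi_less: "0 \<le> s \<Longrightarrow> s < t \<Longrightarrow> \<phi> s < \<phi> t" and phi_convex: "convex_on {0..} \<phi>"
  using orlicz by (auto simp: orlicz_functions_def strict_mono_on_def)

lemma phi_le: "0 \<le> s \<Longrightarrow> s \<le> t \<Longrightarrow> \<phi> s \<le> \<phi> t"
  using phi_less by (metis less_eq_real_def)

lemma phi_1_pos: "\<phi> 1 > 0"
  using phi_less[of 0 1] by (simp add: phi_0)

text \<open>Convexity and \<open>\<phi> 0 = 0\<close> give
  \<open>\<phi> 1 * t \<le> \<phi> t\<close> for \<open>t > 1\<close>, and for
  \<open>t \<le> 1\<close> the left side is not positive. This affine bound is the source of the
  growth of \<open>F\<close>.\<close>

lemma phi_linear_minorant:
  assumes "0 \<le> t"
  shows "\<phi> 1 * (t - 1) \<le> \<phi> t"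
proof (cases "t \<le> 1")
  case True
  then have "\<phi> 1 * (t - 1) \<le> 0"
    using phi_1_pos by (intro mult_nonneg_nonpos) auto
  then show ?thesis
    using phi_nonneg[OF assms] by linarith
next
  case False
  have "(1 - 1 / t) *\<^sub>R 0 + (1 / t) *\<^sub>R t = 1"
    using False by simp
  moreover have "\<phi> ((1 - 1 / t) *\<^sub>R 0 + (1 / t) *\<^sub>R t) \<le> (1 - 1 / t) * \<phi> 0 + 1 / t * \<phi> t"
    using False by (intro convex_onD[OF phi_convex]) auto
  ultimately have "\<phi> 1 \<le> \<phi> t / t"
    by (simp only: phi_0) simp
  then have "\<phi> 1 * t \<le> \<phi> t"
    using False by (simp add: pos_le_divide_eq)
  then show ?thesis
    using phi_1_pos by (simp add: right_diff_distrib)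
qed

lemma integrand_nonneg: "norm u = 1 \<Longrightarrow> 0 \<le> r u * norm (M *v u)"
  using r_pos[of u] by simp

lemma integrand_cont: "continuous_on (sphere 0 1) (\<lambda>u. \<phi> (r u * norm (M *v u)))"
  by (rule continuous_on_compose2[OF phi_cont])
    (auto intro!: continuous_intros r_cont simp: integrand_nonneg)

lemma F_nonneg: "0 \<le> F M"
  unfolding F_def by (intro integral_nonneg_AE AE_I2) (auto simp: space_nu phi_nonneg integrand_nonneg)

lemma F_0: "F 0 = 0"
  by (simp add: F_def phi_0)

lemma F_scale_less:
  assumes "0 \<le> s" "s < t" "M \<noteq> 0"
  shows "F (s *\<^sub>R M) < F (t *\<^sub>R M)"
proof -
  obtain u where u: "norm u = 1" "M *v u \<noteq> 0"
    using exists_mult_vec_nonzero[OF assms(3)] .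
  show ?thesis
    unfolding F_def
  proof (rule integral_less_nu[OF integrand_cont integrand_cont])
    show "norm u = 1"
      by fact
    show "\<phi> (r u * norm (s *\<^sub>R M *v u)) < \<phi> (r u * norm (t *\<^sub>R M *v u))"
      using u assms r_pos[of u] by (intro phi_less) (simp_all flip: scaleR_matrix_vector_assoc)
    show "\<phi> (r u * norm (s *\<^sub>R M *v u)) \<le> \<phi> (r u * norm (t *\<^sub>R M *v u))" if "norm u = 1" for u
      using assms that r_pos[of u]
      by (intro phi_le mult_left_mono) (simp_all add: mult_right_mono flip: scaleR_matrix_vector_assoc)
  qed
qed

lemma F_scale_le: "0 \<le> s \<Longrightarrow> s \<le> t \<Longrightarrow> F (s *\<^sub>R M) \<le> F (t *\<^sub>R M)"
  using F_scale_less[of s t M] by (cases "M = 0"; cases "s = t") auto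

text \<open>Domination in norm is all that is asked of \<open>R\<close>. This covers averages formed
  after one of the matrices is multiplied by an orthogonal matrix, as well as ordinary convex
  combinations.\<close>

lemma F_convex_combination:
  assumes t: "0 \<le> t" "t \<le> 1"
    and le: "\<And>u. norm (R *v u) \<le> (1 - t) * norm (M1 *v u) + t * norm (M2 *v u)"
  shows "F R \<le> (1 - t) * F M1 + t * F M2"
proof -
  have "F R \<le> (\<integral>u. (1 - t) * \<phi> (r u * norm (M1 *v u)) + t * \<phi> (r u * norm (M2 *v u)) \<partial>\<nu>)"
    unfolding F_def
  proof (rule integral_mono_nu)
    fix u :: "real^'n" assume u: "norm u = 1"
    have "r u * norm (R *v u) \<le> r u * ((1 - t) * norm (M1 *v u) + t * norm (M2 *v u))"
      using r_pos[OF u] le by (intro mult_left_mono) auto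
    also have "\<dots> = (1 - t) *\<^sub>R (r u * norm (M1 *v u)) + t *\<^sub>R (r u * norm (M2 *v u))"
      by (simp add: algebra_simps)
    finally have "\<phi> (r u * norm (R *v u)) \<le>
        \<phi> ((1 - t) *\<^sub>R (r u * norm (M1 *v u)) + t *\<^sub>R (r u * norm (M2 *v u)))"
      by (intro phi_le integrand_nonneg u)
    also have "\<dots> \<le> (1 - t) * \<phi> (r u * norm (M1 *v u)) + t * \<phi> (r u * norm (M2 *v u))"
      using integrand_nonneg[OF u] t by (intro convex_onD[OF phi_convex]) auto
    finally show "\<phi> (r u * norm (R *v u)) \<le> (1 - t) * \<phi> (r u * norm (M1 *v u)) + t * \<phi> (r u * norm (M2 *v u))" .
  qed (intro continuous_intros integrand_cont)+
  also have "\<dots> = (1 - t) * F M1 + t * F M2"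
    unfolding F_def
    by (simp add: integrable_nu[OF integrand_cont[of M1]] integrable_nu[OF integrand_cont[of M2]])
  finally show ?thesis .
qed

lemma F_convex: "convex_on UNIV F"
proof (rule convex_onI)
  fix t :: real and M1 M2 :: "real^'n^'n"
  assume t: "0 < t" "t < 1"
  have "norm (((1 - t) *\<^sub>R M1 + t *\<^sub>R M2) *v u) \<le> (1 - t) * norm (M1 *v u) + t * norm (M2 *v u)" for u
    using t norm_triangle_ineq[of "(1 - t) *\<^sub>R (M1 *v u)" "t *\<^sub>R (M2 *v u)"]
    by (simp add: matrix_vector_mult_add_rdistrib flip: scaleR_matrix_vector_assoc)
  then show "F ((1 - t) *\<^sub>R M1 + t *\<^sub>R M2) \<le> (1 - t) * F M1 + t * F M2"
    using t by (intro F_convex_combination) auto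
qed simp

lemma F_cont: "continuous_on UNIV F"
  by (rule convex_on_continuous[OF open_UNIV F_convex])

lemma F_scale_cont: "continuous_on S (\<lambda>t. F (t *\<^sub>R M))"
  by (rule continuous_on_compose2[OF F_cont]) (auto intro!: continuous_intros)

lemma F_small_scale:
  assumes "y > 0"
  obtains t where "t > 0" "F (t *\<^sub>R M) < y"
proof -
  have "isCont (\<lambda>t. F (t *\<^sub>R M)) 0"
    using F_scale_cont[of UNIV] by (simp add: continuous_on_eq_continuous_at)
  then have "((\<lambda>t. F (t *\<^sub>R M)) \<longlongrightarrow> 0) (at_right 0)"
    by (simp add: isCont_def F_0 filterlim_at_split)
  then have "eventually (\<lambda>t. F (t *\<^sub>R M) < y) (at_right 0)"
    using assms by (rule order_tendstoD)
  moreover have "eventually (\<lambda>t::real. t > 0) (at_right 0)"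
    by (simp add: eventually_at_right_less)
  ultimately have "eventually (\<lambda>t. t > 0 \<and> F (t *\<^sub>R M) < y) (at_right 0)"
    by eventually_elim simp
  then obtain t where "t > 0 \<and> F (t *\<^sub>R M) < y"
    using eventually_happens'[of "at_right (0::real)"] by auto
  then show thesis
    using that by blast
qed

text \<open>Equivalence of norms in finite dimension: the right side is homogeneous in
  \<open>M\<close>, and its minimum over the unit sphere of matrices is attained and
  positive.\<close>

lemma weighted_norm_coercive:
  obtains m where "m > 0" "\<And>M :: real^'n^'n. m * norm M \<le> (\<integral>u. r u * norm (M *v u) \<partial>\<nu>)"
proof -
  interpret id: orlicz_sphere \<nu> "\<lambda>t. t" r
    by unfold_locales (auto simp: orlicz_functions_def convex_on_def strict_mono_on_def r_cont r_pos)
  have "compact (sphere 0 1 :: (real^'n^'n) set)" "sphere 0 1 \<noteq> ({} :: (real^'n^'n) set)"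
    by auto
  from continuous_attains_inf[OF this continuous_on_subset[OF id.F_cont subset_UNIV]]
  obtain M0 :: "real^'n^'n" where M0: "M0 \<in> sphere 0 1" "\<And>M. M \<in> sphere 0 1 \<Longrightarrow> id.F M0 \<le> id.F M"
    by blast
  have "M0 \<noteq> 0"
    using M0(1) by auto
  then have "id.F M0 > 0"
    using id.F_scale_less[of 0 1 M0] by (simp add: id.F_0)
  moreover have "id.F M0 * norm M \<le> (\<integral>u. r u * norm (M *v u) \<partial>\<nu>)" for M :: "real^'n^'n"
  proof (cases "M = 0")
    case False
    then have "id.F M0 \<le> id.F ((1 / norm M) *\<^sub>R M)"
      by (intro M0) simp
    also have "\<dots> = (1 / norm M) * (\<integral>u. r u * norm (M *v u) \<partial>\<nu>)"
      unfolding id.F_def by (simp add: mult_ac flip: scaleR_matrix_vector_assoc)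
    finally show ?thesis
      using False by (simp add: field_simps)
  qed simp
  ultimately show thesis
    by (rule that)
qed

text \<open>The affine minorant of \<open>\<phi>\<close> is integrated. Its linear part leads to the
  weighted norm, and its constant part, times the total mass, is \<open>b\<close>.\<close>

lemma F_coercive:
  obtains c b where "c > 0" "b \<ge> 0" "\<And>M. c * norm M - b \<le> F M"
proof -
  obtain m where m: "m > 0" "\<And>M :: real^'n^'n. m * norm M \<le> (\<integral>u. r u * norm (M *v u) \<partial>\<nu>)"
    using weighted_norm_coercive by blast
  have cont: "continuous_on (sphere 0 1) (\<lambda>u. r u * norm (M *v u))" for M :: "real^'n^'n"
    by (intro continuous_intros r_cont)
  show thesis
  proof
    show "\<phi> 1 * m > 0" "\<phi> 1 * measure \<nu> (space \<nu>) \<ge> 0"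
      using m(1) phi_1_pos by auto
    fix M :: "real^'n^'n"
    have "\<phi> 1 * m * norm M - \<phi> 1 * measure \<nu> (space \<nu>) \<le>
        \<phi> 1 * (\<integral>u. r u * norm (M *v u) \<partial>\<nu>) - \<phi> 1 * measure \<nu> (space \<nu>)"
      using m(2)[of M] phi_1_pos by (simp add: mult.assoc)
    also have "\<dots> = (\<integral>u. \<phi> 1 * (r u * norm (M *v u) - 1) \<partial>\<nu>)"
      using integrable_nu[OF cont] by (simp add: algebra_simps)
    also have "\<dots> \<le> F M"
      unfolding F_def
      by (intro integral_mono_nu integrand_cont continuous_intros r_cont phi_linear_minorant integrand_nonneg)
    finally show "\<phi> 1 * m * norm M - \<phi> 1 * measure \<nu> (space \<nu>) \<le> F M" .
  qed
qed

lemma compact_sublevel: "compact {M. F M \<le> y}"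
proof -
  obtain c b where cb: "c > 0" "\<And>M. c * norm M - b \<le> F M"
    using F_coercive by blast
  have "norm M \<le> (y + b) / c" if "F M \<le> y" for M
    using cb(1) cb(2)[of M] that by (simp add: field_simps)
  then have "bounded {M. F M \<le> y}"
    by (auto simp: bounded_iff)
  moreover have "closed {M. F M \<le> y}"
    by (intro closed_Collect_le F_cont continuous_intros)
  ultimately show ?thesis
    by (simp add: compact_eq_bounded_closed)
qed

lemma F_average_with_larger_det:
  assumes "\<bar>det M1\<bar> = \<bar>det M2\<bar>" "det M1 \<noteq> 0" "norm (M1 *v x) \<noteq> norm (M2 *v x)"
    and "F M1 \<le> y" "F M2 \<le> y"
  obtains R where "\<bar>det R\<bar> > \<bar>det M1\<bar>" "F R \<le> y"
proof -
  obtain R where R: "\<bar>det R\<bar> > \<bar>det M1\<bar>" "\<And>x. norm (R *v x) \<le> (norm (M1 *v x) + norm (M2 *v x)) / 2"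
    using average_with_larger_det[OF assms(1-3)] by blast
  have "F R \<le> (1 - 1/2) * F M1 + 1/2 * F M2"
    using R(2) by (intro F_convex_combination) (auto simp: field_simps)
  then show thesis
    using R(1) assms(4,5) by (intro that[of R]) auto
qed

section \<open>Existence and uniqueness of extremal matrices\<close>

lemma max_det_exists:
  assumes "y > 0"
  obtains M where "F M \<le> y" "det M \<noteq> 0" "\<And>M'. F M' \<le> y \<Longrightarrow> \<bar>det M'\<bar> \<le> \<bar>det M\<bar>"
proof -
  have "0 \<in> {M. F M \<le> y}"
    using assms by (simp add: F_0)
  then have "{M. F M \<le> y} \<noteq> {}"
    by blast
  from continuous_attains_sup[OF compact_sublevel this, of "\<lambda>M. \<bar>det M\<bar>"]
  obtain M where M: "F M \<le> y" "\<And>M'. F M' \<le> y \<Longrightarrow> \<bar>det M'\<bar> \<le> \<bar>det M\<bar>"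
    by (auto intro: continuous_on_rabs continuous_on_det)
  \<comment> \<open>A small multiple of the identity lies in the sublevel set, so the maximal
    determinant is not 0.\<close>
  obtain t where t: "t > 0" "F (t *\<^sub>R mat 1) < y"
    using F_small_scale[OF assms] by blast
  have "t ^ CARD('n) \<le> \<bar>det M\<bar>"
    using M(2)[of "t *\<^sub>R mat 1"] t by (simp add: det_scaleR)
  moreover have "t ^ CARD('n) > 0"
    using t(1) by simp
  ultimately have "det M \<noteq> 0"
    by auto
  with M show thesis
    by (intro that) auto
qed

lemma max_det_unique:
  assumes "F M1 \<le> y" "\<And>M'. F M' \<le> y \<Longrightarrow> \<bar>det M'\<bar> \<le> \<bar>det M1\<bar>" "det M1 \<noteq> 0"
    and "F M2 \<le> y" "\<bar>det M2\<bar> = \<bar>det M1\<bar>"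
  shows "norm (M1 *v x) = norm (M2 *v x)"
proof (rule ccontr)
  assume "norm (M1 *v x) \<noteq> norm (M2 *v x)"
  then obtain R where "\<bar>det R\<bar> > \<bar>det M1\<bar>" "F R \<le> y"
    using F_average_with_larger_det[of M1 M2 x y] assms by metis
  then show False
    using assms(2)[of R] by simp
qed

text \<open>The matrices with \<open>\<bar>det M\<bar> = 1\<close> form a closed set that is in
  general unbounded. Intersecting it with the sublevel set at the value \<open>F (mat 1)\<close>
  gives compactness and loses no minimizer.\<close>

lemma min_F_exists:
  obtains M where "\<bar>det M\<bar> = 1" "\<And>M'. \<bar>det M'\<bar> = 1 \<Longrightarrow> F M \<le> F M'"
proof -
  let ?S = "{M. F M \<le> F (mat 1)} \<inter> {M. \<bar>det M\<bar> = 1}"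
  have "closed {M :: real^'n^'n. \<bar>det M\<bar> = 1}"
    by (intro closed_Collect_eq continuous_on_rabs continuous_on_det continuous_intros)
  then have S: "compact ?S"
    by (intro compact_Int_closed compact_sublevel)
  have "?S \<noteq> {}"
    by (auto intro!: exI[of _ "mat 1"])
  from continuous_attains_inf[OF S this continuous_on_subset[OF F_cont subset_UNIV]]
  obtain M where M: "M \<in> ?S" "\<And>M'. M' \<in> ?S \<Longrightarrow> F M \<le> F M'"
    by metis
  show thesis
  proof
    show "\<bar>det M\<bar> = 1"
      using M(1) by simp
    show "F M \<le> F M'" if "\<bar>det M'\<bar> = 1" for M'
      using M(1) M(2)[of M'] that by (cases "F M' \<le> F (mat 1)") auto
  qed
qed

lemma rescale_to_unit_det:
  assumes "\<bar>det R\<bar> > 1" "F R \<le> y"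
  obtains M where "\<bar>det M\<bar> = 1" "F M < y"
proof -
  define s where "s = 1 / root CARD('n) \<bar>det R\<bar>"
  have s: "0 \<le> s" "s < 1"
    using assms(1) by (auto simp: s_def)
  have "R \<noteq> 0"
    using assms(1) by (auto simp: det_0[unfolded mat_0])
  then have "F (s *\<^sub>R R) < F (1 *\<^sub>R R)"
    using s by (intro F_scale_less) auto
  moreover have "\<bar>det (s *\<^sub>R R)\<bar> = 1"
    unfolding s_def by (rule abs_det_normalize) (use assms(1) in auto)
  ultimately show thesis
    using assms(2) by (intro that[of "s *\<^sub>R R"]) auto
qed

lemma min_F_unique:
  assumes "\<bar>det M1\<bar> = 1" "\<And>M'. \<bar>det M'\<bar> = 1 \<Longrightarrow> F M1 \<le> F M'"
    and "\<bar>det M2\<bar> = 1" "F M2 = F M1"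
  shows "norm (M1 *v x) = norm (M2 *v x)"
proof (rule ccontr)
  assume "norm (M1 *v x) \<noteq> norm (M2 *v x)"
  then obtain R where "\<bar>det R\<bar> > \<bar>det M1\<bar>" "F R \<le> F M1"
    using F_average_with_larger_det[of M1 M2 x "F M1"] assms by force
  then obtain M where "\<bar>det M\<bar> = 1" "F M < F M1"
    using rescale_to_unit_det[of R "F M1"] assms by auto
  then show False
    using assms(2)[of M] by simp
qed

text \<open>The Luxemburg norm corresponding to \<open>O_functional\<close>.\<close>

definition lux :: "real^'n^'n \<Rightarrow> real" where
  "lux M = Inf {l. 0 < l \<and> F ((1 / l) *\<^sub>R M) \<le> \<phi> 1}"

text \<open>Coercivity keeps the admissible \<open>l\<close> away from 0 and continuity makes their
  set closed, so the infimum is attained. Monotonicity along the ray makes the set a half-line.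
  Equality holds in \<open>F_lux\<close> because a strict inequality would persist for slightly
  smaller \<open>l\<close>.\<close>

lemma lux:
  assumes "M \<noteq> 0"
  shows lux_pos: "lux M > 0"
    and F_lux: "F ((1 / lux M) *\<^sub>R M) = \<phi> 1"
    and lux_le_iff: "\<And>l. l > 0 \<Longrightarrow> lux M \<le> l \<longleftrightarrow> F ((1 / l) *\<^sub>R M) \<le> \<phi> 1"
proof -
  define S where "S = {l. 0 < l \<and> F ((1 / l) *\<^sub>R M) \<le> \<phi> 1}"
  obtain t where t: "t > 0" "F (t *\<^sub>R M) < \<phi> 1"
    using F_small_scale[OF phi_1_pos] by blast
  then have "1 / t \<in> S"
    by (simp add: S_def)
  then have ne: "S \<noteq> {}"
    by blast
  obtain c b where cb: "c > 0" "b \<ge> 0" "\<And>M. c * norm M - b \<le> F M"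
    using F_coercive by blast
  \<comment> \<open>The solution \<open>l\<close> of
    \<open>c * norm M / l - b = \<phi> 1\<close>.\<close>
  define l0 where "l0 = c * norm M / (\<phi> 1 + b)"
  have l0: "l0 > 0"
    using cb phi_1_pos assms by (simp add: l0_def)
  have lower: "l0 \<le> l" if "l \<in> S" for l
  proof -
    have "c * norm ((1 / l) *\<^sub>R M) - b \<le> \<phi> 1" "l > 0"
      using that cb(3)[of "(1 / l) *\<^sub>R M"] by (auto simp: S_def)
    then show ?thesis
      using cb(2) phi_1_pos by (simp add: l0_def field_simps)
  qed
  have bdd: "bdd_below S"
    using lower by (auto simp: bdd_below_def)
  have cont: "continuous_on {l0..} (\<lambda>l. F ((1 / l) *\<^sub>R M))"
    using l0 by (intro continuous_on_compose2[OF F_scale_cont[of UNIV]]) (auto intro!: continuous_intros)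
  have "S = {l \<in> {l0..}. F ((1 / l) *\<^sub>R M) \<le> \<phi> 1}"
    using l0 lower by (auto simp: S_def)
  moreover have "closed {l \<in> {l0..}. F ((1 / l) *\<^sub>R M) \<le> \<phi> 1}"
    using continuous_closed_preimage[OF cont, of "{..\<phi> 1}"] by (simp add: vimage_def Int_def)
  ultimately have "closed S"
    by simp
  then have inf: "lux M \<in> S"
    unfolding lux_def S_def[symmetric] by (rule closed_contains_Inf[OF ne bdd])
  then show pos: "lux M > 0"
    by (simp add: S_def)
  show iff: "lux M \<le> l \<longleftrightarrow> F ((1 / l) *\<^sub>R M) \<le> \<phi> 1" if "l > 0" for l
  proof
    assume "lux M \<le> l"
    then have "F ((1 / l) *\<^sub>R M) \<le> F ((1 / lux M) *\<^sub>R M)"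
      using pos by (intro F_scale_le) (auto simp: frac_le)
    then show "F ((1 / l) *\<^sub>R M) \<le> \<phi> 1"
      using inf by (simp add: S_def)
  next
    assume "F ((1 / l) *\<^sub>R M) \<le> \<phi> 1"
    then show "lux M \<le> l"
      unfolding lux_def using that bdd by (intro cInf_lower) (auto simp: S_def)
  qed
  show "F ((1 / lux M) *\<^sub>R M) = \<phi> 1"
  proof (rule ccontr)
    assume "F ((1 / lux M) *\<^sub>R M) \<noteq> \<phi> 1"
    then have less: "F ((1 / lux M) *\<^sub>R M) < \<phi> 1"
      using inf by (simp add: S_def)
    have "isCont (\<lambda>t. F (t *\<^sub>R M)) (1 / lux M)"
      using F_scale_cont[of UNIV] by (simp add: continuous_on_eq_continuous_at)
    then have "((\<lambda>t. F (t *\<^sub>R M)) \<longlongrightarrow> F ((1 / lux M) *\<^sub>R M)) (at_right (1 / lux M))"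
      by (simp add: isCont_def filterlim_at_split)
    then have "eventually (\<lambda>t. F (t *\<^sub>R M) < \<phi> 1) (at_right (1 / lux M))"
      using less by (rule order_tendstoD)
    moreover have "eventually (\<lambda>t. t > 1 / lux M) (at_right (1 / lux M))"
      by (simp add: eventually_at_right_less)
    ultimately have "eventually (\<lambda>t. t > 1 / lux M \<and> F (t *\<^sub>R M) < \<phi> 1) (at_right (1 / lux M))"
      by eventually_elim simp
    then obtain t where t: "t > 1 / lux M" "F (t *\<^sub>R M) < \<phi> 1"
      using eventually_happens'[of "at_right (1 / lux M)"] by auto
    moreover have "t > 0"
      using t(1) pos by (meson divide_pos_pos less_trans zero_less_one)
    ultimately have "lux M \<le> 1 / t"
      using iff[of "1 / t"] by simp
    then show False
      using t(1) pos \<open>t > 0\<close> by (simp add: field_simps)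
  qed
qed

lemma nonzero_det: "\<bar>det M\<bar> = 1 \<Longrightarrow> M \<noteq> (0 :: real^'n^'n)"
  by (auto simp: det_0[unfolded mat_0])

lemma le_lux_iff:
  assumes "M \<noteq> 0" "l > 0"
  shows "l \<le> lux M \<longleftrightarrow> \<phi> 1 \<le> F ((1 / l) *\<^sub>R M)"
proof
  assume "l \<le> lux M"
  then have "F ((1 / lux M) *\<^sub>R M) \<le> F ((1 / l) *\<^sub>R M)"
    using assms lux_pos[OF assms(1)] by (intro F_scale_le) (auto simp: frac_le)
  then show "\<phi> 1 \<le> F ((1 / l) *\<^sub>R M)"
    by (simp add: F_lux assms)
next
  assume *: "\<phi> 1 \<le> F ((1 / l) *\<^sub>R M)"
  show "l \<le> lux M"
  proof (rule ccontr)
    assume "\<not> l \<le> lux M"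
    then have "F ((1 / l) *\<^sub>R M) < F ((1 / lux M) *\<^sub>R M)"
      using assms lux_pos[OF assms(1)] by (intro F_scale_less) (auto simp: frac_less2)
    then show False
      using * by (simp add: F_lux assms)
  qed
qed

text \<open>Both sides say that \<open>\<phi> 1 \<le> F ((1 / lux M) *\<^sub>R M')\<close> for every
  competitor, because \<open>F\<close> has the value \<open>\<phi> 1\<close> at
  \<open>(1 / lux M) *\<^sub>R M\<close>.\<close>

lemma min_lux_iff_min_F:
  assumes "\<bar>det M\<bar> = 1"
  shows "(\<forall>M'. \<bar>det M'\<bar> = 1 \<longrightarrow> lux M \<le> lux M') \<longleftrightarrow>
    (\<forall>M'. \<bar>det M'\<bar> = 1 \<longrightarrow> F ((1 / lux M) *\<^sub>R M) \<le> F ((1 / lux M) *\<^sub>R M'))"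
  using le_lux_iff lux_pos F_lux nonzero_det assms by metis

text \<open>Moving along rays trades determinant for \<open>F\<close>. A competitor of absolute
  determinant 1 with smaller \<open>F\<close> can be enlarged until \<open>F\<close> reaches
  \<open>\<phi> 1\<close>, which pushes its determinant above 1. A feasible matrix of larger
  determinant can be shrunk to absolute determinant 1, which lowers \<open>F\<close> strictly below
  \<open>\<phi> 1\<close>.\<close>

lemma max_det_iff_min_F:
  assumes "\<bar>det M\<bar> = 1"
  shows "(\<forall>M'. F ((1 / lux M) *\<^sub>R M') \<le> \<phi> 1 \<longrightarrow> \<bar>det M'\<bar> \<le> 1) \<longleftrightarrow>
    (\<forall>M'. \<bar>det M'\<bar> = 1 \<longrightarrow> F ((1 / lux M) *\<^sub>R M) \<le> F ((1 / lux M) *\<^sub>R M'))"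
    (is "?L \<longleftrightarrow> ?R")
proof -
  let ?c = "1 / lux M"
  have c: "?c > 0"
    using lux_pos[OF nonzero_det[OF assms]] by simp
  have phi1: "F (?c *\<^sub>R M) = \<phi> 1"
    by (rule F_lux[OF nonzero_det[OF assms]])
  show ?thesis
  proof
    assume L: ?L
    show ?R
    proof (intro allI impI, rule ccontr)
      fix M' :: "real^'n^'n" assume det: "\<bar>det M'\<bar> = 1" and "\<not> F (?c *\<^sub>R M) \<le> F (?c *\<^sub>R M')"
      then have less: "F (?c *\<^sub>R M') < \<phi> 1"
        by (simp add: phi1)
      then have "lux (?c *\<^sub>R M') < 1"
        using le_lux_iff[of "?c *\<^sub>R M'" 1] c nonzero_det[OF det] by auto
      \<comment> \<open>Here \<open>1 / l > 1\<close> is the enlargement that raises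
        \<open>F\<close> to exactly \<open>\<phi> 1\<close>.\<close>
      moreover define l where "l = lux (?c *\<^sub>R M')"
      have nz: "?c *\<^sub>R M' \<noteq> 0"
        using c nonzero_det[OF det] by simp
      have l: "l > 0"
        unfolding l_def by (rule lux_pos[OF nz])
      have "F ((1 / l) *\<^sub>R ?c *\<^sub>R M') = \<phi> 1"
        unfolding l_def by (rule F_lux[OF nz])
      then have "F (?c *\<^sub>R ((1 / l) *\<^sub>R M')) \<le> \<phi> 1"
        by (simp add: mult.commute)
      then have "\<bar>det ((1 / l) *\<^sub>R M')\<bar> \<le> 1"
        using L by blast
      then have "(1 / l) ^ CARD('n) \<le> 1"
        using det l by (simp add: det_scaleR abs_mult)
      moreover have "1 < (1 / l) ^ CARD('n)"
        using l \<open>lux (?c *\<^sub>R M') < 1\<close> by (intro one_less_power) (auto simp: l_def)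
      ultimately show False
        by simp
    qed
  next
    assume R: ?R
    show ?L
    proof (intro allI impI, rule ccontr)
      fix M' :: "real^'n^'n" assume le: "F (?c *\<^sub>R M') \<le> \<phi> 1" and "\<not> \<bar>det M'\<bar> \<le> 1"
      then have gt: "\<bar>det M'\<bar> > 1"
        by simp
      define s where "s = 1 / root CARD('n) \<bar>det M'\<bar>"
      have s: "0 \<le> s" "s < 1"
        using gt by (auto simp: s_def)
      have "\<bar>det (s *\<^sub>R M')\<bar> = 1"
        unfolding s_def by (rule abs_det_normalize) (use gt in auto)
      then have "\<phi> 1 \<le> F (?c *\<^sub>R (s *\<^sub>R M'))"
        using R by (simp only: phi1)
      also have "\<dots> = F (s *\<^sub>R (?c *\<^sub>R M'))"
        by (simp add: mult.commute)
      also have "\<dots> < F (1 *\<^sub>R (?c *\<^sub>R M'))"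
        using s gt c by (intro F_scale_less) (auto simp: det_0[unfolded mat_0])
      finally show False
        using le by simp
    qed
  qed
qed

text \<open>A maximizer \<open>M0\<close> of the determinant at level \<open>\<phi> 1\<close> is
  normalized. Its value of \<open>lux\<close> is then at most \<open>1 / \<delta>\<close>. No
  competitor \<open>M'\<close> goes below that, because \<open>(1 / lux M') *\<^sub>R M'\<close> is
  feasible and so cannot beat the determinant of \<open>M0\<close>.\<close>

lemma min_lux_exists:
  obtains M where "\<bar>det M\<bar> = 1" "\<And>M'. \<bar>det M'\<bar> = 1 \<Longrightarrow> lux M \<le> lux M'"
proof -
  obtain M0 where M0: "F M0 \<le> \<phi> 1" "det M0 \<noteq> 0" "\<And>M'. F M' \<le> \<phi> 1 \<Longrightarrow> \<bar>det M'\<bar> \<le> \<bar>det M0\<bar>"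
    using max_det_exists[OF phi_1_pos] by blast
  define \<delta> where "\<delta> = root CARD('n) \<bar>det M0\<bar>"
  have \<delta>: "\<delta> > 0" "\<delta> ^ CARD('n) = \<bar>det M0\<bar>"
    using M0(2) by (auto simp: \<delta>_def)
  show thesis
  proof
    show det: "\<bar>det ((1 / \<delta>) *\<^sub>R M0)\<bar> = 1"
      unfolding \<delta>_def by (rule abs_det_normalize[OF M0(2)])
    fix M' :: "real^'n^'n" assume det': "\<bar>det M'\<bar> = 1"
    note nz' = nonzero_det[OF det']
    have "lux ((1 / \<delta>) *\<^sub>R M0) \<le> 1 / \<delta>"
      using \<delta> M0(1) by (subst lux_le_iff[OF nonzero_det[OF det]]) auto
    also have "1 / \<delta> \<le> lux M'"
    proof -
      have "\<bar>det ((1 / lux M') *\<^sub>R M')\<bar> \<le> \<bar>det M0\<bar>"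
        by (rule M0(3)) (simp add: F_lux nz')
      then have "(1 / lux M') ^ CARD('n) \<le> \<delta> ^ CARD('n)"
        using lux_pos[OF nz'] by (simp add: det_scaleR abs_mult det' \<delta>)
      then have "1 / lux M' \<le> \<delta>"
        using \<delta>(1) by (simp add: power_mono_iff lux_pos[OF nz'] less_imp_le)
      then show ?thesis
        using lux_pos[OF nz'] \<delta>(1) by (simp add: field_simps)
    qed
    finally show "lux ((1 / \<delta>) *\<^sub>R M0) \<le> lux M'" .
  qed
qed

text \<open>Scaled by \<open>1 / lux M1\<close>, both matrices have maximal absolute determinant at
  level \<open>\<phi> 1\<close>, where uniqueness is known.\<close>

lemma min_lux_unique:
  assumes M1: "\<bar>det M1\<bar> = 1" "\<And>M'. \<bar>det M'\<bar> = 1 \<Longrightarrow> lux M1 \<le> lux M'"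
    and M2: "\<bar>det M2\<bar> = 1" "lux M2 = lux M1"
  shows "norm (M1 *v x) = norm (M2 *v x)"
proof -
  let ?c = "1 / lux M1"
  have c: "?c > 0"
    using lux_pos[OF nonzero_det[OF M1(1)]] by simp
  have max: "\<forall>M'. F (?c *\<^sub>R M') \<le> \<phi> 1 \<longrightarrow> \<bar>det M'\<bar> \<le> 1"
    using M1 unfolding max_det_iff_min_F[OF M1(1)] min_lux_iff_min_F[OF M1(1), symmetric] by blast
  have "norm ((?c *\<^sub>R M1) *v x) = norm ((?c *\<^sub>R M2) *v x)"
  proof (rule max_det_unique)
    show "F (?c *\<^sub>R M1) \<le> \<phi> 1" "F (?c *\<^sub>R M2) \<le> \<phi> 1"
      using F_lux[OF nonzero_det[OF M1(1)]] F_lux[OF nonzero_det[OF M2(1)]] M2(2) by auto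
    show "det (?c *\<^sub>R M1) \<noteq> 0" "\<bar>det (?c *\<^sub>R M2)\<bar> = \<bar>det (?c *\<^sub>R M1)\<bar>"
      using c M1(1) M2(1) by (auto simp: det_scaleR abs_mult)
    fix M' assume "F M' \<le> \<phi> 1"
    then have "F (?c *\<^sub>R (lux M1 *\<^sub>R M')) \<le> \<phi> 1"
      using c by simp
    then have "\<bar>det (lux M1 *\<^sub>R M')\<bar> \<le> 1"
      using max by blast
    then show "\<bar>det M'\<bar> \<le> \<bar>det (?c *\<^sub>R M1)\<bar>"
      using c M1(1) by (simp add: det_scaleR abs_mult power_one_over field_simps)
  qed
  then show ?thesis
    using c by (simp flip: scaleR_matrix_vector_assoc)
qed

end

section \<open>Isotropy as the first order condition\<close>

lemma C1_half_line_continuous: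
  assumes "\<phi> \<in> C1_half_line"
  shows "continuous_on {0..} \<phi>"
  using assms
  by (auto simp: C1_half_line_def continuous_on_eq_continuous_within intro!: differentiable_imp_continuous_within)

lemma half_line_deriv_has_derivative:
  assumes "\<phi> \<in> C1_half_line" "t \<ge> 0"
  shows "(\<phi> has_real_derivative half_line_deriv \<phi> t) (at t within {0..})"
  using assms unfolding half_line_deriv_def has_real_derivative_iff_has_vector_derivative
  by (simp add: C1_half_line_def flip: vector_derivative_works)

locale c1_orlicz_star =
  fixes K :: "(real^'n) set" and \<phi> :: "real \<Rightarrow> real"
  assumes K: "K \<in> star_bodies" and orlicz: "\<phi> \<in> orlicz_functions" and C1: "\<phi> \<in> C1_half_line"
begin

abbreviation \<phi>' :: "real \<Rightarrow> real" where "\<phi>' \<equiv> half_line_deriv \<phi>"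
abbreviation \<rho> :: "real^'n \<Rightarrow> real" where "\<rho> \<equiv> radial_fun K"

sublocale S: full_sphere_measure "spherical_measure :: (real^'n) measure"
  by (rule spherical_measure_full)

sublocale dual: orlicz_sphere "dual_cone_measure K" \<phi> \<rho>
  using C1_half_line_continuous[OF C1] orlicz radial_continuous[OF K] radial_pos[OF K]
  by (intro orlicz_sphere.intro dual_cone_full(1) K orlicz_sphere_axioms.intro)

lemma tangent: "0 < t \<Longrightarrow> 0 \<le> s \<Longrightarrow> \<phi> t + \<phi>' t * (s - t) \<le> \<phi> s"
  using convex_on_imp_above_tangent[OF dual.phi_convex _ _ _ half_line_deriv_has_derivative[OF C1], of t s]
  by simp

text \<open>The tangent at \<open>t\<close>, evaluated at 0, gives
  \<open>\<phi> t \<le> \<phi>' t * t\<close>.\<close>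

lemma deriv_pos:
  assumes "0 < t"
  shows "0 < \<phi>' t"
proof -
  have "0 < \<phi> t"
    using dual.phi_less[of 0 t] assms by (simp add: dual.phi_0)
  also have "\<dots> \<le> \<phi>' t * t"
    using tangent[OF assms, of 0] by (simp add: dual.phi_0)
  finally show ?thesis
    using assms by (simp add: zero_less_mult_iff)
qed

lemma deriv_cont: "continuous_on {0..} \<phi>'"
  using C1 by (simp add: C1_half_line_def)

lemma rho_pos: "norm u = 1 \<Longrightarrow> 0 < \<rho> u"
  by (rule radial_pos[OF K])

lemma rho_cont: "continuous_on (sphere 0 1) \<rho>"
  by (rule radial_continuous[OF K])

text \<open>The density of the measure in (4). It is \<open>n\<close> times the derivative at
  \<open>s = 1\<close> of \<open>\<rho> u ^ n / n * \<phi> (\<rho> u * s)\<close>, which ties it to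
  the first variation of \<open>dual.F\<close> at the identity.\<close>

definition w :: "real^'n \<Rightarrow> real" where "w u = \<phi>' (\<rho> u) * \<rho> u ^ (CARD('n) + 1)"

lemma w_pos: "norm u = 1 \<Longrightarrow> 0 < w u"
  by (simp add: w_def deriv_pos rho_pos)

lemma w_cont: "continuous_on (sphere 0 1) w"
  unfolding w_def
  by (intro continuous_intros rho_cont continuous_on_compose2[OF deriv_cont])
    (auto intro: less_imp_le[OF rho_pos])

lemma w_integrable:
  fixes g :: "real^'n \<Rightarrow> real"
  shows "continuous_on (sphere 0 1) g \<Longrightarrow> integrable spherical_measure (\<lambda>u. w u * g u)"
  by (intro S.integrable_nu continuous_intros w_cont)

lemma w_mass_pos: "0 < (\<integral>u. w u \<partial>spherical_measure)"
proof -
  obtain u0 :: "real^'n" where "norm u0 = 1"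
    using vector_choose_size[of 1] by auto
  then show ?thesis
    by (intro S.integral_pos[of _ u0] w_cont) (auto intro: w_pos less_imp_le)
qed

lemma isotropic_iff:
  "isotropic (mu_measure \<phi> K) \<longleftrightarrow>
    (\<forall>v. norm v = 1 \<longrightarrow> real CARD('n) * (\<integral>u. w u * (u \<bullet> v)\<^sup>2 \<partial>spherical_measure) = (\<integral>u. w u \<partial>spherical_measure))"
proof -
  have mu: "mu_measure \<phi> K = density spherical_measure (\<lambda>u. ennreal (w u))"
    by (simp add: mu_measure_def w_def)
  have full: "full_sphere_measure (mu_measure \<phi> K)"
    "continuous_on (sphere 0 1) g \<Longrightarrow>
      (\<integral>u. g u \<partial>mu_measure \<phi> K) = (\<integral>u. w u * g u \<partial>spherical_measure)" for g :: "real^'n \<Rightarrow> real"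
    unfolding mu by (rule full_sphere_measure_density[OF w_cont]; simp add: w_pos)+
  interpret M: full_sphere_measure "mu_measure \<phi> K"
    by (rule full(1))
  have "measure (mu_measure \<phi> K) (space (mu_measure \<phi> K)) = (\<integral>u. w u \<partial>spherical_measure)"
    using full(2)[of "\<lambda>u. 1"] by simp
  moreover have "(\<integral>u. (u \<bullet> v)\<^sup>2 \<partial>mu_measure \<phi> K) = (\<integral>u. w u * (u \<bullet> v)\<^sup>2 \<partial>spherical_measure)" for v
    by (rule full(2)) (intro continuous_intros)
  ultimately show ?thesis
    using w_mass_pos M.sets_nu M.finite_measure_axioms
    by (auto simp: isotropic_def field_simps)
qed

lemma dual_F: "dual.F M = (\<integral>u. \<rho> u ^ CARD('n) / real CARD('n) * \<phi> (\<rho> u * norm (M *v u)) \<partial>spherical_measure)"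
  unfolding dual.F_def by (rule dual_cone_full(2)[OF K dual.integrand_cont])

text \<open>The tangent at \<open>\<rho> u\<close> bounds the increase of the integrand of
  \<open>dual.F\<close> from below by \<open>w u * (norm (N *v u) - 1) / n\<close>. With
  \<open>norm (N *v u)\<close> replaced by its quadratic minorant, isotropy evaluates the integral
  of \<open>w\<close> times the minorant as \<open>W / n\<close> times the sum of the
  \<open>d i\<close>, which is at least \<open>W\<close>.\<close>

lemma isotropic_imp_min:
  assumes iso: "\<And>v. norm v = 1 \<Longrightarrow>
      real CARD('n) * (\<integral>u. w u * (u \<bullet> v)\<^sup>2 \<partial>spherical_measure) = (\<integral>u. w u \<partial>spherical_measure)"
    and N: "\<bar>det N\<bar> = 1"
  shows "dual.F (mat 1) \<le> dual.F N"
proof -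
  let ?n = "real CARD('n)"
  define W where "W = (\<integral>u. w u \<partial>spherical_measure)"
  obtain e d where e: "orthonormal e" "(\<Sum>i\<in>UNIV. d i) \<ge> ?n"
    "\<And>u. norm u = 1 \<Longrightarrow> (\<Sum>i\<in>UNIV. d i * (e i \<bullet> u)\<^sup>2) \<le> norm (N *v u)"
    using det_1_quadratic_minorant[OF N] by blast
  have norm_e: "norm (e i) = 1" for i
    using e(1) by (simp add: orthonormal_def norm_eq_1)
  have i: "integrable spherical_measure (\<lambda>u. w u * (d i * (e i \<bullet> u)\<^sup>2))" for i
    by (intro w_integrable continuous_intros)
  have "(\<integral>u. w u * (d i * (e i \<bullet> u)\<^sup>2) \<partial>spherical_measure) = d i * W / ?n" for i
  proof -
    have "(\<integral>u. w u * (d i * (e i \<bullet> u)\<^sup>2) \<partial>spherical_measure) =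
        (\<integral>u. d i * (w u * (u \<bullet> e i)\<^sup>2) \<partial>spherical_measure)"
      by (simp add: mult.left_commute inner_commute)
    also have "\<dots> = d i * (\<integral>u. w u * (u \<bullet> e i)\<^sup>2 \<partial>spherical_measure)"
      by simp
    finally show ?thesis
      using iso[OF norm_e[of i]] by (simp add: W_def field_simps inner_commute)
  qed
  then have "(\<integral>u. w u * (\<Sum>i\<in>UNIV. d i * (e i \<bullet> u)\<^sup>2) \<partial>spherical_measure) = (\<Sum>i\<in>UNIV. d i) * W / ?n"
    using i by (simp add: sum_distrib_left sum_distrib_right sum_divide_distrib)
  also have "\<dots> \<ge> ?n * W / ?n"
    using e(2) w_mass_pos by (intro divide_right_mono mult_right_mono) (auto simp: W_def)
  finally have ge: "W \<le> (\<integral>u. w u * (\<Sum>i\<in>UNIV. d i * (e i \<bullet> u)\<^sup>2) \<partial>spherical_measure)"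
    by simp
  have c: "continuous_on (sphere 0 1) (\<lambda>u. \<rho> u ^ CARD('n) / real CARD('n) * \<phi> (\<rho> u * norm (M *v u)))" for M
    by (intro continuous_intros rho_cont dual.integrand_cont) auto
  have "0 \<le> (\<integral>u. w u * (\<Sum>i\<in>UNIV. d i * (e i \<bullet> u)\<^sup>2) - w u \<partial>spherical_measure) / ?n"
  proof -
    have "(\<integral>u. w u * (\<Sum>i\<in>UNIV. d i * (e i \<bullet> u)\<^sup>2) - w u \<partial>spherical_measure) =
      (\<integral>u. w u * (\<Sum>i\<in>UNIV. d i * (e i \<bullet> u)\<^sup>2) \<partial>spherical_measure) - W"
      unfolding W_def
      by (intro Bochner_Integration.integral_diff w_integrable S.integrable_nu w_cont continuous_intros)
    then show ?thesis
      using ge by simp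
  qed
  also have "\<dots> = (\<integral>u. (w u * (\<Sum>i\<in>UNIV. d i * (e i \<bullet> u)\<^sup>2) - w u) / ?n \<partial>spherical_measure)"
    by simp
  also have "\<dots> \<le> (\<integral>u. \<rho> u ^ CARD('n) / ?n * \<phi> (\<rho> u * norm (N *v u)) -
      \<rho> u ^ CARD('n) / ?n * \<phi> (\<rho> u * norm (mat 1 *v u)) \<partial>spherical_measure)"
  proof (rule S.integral_mono_nu)
    fix u :: "real^'n" assume u: "norm u = 1"
    note r = rho_pos[OF u]
    have "(w u * (\<Sum>i\<in>UNIV. d i * (e i \<bullet> u)\<^sup>2) - w u) / ?n \<le> (w u * norm (N *v u) - w u) / ?n"
      using e(3)[OF u] w_pos[OF u] by (intro divide_right_mono diff_right_mono mult_left_mono) auto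
    also have "\<dots> = \<rho> u ^ CARD('n) / ?n * (\<phi>' (\<rho> u) * (\<rho> u * norm (N *v u) - \<rho> u))"
      by (simp add: w_def field_simps)
    also have "\<dots> \<le> \<rho> u ^ CARD('n) / ?n * (\<phi> (\<rho> u * norm (N *v u)) - \<phi> (\<rho> u))"
      using tangent[OF r, of "\<rho> u * norm (N *v u)"] r by (intro mult_left_mono) auto
    finally show "(w u * (\<Sum>i\<in>UNIV. d i * (e i \<bullet> u)\<^sup>2) - w u) / ?n \<le>
        \<rho> u ^ CARD('n) / ?n * \<phi> (\<rho> u * norm (N *v u)) - \<rho> u ^ CARD('n) / ?n * \<phi> (\<rho> u * norm (mat 1 *v u))"
      using u by (simp add: right_diff_distrib)
  next
    show "continuous_on (sphere 0 1) (\<lambda>u. (w u * (\<Sum>i\<in>UNIV. d i * (e i \<bullet> u)\<^sup>2) - w u) / ?n)"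
      by (intro continuous_intros w_cont) auto
    show "continuous_on (sphere 0 1) (\<lambda>u. \<rho> u ^ CARD('n) / ?n * \<phi> (\<rho> u * norm (N *v u)) -
      \<rho> u ^ CARD('n) / ?n * \<phi> (\<rho> u * norm (mat 1 *v u)))"
      by (intro continuous_on_diff c)
  qed
  also have "\<dots> = dual.F N - dual.F (mat 1)"
    unfolding dual_F by (intro Bochner_Integration.integral_diff S.integrable_nu c)
  finally show ?thesis
    by simp
qed

text \<open>For \<open>c = (v \<bullet> u)\<^sup>2\<close> and a unit vector \<open>u\<close>,
  \<open>q \<delta>\<close> is the length of the image of \<open>u\<close> under the stretch by
  \<open>1 + \<delta>\<close> along \<open>v\<close>, normalized to determinant 1. At
  \<open>\<delta> = 0\<close> the square root contributes \<open>c\<close> to the derivative and the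
  normalization contributes \<open>- 1 / n\<close>. A sequence is used with a view to dominated
  convergence.\<close>

lemma stretch_quotient_limit:
  fixes c :: real
  assumes "0 \<le> c"
  defines "q \<equiv> \<lambda>\<delta>. sqrt (1 + ((1 + \<delta>)\<^sup>2 - 1) * c) / (1 + \<delta>) powr (1 / real CARD('n))"
  shows "(\<lambda>k. (q (1 / real (Suc k)) - 1) / (1 / real (Suc k))) \<longlonglongrightarrow> c - 1 / real CARD('n)"
proof -
  have "(q has_real_derivative c - 1 / real CARD('n)) (at 0)"
    unfolding q_def by (auto intro!: derivative_eq_intros)
  then have "((\<lambda>\<delta>. (q \<delta> - 1) / \<delta>) \<longlongrightarrow> c - 1 / real CARD('n)) (at 0)"
    by (simp add: DERIV_def q_def)
  moreover have "filterlim (\<lambda>k. 1 / real (Suc k)) (at 0) sequentially"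
    unfolding filterlim_at using LIMSEQ_inverse_real_of_nat by (simp add: inverse_eq_divide)
  ultimately show ?thesis
    by (rule filterlim_compose)
qed

text \<open>The identity is compared with the normalized stretches by \<open>1 + \<delta>\<close>
  along \<open>v\<close>. The integral of \<open>f k\<close> bounds the difference quotient of
  \<open>dual.F\<close> from above, hence is nonnegative, and dominated convergence carries this to
  the first variation. Since \<open>\<delta>\<close> is positive throughout, the result is an
  inequality.\<close>

lemma min_imp_mass_le:
  assumes min: "\<And>N. \<bar>det N\<bar> = 1 \<Longrightarrow> dual.F (mat 1) \<le> dual.F N"
    and v: "norm v = 1"
  shows "(\<integral>u. w u \<partial>spherical_measure) \<le>
    real CARD('n) * (\<integral>u. w u * (u \<bullet> v)\<^sup>2 \<partial>spherical_measure)"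
proof -
  let ?n = "real CARD('n)"
  define q where "q u \<delta> = sqrt (1 + ((1 + \<delta>)\<^sup>2 - 1) * (v \<bullet> u)\<^sup>2) / (1 + \<delta>) powr (1 / ?n)"
    for u :: "real^'n" and \<delta>
  define \<delta> where "\<delta> k = 1 / real (Suc k)" for k
  have \<delta>: "0 < \<delta> k" "\<delta> k \<le> 1" for k
    by (auto simp: \<delta>_def)
  \<comment> \<open>Numerator and denominator of \<open>q\<close> both lie between 1 and
    \<open>1 + \<delta> k\<close>. This bounds the difference quotients uniformly in
    \<open>u\<close> and \<open>k\<close>.\<close>
  have qb: "\<bar>q u (\<delta> k) - 1\<bar> \<le> \<delta> k" "0 < q u (\<delta> k)" "q u (\<delta> k) \<le> 2" if u: "norm u = 1" for u k
  proof -
    let ?s = "1 + \<delta> k"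
    let ?a = "sqrt (1 + (?s\<^sup>2 - 1) * (v \<bullet> u)\<^sup>2)" and ?b = "?s powr (1 / ?n)"
    have s: "?s > 1" "?s\<^sup>2 \<ge> 1"
      using \<delta>(1)[of k] by auto
    have "\<bar>v \<bullet> u\<bar> \<le> 1"
      using Cauchy_Schwarz_ineq2[of v u] u v by simp
    then have c: "0 \<le> (v \<bullet> u)\<^sup>2" "(v \<bullet> u)\<^sup>2 \<le> 1"
      by (auto simp: abs_square_le_1)
    then have "(?s\<^sup>2 - 1) * (v \<bullet> u)\<^sup>2 \<le> ?s\<^sup>2 - 1" "0 \<le> (?s\<^sup>2 - 1) * (v \<bullet> u)\<^sup>2"
      using s by (auto intro!: mult_left_le mult_nonneg_nonneg)
    then have "sqrt 1 \<le> ?a" "?a \<le> sqrt (?s\<^sup>2)"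
      by (intro real_sqrt_le_mono; linarith)+
    then have a: "1 \<le> ?a" "?a \<le> ?s"
      using s by simp_all
    have "?s powr (1 / ?n) \<le> ?s powr 1"
      using s by (intro powr_mono) auto
    then have b: "1 \<le> ?b" "?b \<le> ?s"
      using s by (auto intro!: ge_one_powr_ge_zero)
    have "?a / ?b \<le> ?s / 1"
      using a b by (intro frac_le) auto
    moreover have "1 / ?s \<le> ?a / ?b"
      using a b by (intro frac_le) auto
    moreover have "1 - \<delta> k \<le> 1 / ?s"
      using s \<delta>(1)[of k] by (simp add: field_simps)
    ultimately show "\<bar>q u (\<delta> k) - 1\<bar> \<le> \<delta> k" "q u (\<delta> k) \<le> 2"
      using \<delta>[of k] by (auto simp: q_def)
    have "0 < ?a" "0 < ?b"
      using a b by linarith+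
    then show "0 < q u (\<delta> k)"
      unfolding q_def by (rule divide_pos_pos)
  qed
  \<comment> \<open>The slope is taken at the perturbed argument
    \<open>\<rho> u * q u (\<delta> k)\<close>, since the tangent there bounds the increment of
    \<open>\<phi>\<close> from above. Continuity of \<open>\<phi>'\<close> brings back the slope at
    \<open>\<rho> u\<close> in the limit.\<close>
  define f where "f k u = \<rho> u ^ (CARD('n) + 1) / ?n * (\<phi>' (\<rho> u * q u (\<delta> k)) * ((q u (\<delta> k) - 1) / \<delta> k))" for k u
  have qc: "continuous_on (sphere 0 1) (\<lambda>u. q u (\<delta> k))" for k
  proof -
    have "(1 + \<delta> k) powr (1 / ?n) \<noteq> 0"
      using \<delta>(1)[of k] by simp
    then show ?thesis
      unfolding q_def by (intro continuous_intros) auto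
  qed
  have q1: "\<phi>' (\<rho> u * q u (\<delta> k)) > 0" "\<rho> u * q u (\<delta> k) > 0" if "norm u = 1" for u k
    using deriv_pos rho_pos[OF that] qb(2)[OF that] by auto
  have fc: "continuous_on (sphere 0 1) (f k)" for k
    unfolding f_def
    by (intro continuous_intros rho_cont qc continuous_on_compose2[OF deriv_cont])
      (use q1(2) \<delta>(1)[of k] in \<open>auto intro: less_imp_le\<close>)
  have f_nonneg: "0 \<le> (\<integral>u. f k u \<partial>spherical_measure)" for k
  proof -
    obtain M :: "real^'n^'n" where M: "det M = 1 + \<delta> k"
      "\<And>x. (norm (M *v x))\<^sup>2 = (norm x)\<^sup>2 + ((1 + \<delta> k)\<^sup>2 - 1) * (v \<bullet> x)\<^sup>2"
      using det_stretch[OF v, of "1 + \<delta> k"] \<delta>(1)[of k] by (metis add_pos_pos zero_less_one)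
    define b where "b = (1 + \<delta> k) powr (1 / ?n)"
    have b: "b > 0" "b ^ CARD('n) = 1 + \<delta> k"
      using \<delta>(1)[of k] by (auto simp: b_def powr_powr simp flip: powr_realpow)
    define N where "N = (1 / b) *\<^sub>R M"
    have "\<bar>det N\<bar> = 1"
      using b \<delta>(1)[of k] by (simp add: N_def det_scaleR M(1) power_one_over)
    have Nu: "norm (N *v u) = q u (\<delta> k)" if "norm u = 1" for u
    proof -
      have "norm (M *v u) = sqrt (1 + ((1 + \<delta> k)\<^sup>2 - 1) * (v \<bullet> u)\<^sup>2)"
        using M(2)[of u] that by (intro real_sqrt_unique[symmetric]) auto
      then show ?thesis
        using b(1) by (simp add: N_def q_def b_def flip: scaleR_matrix_vector_assoc)
    qed
    have c: "continuous_on (sphere 0 1) (\<lambda>u. \<rho> u ^ CARD('n) / real CARD('n) * \<phi> (\<rho> u * norm (M *v u)))" for M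
      by (intro continuous_intros rho_cont dual.integrand_cont) auto
    have "0 \<le> (dual.F N - dual.F (mat 1)) / \<delta> k"
      using min[OF \<open>\<bar>det N\<bar> = 1\<close>] \<delta>(1)[of k] by simp
    also have "\<dots> = (\<integral>u. \<rho> u ^ CARD('n) / ?n * \<phi> (\<rho> u * norm (N *v u)) -
      \<rho> u ^ CARD('n) / ?n * \<phi> (\<rho> u * norm (mat 1 *v u)) \<partial>spherical_measure) / \<delta> k"
      unfolding dual_F
      by (intro arg_cong[of _ _ "\<lambda>x. x / \<delta> k"] Bochner_Integration.integral_diff[symmetric] S.integrable_nu c)
    also have "\<dots> = (\<integral>u. (\<rho> u ^ CARD('n) / ?n * \<phi> (\<rho> u * norm (N *v u)) -
      \<rho> u ^ CARD('n) / ?n * \<phi> (\<rho> u * norm (mat 1 *v u))) / \<delta> k \<partial>spherical_measure)"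
      by simp
    also have "\<dots> \<le> (\<integral>u. f k u \<partial>spherical_measure)"
    proof (rule S.integral_mono_nu[OF _ fc])
      fix u :: "real^'n" assume u: "norm u = 1"
      let ?t = "\<rho> u * q u (\<delta> k)"
      have "\<phi> ?t - \<phi> (\<rho> u) \<le> \<phi>' ?t * (?t - \<rho> u)"
        using tangent[OF q1(2)[OF u], of "\<rho> u" k] rho_pos[OF u] by (simp add: algebra_simps)
      then have "\<rho> u ^ CARD('n) / ?n * (\<phi> ?t - \<phi> (\<rho> u)) / \<delta> k \<le>
          \<rho> u ^ CARD('n) / ?n * (\<phi>' ?t * (?t - \<rho> u)) / \<delta> k"
        using rho_pos[OF u] \<delta>(1)[of k] by (intro divide_right_mono mult_left_mono) auto
      also have "\<dots> = f k u"
        using \<delta>(1)[of k] by (simp add: f_def field_simps)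
      finally show "(\<rho> u ^ CARD('n) / ?n * \<phi> (\<rho> u * norm (N *v u)) -
        \<rho> u ^ CARD('n) / ?n * \<phi> (\<rho> u * norm (mat 1 *v u))) / \<delta> k \<le> f k u"
        using u by (simp add: Nu right_diff_distrib)
    next
      show "continuous_on (sphere 0 1) (\<lambda>u. (\<rho> u ^ CARD('n) / ?n * \<phi> (\<rho> u * norm (N *v u)) -
        \<rho> u ^ CARD('n) / ?n * \<phi> (\<rho> u * norm (mat 1 *v u))) / \<delta> k)"
        using \<delta>(1)[of k] by (intro continuous_on_divide continuous_on_diff c continuous_on_const) auto
    qed
    finally show ?thesis .
  qed
  \<comment> \<open>The pointwise limit of \<open>f k\<close>, that is, the integrand of the first
    variation.\<close>
  define g where "g u = w u / ?n * ((u \<bullet> v)\<^sup>2 - 1 / ?n)" for u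
  obtain R where R: "\<And>u. norm u = 1 \<Longrightarrow> \<bar>\<rho> u\<bar> \<le> R"
    using continuous_on_sphere_bounded[OF rho_cont] by blast
  \<comment> \<open>On the sphere \<open>\<rho> u \<le> R\<close> and
    \<open>q u (\<delta> k) \<le> 2\<close>, so all arguments of \<open>\<phi>'\<close> stay in this
    interval.\<close>
  have "compact (\<phi>' ` {0..2 * R})"
    by (intro compact_continuous_image continuous_on_subset[OF deriv_cont]) auto
  then obtain D where D: "\<And>t. t \<in> {0..2 * R} \<Longrightarrow> \<bar>\<phi>' t\<bar> \<le> D"
    by (metis bounded_iff compact_imp_bounded imageI real_norm_def)
  have "(\<lambda>k. \<integral>u. f k u \<partial>spherical_measure) \<longlonglongrightarrow> (\<integral>u. g u \<partial>spherical_measure)"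
  proof (rule integral_dominated_convergence)
    show "g \<in> borel_measurable spherical_measure"
      unfolding g_def by (intro S.measurable_nu continuous_intros w_cont) auto
    show "f k \<in> borel_measurable spherical_measure" for k
      by (intro S.measurable_nu fc)
    show "integrable spherical_measure (\<lambda>u :: real^'n. R ^ (CARD('n) + 1) / ?n * (D * 1) :: real)"
      by (intro S.integrable_nu continuous_intros) auto
    show "AE u in spherical_measure. norm (f k u) \<le> R ^ (CARD('n) + 1) / ?n * (D * 1)" for k
    proof (rule AE_I2)
      fix u :: "real^'n" assume "u \<in> space spherical_measure"
      then have u: "norm u = 1"
        by (simp add: space_spherical_measure)
      have r: "0 < \<rho> u" "\<rho> u \<le> R"
        using rho_pos[OF u] R[OF u] by auto
      have "\<rho> u * q u (\<delta> k) \<le> R * 2"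
        using r qb[OF u, of k] by (intro mult_mono) auto
      then have "\<bar>\<phi>' (\<rho> u * q u (\<delta> k))\<bar> \<le> D"
        using q1(2)[OF u, of k] by (intro D) auto
      moreover have "\<bar>(q u (\<delta> k) - 1) / \<delta> k\<bar> \<le> 1"
        using qb(1)[OF u, of k] \<delta>(1)[of k] by simp
      ultimately have m1: "\<bar>\<phi>' (\<rho> u * q u (\<delta> k))\<bar> * \<bar>(q u (\<delta> k) - 1) / \<delta> k\<bar> \<le> D * 1"
        by (intro mult_mono) auto
      have m2: "\<bar>\<rho> u ^ (CARD('n) + 1) / ?n\<bar> \<le> R ^ (CARD('n) + 1) / ?n"
        using r by (auto simp: abs_mult intro!: divide_right_mono mult_mono power_mono)
      show "norm (f k u) \<le> R ^ (CARD('n) + 1) / ?n * (D * 1)"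
        unfolding f_def real_norm_def abs_mult[of "_ / _"] abs_mult[of "\<phi>' _"]
        by (rule mult_mono[OF m2 m1]) (use r in auto)
    qed
    show "AE u in spherical_measure. (\<lambda>k. f k u) \<longlonglongrightarrow> g u"
    proof (rule AE_I2)
      fix u :: "real^'n" assume "u \<in> space spherical_measure"
      then have u: "norm u = 1"
        by (simp add: space_spherical_measure)
      have lim: "(\<lambda>k. (q u (\<delta> k) - 1) / \<delta> k) \<longlonglongrightarrow> (v \<bullet> u)\<^sup>2 - 1 / ?n"
        using stretch_quotient_limit[of "(v \<bullet> u)\<^sup>2"] by (simp add: q_def \<delta>_def)
      have d0: "\<delta> \<longlonglongrightarrow> 0"
        using LIMSEQ_inverse_real_of_nat by (simp add: \<delta>_def[abs_def] inverse_eq_divide)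
      have "(\<lambda>k. q u (\<delta> k) - 1) \<longlonglongrightarrow> 0"
        using tendsto_mult[OF lim d0] \<delta>(1) by (simp add: less_imp_neq[symmetric])
      then have "(\<lambda>k. \<rho> u * (q u (\<delta> k) - 1) + \<rho> u) \<longlonglongrightarrow> \<rho> u * 0 + \<rho> u"
        by (intro tendsto_intros)
      then have "(\<lambda>k. \<rho> u * q u (\<delta> k)) \<longlonglongrightarrow> \<rho> u"
        by (simp add: algebra_simps)
      then have "(\<lambda>k. \<phi>' (\<rho> u * q u (\<delta> k))) \<longlonglongrightarrow> \<phi>' (\<rho> u)"
        using q1(2)[OF u] rho_pos[OF u]
        by (intro continuous_on_tendsto_compose[OF deriv_cont]) (auto intro: less_imp_le always_eventually)
      then have "(\<lambda>k. f k u) \<longlonglongrightarrow> \<rho> u ^ (CARD('n) + 1) / ?n * (\<phi>' (\<rho> u) * ((v \<bullet> u)\<^sup>2 - 1 / ?n))"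
        unfolding f_def using lim by (intro tendsto_mult tendsto_const)
      also have "\<rho> u ^ (CARD('n) + 1) / ?n * (\<phi>' (\<rho> u) * ((v \<bullet> u)\<^sup>2 - 1 / ?n)) = g u"
        by (simp add: g_def w_def inner_commute)
      finally show "(\<lambda>k. f k u) \<longlonglongrightarrow> g u" .
    qed
  qed
  then have "0 \<le> (\<integral>u. g u \<partial>spherical_measure)"
    by (rule LIMSEQ_le_const) (use f_nonneg in auto)
  also have "(\<integral>u. g u \<partial>spherical_measure) =
      (\<integral>u. w u * (u \<bullet> v)\<^sup>2 / ?n - w u / (?n * ?n) \<partial>spherical_measure)"
    by (intro Bochner_Integration.integral_cong refl) (simp add: g_def field_simps)
  also have "\<dots> = (\<integral>u. w u * (u \<bullet> v)\<^sup>2 \<partial>spherical_measure) / ?n - (\<integral>u. w u \<partial>spherical_measure) / (?n * ?n)"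
  proof -
    have "integrable spherical_measure (\<lambda>u. w u * (u \<bullet> v)\<^sup>2)" "integrable spherical_measure w"
      by (intro w_integrable S.integrable_nu w_cont continuous_intros)+
    then show ?thesis
      by simp
  qed
  finally show ?thesis
    by (simp add: field_simps)
qed

text \<open>The inequalities of the previous lemma for an orthonormal basis add up to an equality.\<close>

lemma min_imp_isotropic:
  assumes min: "\<And>N. \<bar>det N\<bar> = 1 \<Longrightarrow> dual.F (mat 1) \<le> dual.F N"
    and v: "norm v = 1"
  shows "real CARD('n) * (\<integral>u. w u * (u \<bullet> v)\<^sup>2 \<partial>spherical_measure) = (\<integral>u. w u \<partial>spherical_measure)"
proof -
  let ?n = "real CARD('n)"
  define W where "W = (\<integral>u. w u \<partial>spherical_measure)"
  obtain e k where e: "orthonormal e" "e k = v"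
    using orthonormal_extend[OF v] by blast
  define I where "I i = (\<integral>u. w u * (e i \<bullet> u)\<^sup>2 \<partial>spherical_measure)" for i
  have "norm (e i) = 1" for i
    using e(1) by (simp add: orthonormal_def norm_eq_1)
  then have ge: "0 \<le> ?n * I i - W" for i
    using min_imp_mass_le[OF min, of "e i"] by (simp add: I_def W_def inner_commute)
  have "integrable spherical_measure (\<lambda>u. w u * (e i \<bullet> u)\<^sup>2)" for i
    by (intro w_integrable continuous_intros)
  then have "(\<Sum>i\<in>UNIV. I i) = (\<integral>u. w u * (\<Sum>i\<in>UNIV. (e i \<bullet> u)\<^sup>2) \<partial>spherical_measure)"
    by (simp add: I_def sum_distrib_left)
  also have "\<dots> = W"
    unfolding W_def norm_sq_orthonormal[OF e(1), symmetric]
    by (intro Bochner_Integration.integral_cong refl) (simp add: space_spherical_measure)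
  finally have "(\<Sum>i\<in>UNIV. ?n * I i - W) = 0"
    by (simp add: sum_subtractf flip: sum_distrib_left)
  then have "?n * I k - W = 0"
    using ge by (simp add: sum_nonneg_eq_0_iff)
  then show ?thesis
    by (simp add: I_def W_def e(2) inner_commute)
qed

proposition isotropic_iff_min:
  "isotropic (mu_measure \<phi> K) \<longleftrightarrow> (\<forall>N. \<bar>det N\<bar> = 1 \<longrightarrow> dual.F (mat 1) \<le> dual.F N)"
  unfolding isotropic_iff using isotropic_imp_min min_imp_isotropic by blast

end

section \<open>Ellipsoids\<close>

text \<open>This is the image of the unit ball under the inverse of \<open>M\<close>.\<close>

definition ell :: "real^'n^'n \<Rightarrow> (real^'n) set" where
  "ell M = {x. norm (M *v x) \<le> 1}"

lemma lin_image_unit_ball: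
  fixes A B :: "real^'n^'n"
  assumes "A ** B = mat 1" "B ** A = mat 1"
  shows "lin_image A unit_ball = ell B"
proof (intro set_eqI iffI)
  fix x assume "x \<in> ell B"
  then have "B *v x \<in> unit_ball" "x = A *v (B *v x)"
    using assms(1) by (auto simp: ell_def matrix_vector_mul_assoc)
  then show "x \<in> lin_image A unit_ball"
    by blast
qed (auto simp: ell_def matrix_vector_mul_assoc assms(2))

lemma unit_ball_eq_ell: "unit_ball = ell (mat 1)"
  by (auto simp: ell_def)

lemma ellipsoids_eq: "ellipsoids = {ell M | M. det M \<noteq> 0}"
proof (intro set_eqI iffI)
  fix E :: "(real^'n) set" assume "E \<in> ellipsoids"
  then obtain A where A: "invertible A" "E = lin_image A unit_ball"
    by (auto simp: ellipsoids_def)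
  obtain B where "A ** B = mat 1" "B ** A = mat 1" "invertible B"
    using invertible_obtains[OF A(1)] .
  with A(2) show "E \<in> {ell M | M. det M \<noteq> 0}"
    using lin_image_unit_ball[of A B] by (auto simp: invertible_det_nz)
next
  fix E :: "(real^'n) set" assume "E \<in> {ell M | M. det M \<noteq> 0}"
  then obtain M where M: "invertible M" "E = ell M"
    by (auto simp: invertible_det_nz)
  obtain B where "M ** B = mat 1" "B ** M = mat 1" "invertible B"
    using invertible_obtains[OF M(1)] .
  with M(2) show "E \<in> ellipsoids"
    using lin_image_unit_ball[of B M] by (auto simp: ellipsoids_def)
qed

lemma mult_vec_eq_0_iff:
  fixes M :: "real^'n^'n"
  assumes "det M \<noteq> 0"
  shows "M *v x = 0 \<longleftrightarrow> x = 0"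
proof
  obtain B where "B ** M = mat 1"
    using assms invertible_det_nz invertible_def by blast
  then have "x = B *v (M *v x)"
    by (simp add: matrix_vector_mul_assoc)
  then show "M *v x = 0 \<Longrightarrow> x = 0"
    by simp
qed simp

lemma radial_fun_ell:
  fixes M :: "real^'n^'n"
  assumes "det M \<noteq> 0" "x \<noteq> 0"
  shows "radial_fun (ell M) x = 1 / norm (M *v x)"
  using assms mult_vec_eq_0_iff[OF assms(1), of x]
  by (intro radial_fun_eqI) (auto simp: ell_def matrix_vector_mult_scaleR field_simps)

lemma volume_ell:
  fixes M :: "real^'n^'n"
  assumes "det M \<noteq> 0"
  shows "volume (ell M) = volume (unit_ball :: (real^'n) set) / \<bar>det M\<bar>"
proof -
  obtain B where B: "M ** B = mat 1" "B ** M = mat 1" "invertible B"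
    using assms invertible_det_nz invertible_obtains by metis
  have "det B * det M = 1"
    using B(2) by (metis det_I det_mul)
  then have "\<bar>det B\<bar> = 1 / \<bar>det M\<bar>"
    using assms by (simp add: field_simps flip: abs_mult)
  moreover have "volume (lin_image B unit_ball) = \<bar>det B\<bar> * volume (unit_ball :: (real^'n) set)"
    by (rule measure_linear_image_borel) (auto simp: B(3))
  ultimately show ?thesis
    using lin_image_unit_ball[OF B(2,1)] by simp
qed

lemma volume_unit_ball_pos: "0 < volume (unit_ball :: (real^'n) set)"
  using content_cball_pos[of 1 "0 :: real^'n"] by simp

lemma volume_ell_eq_iff:
  fixes M :: "real^'n^'n"
  assumes "det M \<noteq> 0"
  shows "volume (ell M) = volume (unit_ball :: (real^'n) set) \<longleftrightarrow> \<bar>det M\<bar> = 1"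
  using assms volume_unit_ball_pos[where 'n='n] by (auto simp: volume_ell field_simps)

lemma ell_eqI: "(\<And>x. norm (M1 *v x) = norm (M2 *v x)) \<Longrightarrow> ell M1 = ell M2"
  by (simp add: ell_def)

text \<open>Existence and uniqueness make the description equivalent to minimality of
  \<open>ell M\<close>, and minimality over ellipsoids is minimality over invertible matrices.
  Uniqueness is asked only of the norm functions, since they determine the ellipsoid.\<close>

lemma the_arg_min_eq_ell:
  fixes f :: "(real^'n) set \<Rightarrow> real" and f' :: "real^'n^'n \<Rightarrow> real"
  assumes P: "\<And>E. P E \<Longrightarrow> E \<in> ellipsoids"
    and P': "\<And>M. det M \<noteq> 0 \<Longrightarrow> P (ell M) \<longleftrightarrow> P' M"
    and f: "\<And>M. det M \<noteq> 0 \<Longrightarrow> f (ell M) = f' M"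
    and ex: "\<exists>M. det M \<noteq> 0 \<and> P' M \<and> (\<forall>M'. det M' \<noteq> 0 \<longrightarrow> P' M' \<longrightarrow> f' M \<le> f' M')"
    and unique: "\<And>M1 M2 x. det M1 \<noteq> 0 \<Longrightarrow> det M2 \<noteq> 0 \<Longrightarrow> P' M1 \<Longrightarrow> P' M2 \<Longrightarrow>
      (\<And>M'. det M' \<noteq> 0 \<Longrightarrow> P' M' \<Longrightarrow> f' M1 \<le> f' M') \<Longrightarrow> f' M2 = f' M1 \<Longrightarrow> norm (M1 *v x) = norm (M2 *v x)"
    and M: "det M \<noteq> 0"
  shows "(THE E. is_arg_min f P E) = ell M \<longleftrightarrow>
    P' M \<and> (\<forall>M'. det M' \<noteq> 0 \<longrightarrow> P' M' \<longrightarrow> f' M \<le> f' M')"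
proof -
  have min_iff: "is_arg_min f P (ell N) \<longleftrightarrow> P' N \<and> (\<forall>M'. det M' \<noteq> 0 \<longrightarrow> P' M' \<longrightarrow> f' N \<le> f' M')"
    if N: "det N \<noteq> 0" for N
  proof -
    have "(\<forall>E. P E \<longrightarrow> f (ell N) \<le> f E) \<longleftrightarrow> (\<forall>M'. det M' \<noteq> 0 \<longrightarrow> P' M' \<longrightarrow> f' N \<le> f' M')"
    proof (intro iffI allI impI)
      fix M' assume "\<forall>E. P E \<longrightarrow> f (ell N) \<le> f E" "det M' \<noteq> 0" "P' M'"
      then show "f' N \<le> f' M'"
        using P'[of M'] f[of M'] f[OF N] by metis
    next
      fix E assume *: "\<forall>M'. det M' \<noteq> 0 \<longrightarrow> P' M' \<longrightarrow> f' N \<le> f' M'" "P E"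
      then obtain M' where "det M' \<noteq> 0" "E = ell M'"
        using P[OF *(2)] by (auto simp: ellipsoids_eq)
      with * show "f (ell N) \<le> f E"
        using P' f N by simp
    qed
    then show ?thesis
      using P'[OF N] by (simp add: is_arg_min_linorder)
  qed
  have "\<exists>!E. is_arg_min f P E"
  proof (rule ex_ex1I)
    show "\<exists>E. is_arg_min f P E"
      using ex min_iff by blast
    fix E1 E2 assume E: "is_arg_min f P E1" "is_arg_min f P E2"
    then have "E1 \<in> ellipsoids" "E2 \<in> ellipsoids"
      by (simp_all add: is_arg_min_def P)
    then obtain M1 M2 where M12: "det M1 \<noteq> 0" "E1 = ell M1" "det M2 \<noteq> 0" "E2 = ell M2"
      by (auto simp: ellipsoids_eq)
    have 1: "P' M1" "\<And>M'. det M' \<noteq> 0 \<Longrightarrow> P' M' \<Longrightarrow> f' M1 \<le> f' M'"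
      using E(1) min_iff[OF M12(1)] M12(2) by auto
    have 2: "P' M2" "\<And>M'. det M' \<noteq> 0 \<Longrightarrow> P' M' \<Longrightarrow> f' M2 \<le> f' M'"
      using E(2) min_iff[OF M12(3)] M12(4) by auto
    have "f' M2 = f' M1"
      using 1(2)[OF M12(3) 2(1)] 2(2)[OF M12(1) 1(1)] by simp
    then show "E1 = E2"
      unfolding M12(2,4) by (intro ell_eqI unique M12(1,3) 1 2(1))
  qed
  then have "(THE E. is_arg_min f P E) = ell M \<longleftrightarrow> is_arg_min f P (ell M)"
    using theI'[of "is_arg_min f P"] the1_equality[of "is_arg_min f P"] by metis
  then show ?thesis
    by (simp only: min_iff[OF M])
qed

section \<open>The Orlicz functionals on ellipsoids as functionals of matrices\<close>

context c1_orlicz_star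
begin

sublocale norm: orlicz_sphere "normalized_dual_cone_measure K" \<phi> "radial_fun K"
  using C1_half_line_continuous[OF C1] orlicz radial_continuous[OF K] radial_pos[OF K]
  by (intro orlicz_sphere.intro normalized_dual_cone_full(1) K orlicz_sphere_axioms.intro)

lemma dual_F_eq_norm_F: "dual.F M = volume K * norm.F M"
proof -
  have "norm.F M = dual.F M / volume K"
    unfolding dual.F_def norm.F_def
    by (rule normalized_dual_cone_full(2)[OF K norm.integrand_cont])
      (intro norm.phi_nonneg norm.integrand_nonneg)
  then show ?thesis
    using volume_star_body_pos[OF K] by simp
qed

text \<open>As \<open>inv_into\<close> inverts \<open>\<phi>\<close> only on its range,
  \<open>y\<close> must first be exhibited as a value of \<open>\<phi>\<close>, by the intermediate
  value theorem. Strict monotonicity does the rest.\<close>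

lemma phi_inverse_le_1_iff:
  assumes y: "0 \<le> y"
  shows "inv_into {0..} \<phi> y \<le> 1 \<longleftrightarrow> y \<le> \<phi> 1"
proof -
  \<comment> \<open>At this argument the linear minorant of \<open>\<phi>\<close> has the value
    \<open>y\<close>.\<close>
  have "y \<le> \<phi> (y / \<phi> 1 + 1)"
    using norm.phi_linear_minorant[of "y / \<phi> 1 + 1"] norm.phi_1_pos y by simp
  moreover have "0 \<le> y / \<phi> 1 + 1"
    using norm.phi_1_pos y by simp
  moreover have "continuous_on {0..y / \<phi> 1 + 1} \<phi>"
    by (rule continuous_on_subset[OF norm.phi_cont]) auto
  ultimately obtain x where x: "0 \<le> x" "\<phi> x = y"
    using IVT'[of \<phi> 0 y "y / \<phi> 1 + 1"] y norm.phi_0 by auto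
  have "inj_on \<phi> {0..}"
    using orlicz by (auto simp: orlicz_functions_def intro: strict_mono_on_imp_inj_on)
  then have "inv_into {0..} \<phi> y = x"
    using x by (intro inv_into_f_eq) auto
  moreover have "x \<le> 1 \<longleftrightarrow> \<phi> x \<le> \<phi> 1"
    using norm.phi_le[of x 1] norm.phi_less[of 1 x] x(1) by force
  ultimately show ?thesis
    using x(2) by simp
qed

lemma O_functional_ell:
  assumes "det M \<noteq> 0"
  shows "O_functional \<phi> K (ell M) = norm.lux M"
proof -
  have "(\<integral>u. \<phi> (radial_fun K u / (l * radial_fun (ell M) u)) \<partial>normalized_dual_cone_measure K) =
      norm.F ((1 / l) *\<^sub>R M)" if "l > 0" for l
    unfolding norm.F_def
  proof (rule Bochner_Integration.integral_cong[OF refl])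
    fix u assume "u \<in> space (normalized_dual_cone_measure K)"
    then have "u \<noteq> 0"
      by (auto simp: norm.space_nu)
    then show "\<phi> (radial_fun K u / (l * radial_fun (ell M) u)) = \<phi> (radial_fun K u * norm ((1 / l) *\<^sub>R M *v u))"
      using that by (simp add: radial_fun_ell[OF assms] flip: scaleR_matrix_vector_assoc)
  qed
  then show ?thesis
    unfolding O_functional_def norm.lux_def
    by (intro arg_cong[of _ _ Inf] Collect_cong) (auto simp: phi_inverse_le_1_iff norm.F_nonneg)
qed

lemma dual_orlicz_mixed_volume_ell:
  assumes "det M \<noteq> 0"
  shows "dual_orlicz_mixed_volume \<phi> K (ell M) = dual.F M"
  unfolding dual_orlicz_mixed_volume_def dual.F_def
proof (rule Bochner_Integration.integral_cong[OF refl])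
  fix u assume "u \<in> space (dual_cone_measure K)"
  then have "u \<noteq> 0"
    by (auto simp: dual.space_nu)
  then show "\<phi> (radial_fun K u / radial_fun (ell M) u) = \<phi> (radial_fun K u * norm (M *v u))"
    by (simp add: radial_fun_ell[OF assms])
qed

lemma O_functional_ell_le_1_iff:
  assumes "det M \<noteq> 0"
  shows "O_functional \<phi> K (ell M) \<le> 1 \<longleftrightarrow> norm.F M \<le> \<phi> 1"
proof -
  have "M \<noteq> 0"
    using assms by (auto simp: det_0[unfolded mat_0])
  then show ?thesis
    using norm.lux_le_iff[of M 1] by (simp add: O_functional_ell[OF assms])
qed

text \<open>The volume of \<open>ell M\<close> is inversely proportional to
  \<open>\<bar>det M\<bar>\<close>, so least volume means largest determinant. Singular competitors
  can be included on the right, as their determinant is 0.\<close>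

lemma orlicz_legendre_eq_iff:
  assumes "det M \<noteq> 0"
  shows "orlicz_legendre \<phi> K = ell M \<longleftrightarrow>
    norm.F M \<le> \<phi> 1 \<and> (\<forall>M'. norm.F M' \<le> \<phi> 1 \<longrightarrow> \<bar>det M'\<bar> \<le> \<bar>det M\<bar>)"
proof -
  let ?f = "\<lambda>M :: real^'n^'n. volume (unit_ball :: (real^'n) set) / \<bar>det M\<bar>"
  have f: "?f M1 \<le> ?f M2 \<longleftrightarrow> \<bar>det M2\<bar> \<le> \<bar>det M1\<bar>" if "det M1 \<noteq> 0" "det M2 \<noteq> 0" for M1 M2
    using that volume_unit_ball_pos[where 'n='n] by (simp add: field_simps)
  have "orlicz_legendre \<phi> K = ell M \<longleftrightarrow>
    norm.F M \<le> \<phi> 1 \<and> (\<forall>M'. det M' \<noteq> 0 \<longrightarrow> norm.F M' \<le> \<phi> 1 \<longrightarrow> ?f M \<le> ?f M')"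
    unfolding orlicz_legendre_def
  proof (rule the_arg_min_eq_ell)
    show "ell M \<in> ellipsoids \<and> O_functional \<phi> K (ell M) \<le> 1 \<longleftrightarrow> norm.F M \<le> \<phi> 1" if "det M \<noteq> 0" for M
      using that O_functional_ell_le_1_iff[OF that] by (auto simp: ellipsoids_eq)
    obtain M0 where "norm.F M0 \<le> \<phi> 1" "det M0 \<noteq> 0" "\<And>M'. norm.F M' \<le> \<phi> 1 \<Longrightarrow> \<bar>det M'\<bar> \<le> \<bar>det M0\<bar>"
      using norm.max_det_exists[OF norm.phi_1_pos] by blast
    then show "\<exists>M. det M \<noteq> 0 \<and> norm.F M \<le> \<phi> 1 \<and> (\<forall>M'. det M' \<noteq> 0 \<longrightarrow> norm.F M' \<le> \<phi> 1 \<longrightarrow> ?f M \<le> ?f M')"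
      using f by blast
    fix M1 M2 x
    assume 1: "det M1 \<noteq> 0" "norm.F M1 \<le> \<phi> 1" "\<And>M'. det M' \<noteq> 0 \<Longrightarrow> norm.F M' \<le> \<phi> 1 \<Longrightarrow> ?f M1 \<le> ?f M'"
      and 2: "det M2 \<noteq> 0" "norm.F M2 \<le> \<phi> 1" "?f M2 = ?f M1"
    show "norm (M1 *v x) = norm (M2 *v x)"
    proof (rule norm.max_det_unique[OF 1(2) _ 1(1) 2(2)])
      show "\<bar>det M'\<bar> \<le> \<bar>det M1\<bar>" if "norm.F M' \<le> \<phi> 1" for M'
        using 1(3)[OF _ that] f[OF 1(1), of M'] by (cases "det M' = 0") auto
      show "\<bar>det M2\<bar> = \<bar>det M1\<bar>"
        using 2(3) 1(1) 2(1) volume_unit_ball_pos[where 'n='n] by simp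
    qed
  qed (use assms in \<open>auto simp: volume_ell\<close>)
  also have "\<dots> \<longleftrightarrow> norm.F M \<le> \<phi> 1 \<and> (\<forall>M'. norm.F M' \<le> \<phi> 1 \<longrightarrow> \<bar>det M'\<bar> \<le> \<bar>det M\<bar>)"
    using f[OF assms] by (metis abs_ge_zero abs_zero)
  finally show ?thesis .
qed

lemma normalized_orlicz_legendre_eq_iff:
  assumes "\<bar>det M\<bar> = 1"
  shows "normalized_orlicz_legendre \<phi> K = ell M \<longleftrightarrow> (\<forall>M'. \<bar>det M'\<bar> = 1 \<longrightarrow> norm.lux M \<le> norm.lux M')"
proof -
  have "normalized_orlicz_legendre \<phi> K = ell M \<longleftrightarrow>
    \<bar>det M\<bar> = 1 \<and> (\<forall>M'. det M' \<noteq> 0 \<longrightarrow> \<bar>det M'\<bar> = 1 \<longrightarrow> norm.lux M \<le> norm.lux M')"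
    unfolding normalized_orlicz_legendre_def
  proof (rule the_arg_min_eq_ell)
    show "ell M \<in> ellipsoids \<and> volume (ell M) = volume (unit_ball :: (real^'n) set) \<longleftrightarrow> \<bar>det M\<bar> = 1"
      if "det M \<noteq> 0" for M :: "real^'n^'n"
      using that volume_ell_eq_iff[OF that] by (auto simp: ellipsoids_eq)
    obtain M0 where "\<bar>det M0\<bar> = 1" "\<And>M'. \<bar>det M'\<bar> = 1 \<Longrightarrow> norm.lux M0 \<le> norm.lux M'"
      using norm.min_lux_exists by blast
    then show "\<exists>M. det M \<noteq> 0 \<and> \<bar>det M\<bar> = 1 \<and> (\<forall>M'. det M' \<noteq> 0 \<longrightarrow> \<bar>det M'\<bar> = 1 \<longrightarrow> norm.lux M \<le> norm.lux M')"
      by (intro exI[of _ M0]) auto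
    show "norm (M1 *v x) = norm (M2 *v x)"
      if "\<bar>det M1\<bar> = 1" "\<bar>det M2\<bar> = 1" "norm.lux M2 = norm.lux M1"
        "\<And>M'. det M' \<noteq> 0 \<Longrightarrow> \<bar>det M'\<bar> = 1 \<Longrightarrow> norm.lux M1 \<le> norm.lux M'" for M1 M2 x
      by (rule norm.min_lux_unique[OF that(1) that(4) that(2,3)]) auto
  qed (use assms in \<open>auto simp: O_functional_ell\<close>)
  with assms show ?thesis
    by (metis abs_zero zero_neq_one)
qed

lemma diamond_orlicz_legendre_eq_iff:
  assumes "\<bar>det M\<bar> = 1"
  shows "diamond_orlicz_legendre \<phi> K = ell M \<longleftrightarrow> (\<forall>M'. \<bar>det M'\<bar> = 1 \<longrightarrow> dual.F M \<le> dual.F M')"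
proof -
  have "diamond_orlicz_legendre \<phi> K = ell M \<longleftrightarrow>
    \<bar>det M\<bar> = 1 \<and> (\<forall>M'. det M' \<noteq> 0 \<longrightarrow> \<bar>det M'\<bar> = 1 \<longrightarrow> dual.F M \<le> dual.F M')"
    unfolding diamond_orlicz_legendre_def
  proof (rule the_arg_min_eq_ell)
    show "ell M \<in> ellipsoids \<and> volume (ell M) = volume (unit_ball :: (real^'n) set) \<longleftrightarrow> \<bar>det M\<bar> = 1"
      if "det M \<noteq> 0" for M :: "real^'n^'n"
      using that volume_ell_eq_iff[OF that] by (auto simp: ellipsoids_eq)
    obtain M0 where "\<bar>det M0\<bar> = 1" "\<And>M'. \<bar>det M'\<bar> = 1 \<Longrightarrow> dual.F M0 \<le> dual.F M'"
      using dual.min_F_exists by blast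
    then show "\<exists>M. det M \<noteq> 0 \<and> \<bar>det M\<bar> = 1 \<and> (\<forall>M'. det M' \<noteq> 0 \<longrightarrow> \<bar>det M'\<bar> = 1 \<longrightarrow> dual.F M \<le> dual.F M')"
      by (intro exI[of _ M0]) auto
    show "norm (M1 *v x) = norm (M2 *v x)"
      if "\<bar>det M1\<bar> = 1" "\<bar>det M2\<bar> = 1" "dual.F M2 = dual.F M1"
        "\<And>M'. det M' \<noteq> 0 \<Longrightarrow> \<bar>det M'\<bar> = 1 \<Longrightarrow> dual.F M1 \<le> dual.F M'" for M1 M2 x
      by (rule dual.min_F_unique[OF that(1) that(4) that(2,3)]) auto
  qed (use assms in \<open>auto simp: dual_orlicz_mixed_volume_ell\<close>)
  with assms show ?thesis
    by (metis abs_zero zero_neq_one)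
qed

section \<open>Behaviour under linear images and dilates\<close>

lemma lin_image_c1_orlicz_star: "invertible A \<Longrightarrow> c1_orlicz_star (lin_image A K) \<phi>"
  using orlicz C1 by (intro c1_orlicz_star.intro lin_image_star_bodies K)

text \<open>The product \<open>radial_fun K x * norm (N *v x)\<close> is homogeneous of degree 0,
  hence a function of \<open>sgn x\<close>, and the radial function of the image at
  \<open>A *v x\<close> is that of \<open>K\<close> at \<open>x\<close>. So the integrands
  correspond under \<open>A\<close>.\<close>

lemma F_lin_image:
  assumes A: "invertible A"
  shows "orlicz_sphere.F (normalized_dual_cone_measure (lin_image A K)) \<phi> (radial_fun (lin_image A K)) M =
    norm.F (M ** A)"
proof -
  interpret A: c1_orlicz_star "lin_image A K" \<phi>
    by (rule lin_image_c1_orlicz_star[OF A])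
  show ?thesis
    unfolding norm.F_def A.norm.F_def
  proof (rule integral_normalized_dual_cone_linear[OF K A])
    fix x :: "real^'n" assume x: "x \<noteq> 0"
    have Ax: "A *v x \<noteq> 0"
      using A x by (simp add: mult_vec_eq_0_iff invertible_det_nz)
    have sgn: "radial_fun L (sgn y) * norm (N *v sgn y) = radial_fun L y * norm (N *v y)"
      if "L \<in> star_bodies" "y \<noteq> 0" for L and y :: "real^'n" and N :: "real^'n^'n"
    proof -
      have "norm (N *v sgn y) = norm (N *v y) / norm y"
        by (simp add: sgn_div_norm matrix_vector_mult_scaleR divide_inverse mult.commute)
      then show ?thesis
        by (simp add: radial_fun_sgn[OF that])
    qed
    show "\<phi> (radial_fun (lin_image A K) (sgn (A *v x)) * norm (M *v sgn (A *v x))) =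
        \<phi> (radial_fun K (sgn x) * norm (M ** A *v sgn x))"
      by (simp add: sgn[OF A.K Ax] sgn[OF K x] radial_fun_lin_image[OF A] matrix_vector_mul_assoc)
  qed (intro norm.integrand_cont A.norm.integrand_cont norm.phi_nonneg
      norm.integrand_nonneg A.norm.integrand_nonneg; assumption)+
qed

lemma F_dilate:
  assumes "c \<noteq> 0"
  shows "orlicz_sphere.F (normalized_dual_cone_measure (dilate c K)) \<phi> (radial_fun (dilate c K)) M =
    norm.F (c *\<^sub>R M)"
proof -
  have "M ** (c *\<^sub>R mat 1) = c *\<^sub>R M"
    by (simp add: vec_eq_iff matrix_matrix_mult_def mat_def if_distrib[of "\<lambda>x. _ * x"] cong: if_cong)
  then show ?thesis
    unfolding dilate_conv_lin_image by (simp add: F_lin_image[OF scaled_identity_invertible[OF assms]])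
qed

end

theorem theorem7p4:
  fixes K :: "(real^'n) set" and \<phi> :: "real \<Rightarrow> real" and T :: "real^'n^'n"
  assumes "K \<in> star_bodies"
    and "\<phi> \<in> orlicz_functions \<inter> C1_half_line"
    and "det T = 1"
  defines "TB \<equiv> lin_image T unit_ball"
    and "K' \<equiv> lin_image (matrix_inv T) K"
  shows "(orlicz_legendre \<phi> (dilate (inverse (O_functional \<phi> K TB)) K) = TB
          \<longleftrightarrow> normalized_orlicz_legendre \<phi> K = TB) \<and>
         (normalized_orlicz_legendre \<phi> K = TB
          \<longleftrightarrow> diamond_orlicz_legendre \<phi> (dilate (inverse (O_functional \<phi> K' unit_ball)) K') = unit_ball) \<and>
         (diamond_orlicz_legendre \<phi> (dilate (inverse (O_functional \<phi> K' unit_ball)) K') = unit_ball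
          \<longleftrightarrow> isotropic (mu_measure \<phi> (dilate (inverse (O_functional \<phi> K' unit_ball)) K')))"
proof -
  \<comment> \<open>The set \<open>TB\<close> is \<open>ell S\<close>, so among the matrices it is
    \<open>S\<close> whose minimality is at stake.\<close>
  define S where "S = matrix_inv T"
  have "invertible T"
    using assms(3) by (simp add: invertible_det_nz)
  then have S: "T ** S = mat 1" "S ** T = mat 1"
    unfolding S_def matrix_inv_def invertible_def by (metis (mono_tags, lifting) someI_ex)+
  have detS: "det S = 1"
    using arg_cong[OF S(1), of det] assms(3) by (simp add: det_mul)
  have invS: "invertible S"
    by (simp add: invertible_det_nz detS)
  interpret K: c1_orlicz_star K \<phi>
    using assms(1,2) by unfold_locales auto
  interpret K': c1_orlicz_star K' \<phi>
    unfolding K'_def S_def[symmetric] by (rule K.lin_image_c1_orlicz_star[OF invS])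
  have F': "K'.norm.F M = K.norm.F (M ** S)" for M
    using K.F_lin_image[OF invS] by (simp add: K'_def S_def)
  have scale_mult: "(c *\<^sub>R M) ** S = c *\<^sub>R (M ** S)" for c M
    by (simp add: vec_eq_iff matrix_matrix_mult_def sum_distrib_left mult.assoc)
  \<comment> \<open>The common value of \<open>O_functional \<phi> K TB\<close> and
    \<open>O_functional \<phi> K' unit_ball\<close>, so one dilation factor serves (1), (3) and
    (4).\<close>
  define L where "L = K.norm.lux S"
  have S0: "S \<noteq> 0"
    using detS by (intro K.norm.nonzero_det) simp
  have L: "L > 0"
    unfolding L_def by (rule K.norm.lux_pos[OF S0])
  have TB: "TB = ell S"
    unfolding TB_def by (rule lin_image_unit_ball[OF S])
  have O1: "O_functional \<phi> K TB = L"
    unfolding TB L_def by (rule K.O_functional_ell) (simp add: detS)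
  have O2: "O_functional \<phi> K' unit_ball = L"
    unfolding unit_ball_eq_ell L_def
    by (simp add: K'.O_functional_ell K'.norm.lux_def K.norm.lux_def F' scale_mult)
  interpret K1: c1_orlicz_star "dilate (inverse L) K" \<phi>
    using L K.orlicz K.C1 by (intro c1_orlicz_star.intro dilate_star_bodies K.K) auto
  interpret K2: c1_orlicz_star "dilate (inverse L) K'" \<phi>
    using L K.orlicz K.C1 by (intro c1_orlicz_star.intro dilate_star_bodies K'.K) auto
  have F1: "K1.norm.F M = K.norm.F ((1 / L) *\<^sub>R M)" for M
    using K.F_dilate[of "inverse L" M] L by (simp add: inverse_eq_divide)
  have F2: "K2.norm.F M = K.norm.F ((1 / L) *\<^sub>R (M ** S))" for M
    using K'.F_dilate[of "inverse L" M] L by (simp add: inverse_eq_divide F' scale_mult)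
  \<comment> \<open>By the choice of \<open>L\<close>, the left side of the inequality is
    \<open>\<phi> 1\<close>; in (1) this means that the constraint is active at
    \<open>TB\<close>.\<close>
  let ?min = "\<forall>M. \<bar>det M\<bar> = 1 \<longrightarrow> K.norm.F ((1 / L) *\<^sub>R S) \<le> K.norm.F ((1 / L) *\<^sub>R M)"
  have "orlicz_legendre \<phi> (dilate (inverse L) K) = TB \<longleftrightarrow> ?min"
  proof -
    have "K.norm.F ((1 / L) *\<^sub>R S) = \<phi> 1"
      unfolding L_def by (rule K.norm.F_lux[OF S0])
    then show ?thesis
      using K.norm.max_det_iff_min_F[of S] K1.orlicz_legendre_eq_iff[of S]
      by (simp add: TB detS F1 flip: L_def)
  qed
  moreover have "normalized_orlicz_legendre \<phi> K = TB \<longleftrightarrow> ?min"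
    using K.norm.min_lux_iff_min_F[of S] K.normalized_orlicz_legendre_eq_iff[of S]
    by (simp add: TB detS flip: L_def)
  moreover have dia: "diamond_orlicz_legendre \<phi> (dilate (inverse L) K') = unit_ball \<longleftrightarrow>
      (\<forall>M. \<bar>det M\<bar> = 1 \<longrightarrow> K2.dual.F (mat 1) \<le> K2.dual.F M)"
    unfolding unit_ball_eq_ell by (rule K2.diamond_orlicz_legendre_eq_iff) simp
  moreover have "(\<forall>M. \<bar>det M\<bar> = 1 \<longrightarrow> K2.dual.F (mat 1) \<le> K2.dual.F M) \<longleftrightarrow> ?min"
  proof -
    have "(\<forall>M. \<bar>det M\<bar> = 1 \<longrightarrow> K2.dual.F (mat 1) \<le> K2.dual.F M) \<longleftrightarrow>
        (\<forall>M. \<bar>det M\<bar> = 1 \<longrightarrow> K.norm.F ((1 / L) *\<^sub>R S) \<le> K.norm.F ((1 / L) *\<^sub>R (M ** S)))"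
      using volume_star_body_pos[OF K2.K] by (simp add: K2.dual_F_eq_norm_F F2)
    also have "\<dots> \<longleftrightarrow> ?min"
    proof (intro iffI allI impI)
      fix M :: "real^'n^'n"
      assume *: "\<forall>M. \<bar>det M\<bar> = 1 \<longrightarrow> K.norm.F ((1 / L) *\<^sub>R S) \<le> K.norm.F ((1 / L) *\<^sub>R (M ** S))"
        and M: "\<bar>det M\<bar> = 1"
      \<comment> \<open>The competitor \<open>M ** T\<close> is used: right multiplication by
        \<open>S\<close> permutes the matrices of absolute determinant 1, with right multiplication
        by \<open>T\<close> as its inverse.\<close>
      have "M ** T ** S = M"
        by (simp add: S flip: matrix_mul_assoc)
      moreover have "\<bar>det (M ** T)\<bar> = 1"
        using M assms(3) by (simp add: det_mul)
      ultimately show "K.norm.F ((1 / L) *\<^sub>R S) \<le> K.norm.F ((1 / L) *\<^sub>R M)"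
        using * by metis
    next
      fix M :: "real^'n^'n"
      assume ?min and "\<bar>det M\<bar> = 1"
      then show "K.norm.F ((1 / L) *\<^sub>R S) \<le> K.norm.F ((1 / L) *\<^sub>R (M ** S))"
        by (simp add: det_mul detS)
    qed
    finally show ?thesis .
  qed
  ultimately show ?thesis
    unfolding O1 O2 using K2.isotropic_iff_min by blast
qed

end
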